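(* Consider the condition $$e_1+e_2-e_5-e_6=0,\qquad e_3+e_4-e_7-e_8=0 \tag{$*$}$$ on the parameters in the elliptic curve $\mathbb{T}$. The subgroup of elements in $W(E_8^{(1)})$ preserving condition $( * )$ is isomorphic to the extended affine Weyl group $\widetilde{W}(D_6^{(1)})$. One can take the generators of $W(D_6^{(1)})$ to be (the reflections in) the roots $$\beta_0=\mathcal{E}_1-\mathcal{E}_2=\alpha_0,\quad \beta_1=\mathcal{E}_5-\mathcal{E}_6=\alpha_6,\quad \beta_2=\mathcal{H}_y-\mathcal{E}_1-\mathcal{E}_5=\alpha_2+\alpha_3+\alpha_4+\alpha_5,\quad \beta_3=\mathcal{H}_x-\mathcal{H}_y=\alpha_1,$$ $$\beta_4=\mathcal{H}_y-\mathcal{E}_3-\mathcal{E}_7=\alpha_0+\alpha_2+2\alpha_3+\alpha_4+\alpha_5+\alpha_6+\alpha_7,\quad \beta_5=\mathcal{E}_3-\mathcal{E}_4=\alpha_4,\quad \beta_6=\mathcal{E}_7-\mathcal{E}_8=\alpha_8,$$ whose configuration is described by the Dynkin diagram of type $D_6^{(1)}$ with edges $\beta_0\beta_2$, $\beta_1\beta_2$, $\beta_2\beta_3$, $\beta_3\beta_4$, $\beta_4\beta_5$, $\beta_4\beta_6$. The extended affine Weyl group is $\widetilde{W}(D_6^{(1)})=\operatorname{Aut}(D_6^{(1)})\ltimes W(D_6^{(1)})$, where the group of $D_6^{(1)}$ Dynkin diagram automorphisms is isomorphic to the dihedral group $$\operatorname{Aut}(D_6^{(1)})\simeq\mathbb{D}_4=\langle\sigma_1,\sigma_2\mid\sigma_1^4=\sigma_2^2=(\sigma_2\sigma_1)^2=e\rangle,$$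 with the generating automorphisms $\sigma_1$ and $\sigma_2$, written in the standard cycle notation, given by $$\sigma_1=(\beta_0\beta_5\beta_1\beta_6)(\beta_2\beta_4)=(\mathcal{E}_1\mathcal{E}_3\mathcal{E}_5\mathcal{E}_7)(\mathcal{E}_2\mathcal{E}_4\mathcal{E}_6\mathcal{E}_8),$$ $$\sigma_2=(\beta_0\beta_1)=(\mathcal{E}_1\mathcal{E}_5)(\mathcal{E}_2\mathcal{E}_6)(\mathcal{E}_3\mathcal{E}_7)(\mathcal{E}_4\mathcal{E}_8).$$ The induced action $\varphi^*$ is $$\varphi^*:(\bar\beta_0,\ldots,\bar\beta_6)\mapsto(-\beta_5,\,-\beta_6,\,-\beta_3-\beta_4,\,\beta_3+2\beta_4+\beta_5+\beta_6,\,\beta_0+\beta_1+\beta_2+\beta_3,\,-\beta_0,\,-\beta_1),$$ which is not a translation on the sublattice $Q_B=\operatorname{Span}_{\mathbb{Z}}\{\beta_0,\dots,\beta_6\}$, but $(\varphi^2)^*$ is: $$(\varphi^2)^*:(\bar\beta_0,\ldots,\bar\beta_6)\mapsto(\beta_0,\ldots,\beta_6)+(0,0,-1,1,0,0,0)\,\delta,$$ where $\delta$ can be represented in terms of the simple roots $\beta_i$ as $\delta=-\mathcal{K}_{\mathcal{X}}=\beta_0+\beta_1+2\beta_2+2\beta_3+2\beta_4+\beta_5+\beta_6$. The actions of the push-forwards $\varphi_*$ and $(\varphi^2)_*$ on $\operatorname{Pic}(\mathcal{X})$ can be written in terms of the generators of $\widetilde{W}(D_6^{(1)})$ as $$\varphi_*=\sigma_1^3\,w_{\beta_6}w_{\beta_5}w_{\beta_3}\,w_{\beta_2}w_{\beta_1}w_{\beta_0}\,w_{\beta_2}w_{\beta_1}w_{\beta_0},$$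 $$(\varphi^2)_*=\sigma_1^2\,w_{\beta_3}w_{\beta_4}w_{\beta_6}\,w_{\beta_5}w_{\beta_4}w_{\beta_3}\,w_{\beta_2}w_{\beta_1}w_{\beta_0}\,w_{\beta_2},$$ where $\sigma_1^2$ is the reflection symmetry of the Dynkin diagram exchanging $\beta_0$ with $\beta_1$ and $\beta_5$ with $\beta_6$.
   Context: Lattice. $\mathcal{X}$ is a rational surface obtained from $\mathbb{P}^1\times\mathbb{P}^1$ by blowing up eight points; $\operatorname{Pic}(\mathcal{X})=\mathbb{Z}\mathcal{H}_x\oplus\mathbb{Z}\mathcal{H}_y\oplus\bigoplus_{i=1}^8\mathbb{Z}\mathcal{E}_i$ with intersection form $\mathcal{H}_x^2=\mathcal{H}_y^2=\mathcal{H}_x\bullet\mathcal{E}_i=\mathcal{H}_y\bullet\mathcal{E}_i=0$, $\mathcal{H}_x\bullet\mathcal{H}_y=1$, $\mathcal{E}_i\bullet\mathcal{E}_j=-\delta_{ij}$, and $\delta=-\mathcal{K}_{\mathcal{X}}=2\mathcal{H}_x+2\mathcal{H}_y-\sum_{i=1}^8\mathcal{E}_i$ is the anti-canonical class. The Picard lattices of all surfaces in the family are identified via these bases; a bar denotes the same element in the Picard lattice of the target surface $\bar{\mathcal{X}}$. $W(E_8^{(1)})$ is the affine Weyl group acting on $\operatorname{Pic}(\mathcal{X})$ generated by the reflections $\mathcal{D}\mapsto\mathcal{D}+(\alpha_i\bullet\mathcal{D})\alpha_i$ in the simple roots $\alpha_0=\mathcal{E}_1-\mathcal{E}_2$, $\alpha_1=\mathcal{H}_x-\mathcal{H}_y$,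 $\alpha_2=\mathcal{H}_y-\mathcal{E}_1-\mathcal{E}_2$, $\alpha_3=\mathcal{E}_2-\mathcal{E}_3$, $\alpha_4=\mathcal{E}_3-\mathcal{E}_4$, $\alpha_5=\mathcal{E}_4-\mathcal{E}_5$, $\alpha_6=\mathcal{E}_5-\mathcal{E}_6$, $\alpha_7=\mathcal{E}_6-\mathcal{E}_7$, $\alpha_8=\mathcal{E}_7-\mathcal{E}_8$. Similarly $w_{\beta_i}$ is the reflection $\mathcal{D}\mapsto\mathcal{D}+(\beta_i\bullet\mathcal{D})\beta_i$. The permutations of the $\mathcal{E}_i$ given in cycle notation fix $\mathcal{H}_x$ and $\mathcal{H}_y$. Parameters and the condition. $\mathbb{T}=\mathbb{C}/(\mathbb{Z}+\mathbb{Z}\tau)$ is an elliptic curve with its group structure, embedded by $\iota$ as an anti-canonical curve of $\mathcal{X}$; this gives a pull-back $\iota^*:\operatorname{Pic}(\mathcal{X})\to\operatorname{Pic}(\mathbb{T})$, and, identifying divisor classes on $\mathbb{T}$ with points of $\mathbb{T}$ by summation, $e_i=\iota^*(\mathcal{E}_i)$, $h_x=\iota^*(\mathcal{H}_x)$, $h_y=\iota^*(\mathcal{H}_y)$ are points of $\mathbb{T}$; these are the parameters. An element $w\in W(E_8^{(1)})$ with pull-back action $w^*$ transforms the parameters by $\bar e_i=\iota^*(w^*(\bar{\mathcal{E}}_i))$, $\bar h_x=\iota^*(w^*(\bar{\mathcal{H}}_x))$, $\bar h_y=\iota^*(w^*(\bar{\mathcal{H}}_y))$. It preserves $( * )$ if,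 for (generic) parameter values satisfying $( * )$, the transformed parameters $\bar e_i$ also satisfy $( * )$. The mapping $\varphi$. $\varphi:\mathcal{X}\to\bar{\mathcal{X}}$ is the isomorphism (a deautonomized half of a QRT map, for a smooth elliptic fiber) whose pull-back action $\varphi^*$ on the Picard lattice is $$\bar{\mathcal{H}}_x\mapsto 2\mathcal{H}_x+\mathcal{H}_y-\mathcal{E}_3-\mathcal{E}_4-\mathcal{E}_7-\mathcal{E}_8,\quad \bar{\mathcal{H}}_y\mapsto\mathcal{H}_x,$$ $$\bar{\mathcal{E}}_1\mapsto\mathcal{H}_x-\mathcal{E}_3,\ \bar{\mathcal{E}}_2\mapsto\mathcal{H}_x-\mathcal{E}_4,\ \bar{\mathcal{E}}_3\mapsto\mathcal{E}_2,\ \bar{\mathcal{E}}_4\mapsto\mathcal{E}_1,\ \bar{\mathcal{E}}_5\mapsto\mathcal{H}_x-\mathcal{E}_7,\ \bar{\mathcal{E}}_6\mapsto\mathcal{H}_x-\mathcal{E}_8,\ \bar{\mathcal{E}}_7\mapsto\mathcal{E}_6,\ \bar{\mathcal{E}}_8\mapsto\mathcal{E}_5,$$ and whose push-forward action $\varphi_*=(\varphi^* )^{-1}$ is $$\mathcal{H}_x\mapsto\bar{\mathcal{H}}_y,\quad \mathcal{H}_y\mapsto\bar{\mathcal{H}}_x+2\bar{\mathcal{H}}_y-\bar{\mathcal{E}}_1-\bar{\mathcal{E}}_2-\bar{\mathcal{E}}_5-\bar{\mathcal{E}}_6,$$ $$\mathcal{E}_1\mapsto\bar{\mathcal{E}}_4,\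 \mathcal{E}_2\mapsto\bar{\mathcal{E}}_3,\ \mathcal{E}_3\mapsto\bar{\mathcal{H}}_y-\bar{\mathcal{E}}_1,\ \mathcal{E}_4\mapsto\bar{\mathcal{H}}_y-\bar{\mathcal{E}}_2,\ \mathcal{E}_5\mapsto\bar{\mathcal{E}}_8,\ \mathcal{E}_6\mapsto\bar{\mathcal{E}}_7,\ \mathcal{E}_7\mapsto\bar{\mathcal{H}}_y-\bar{\mathcal{E}}_5,\ \mathcal{E}_8\mapsto\bar{\mathcal{H}}_y-\bar{\mathcal{E}}_6.$$ Under the identification of Picard lattices, $(\varphi^2)^*$ and $(\varphi^2)_*$ are the squares of these linear maps. A lattice map is called a translation on $Q_B$ if it has the form $\bar\beta_i\mapsto\beta_i+k_i\delta$ with $k_i\in\mathbb{Z}$.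
   Formalization: σ2 is taken as (E1E5)(E2E6), since the printed permutation equals σ1² and also exchanges β5 and β6; the printed words, composed right to left, equal φ^* and (φ²)^*, so they are asserted for these, and φ_*, (φ²)_* are given by the inverse words. *)

theory Defs
  imports
    "HOL-Analysis.Analysis"
    "HOL-Algebra.Elementary_Groups"
    "HOL-Algebra.FiniteProduct"
    "HOL-Algebra.Bij"
    "HOL-Combinatorics.Cycles"
begin

section \<open>Groups given by generators and relations\<close>

text \<open>
  A letter \<open>(x, True)\<close> stands for the generator \<open>x\<close>, a letter \<open>(x, False)\<close> for its inverse.
  The relators in \<open>R\<close> are the words that are set equal to the identity.
\<close>

inductive word_eq :: "('g \<times> bool) list set \<Rightarrow> ('g \<times> bool) list \<Rightarrow> ('g \<times> bool) list \<Rightarrow> bool"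
  for R where
  refl: "word_eq R u u"
| sym: "word_eq R u v \<Longrightarrow> word_eq R v u"
| trans: "word_eq R u v \<Longrightarrow> word_eq R v w \<Longrightarrow> word_eq R u w"
| cancel: "word_eq R (u @ [(x, b), (x, \<not> b)] @ v) (u @ v)"
| relator: "r \<in> R \<Longrightarrow> word_eq R (u @ r @ v) (u @ v)"

definition word_class :: "('g \<times> bool) list set \<Rightarrow> ('g \<times> bool) list \<Rightarrow> ('g \<times> bool) list set" where
  "word_class R u = {v. word_eq R u v}"

definition presented_group :: "('g \<times> bool) list set \<Rightarrow> ('g \<times> bool) list set monoid" where
  "presented_group R =
     \<lparr>carrier = range (word_class R),
      mult = (\<lambda>A B. \<Union>u\<in>A. \<Union>v\<in>B. word_class R (u @ v)),
      one = word_class R []\<rparr>"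

datatype dihedral_gen = S1 | S2

abbreviation gen_word :: "'g \<Rightarrow> ('g \<times> bool) list" where
  "gen_word x \<equiv> [(x, True)]"

definition dihedral_D4 :: "(dihedral_gen \<times> bool) list set" where
  "dihedral_D4 =
     {concat (replicate 4 (gen_word S1)),
      concat (replicate 2 (gen_word S2)),
      concat (replicate 2 (gen_word S2 @ gen_word S1))}"


section \<open>Extended Weyl group of a simply laced Dynkin diagram\<close>

text \<open>
  A simply laced diagram on the nodes \<open>'n\<close> is given by its set of edges.  Its Weyl group is
  generated by the simple reflections on the root lattice, whose elements are written in the basis
  of simple roots.
\<close>

definition cartan :: "'n set set \<Rightarrow> 'n \<Rightarrow> 'n \<Rightarrow> int" where
  "cartan edges i j = (if i = j then 2 else if {i, j} \<in> edges then - 1 else 0)"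

definition simple_reflection :: "'n::finite set set \<Rightarrow> 'n \<Rightarrow> int ^ 'n \<Rightarrow> int ^ 'n" where
  "simple_reflection edges i c = c - (\<Sum>j\<in>UNIV. cartan edges i j * c $ j) *s axis i 1"

definition weyl_group :: "'n::finite set set \<Rightarrow> (int ^ 'n \<Rightarrow> int ^ 'n) monoid" where
  "weyl_group edges = subgroup_generated (BijGroup UNIV) (range (simple_reflection edges))"

definition diagram_aut_group :: "'n set set \<Rightarrow> ('n \<Rightarrow> 'n) monoid" where
  "diagram_aut_group edges =
     (BijGroup UNIV)\<lparr>carrier := {\<pi>. bij \<pi> \<and> (\<forall>i j. {\<pi> i, \<pi> j} \<in> edges \<longleftrightarrow> {i, j} \<in> edges)}\<rparr>"

text \<open>The linear map that sends the basis vector at \<open>i\<close> to the basis vector at \<open>\<pi> i\<close>.\<close>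

definition permute_basis :: "('n \<Rightarrow> 'n) \<Rightarrow> int ^ 'n \<Rightarrow> int ^ 'n" where
  "permute_basis \<pi> c = (\<chi> i. c $ inv_into UNIV \<pi> i)"

text \<open>In \<open>A \<ltimes> N\<close> the pair \<open>(a, n)\<close> stands for the product \<open>n a\<close>, and \<open>a n a\<^sup>-\<^sup>1 = \<theta> a n\<close>.\<close>

definition semidirect_product ::
  "('a, 'c) monoid_scheme \<Rightarrow> ('a \<Rightarrow> 'b \<Rightarrow> 'b) \<Rightarrow> ('b, 'd) monoid_scheme \<Rightarrow> ('a \<times> 'b) monoid" where
  "semidirect_product A \<theta> N =
     \<lparr>carrier = carrier A \<times> carrier N,
      mult = (\<lambda>(a, n) (a', n'). (a \<otimes>\<^bsub>A\<^esub> a', n \<otimes>\<^bsub>N\<^esub> \<theta> a n')),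
      one = (\<one>\<^bsub>A\<^esub>, \<one>\<^bsub>N\<^esub>)\<rparr>"

definition extended_weyl_group ::
  "'n::finite set set \<Rightarrow> (('n \<Rightarrow> 'n) \<times> (int ^ 'n \<Rightarrow> int ^ 'n)) monoid" where
  "extended_weyl_group edges =
     semidirect_product (diagram_aut_group edges)
       (\<lambda>\<pi> w. permute_basis \<pi> \<circ> w \<circ> permute_basis (inv_into UNIV \<pi>))
       (weyl_group edges)"

datatype d6_node = N0 | N1 | N2 | N3 | N4 | N5 | N6

instance d6_node :: finite
proof
  show "finite (UNIV :: d6_node set)"
    by (rule finite_subset[of _ "{N0, N1, N2, N3, N4, N5, N6}"]) (auto intro: d6_node.exhaust)
qed

definition d6_edges :: "d6_node set set" where
  "d6_edges = {{N0, N2}, {N1, N2}, {N2, N3}, {N3, N4}, {N4, N5}, {N4, N6}}"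

definition sigma1_node :: "d6_node \<Rightarrow> d6_node" where
  "sigma1_node = cycle_of_list [N0, N5, N1, N6] \<circ> cycle_of_list [N2, N4]"

definition sigma2_node :: "d6_node \<Rightarrow> d6_node" where
  "sigma2_node = cycle_of_list [N0, N1]"


section \<open>The Picard lattice\<close>

datatype pic_gen = HX | HY | E1 | E2 | E3 | E4 | E5 | E6 | E7 | E8

instance pic_gen :: finite
proof
  show "finite (UNIV :: pic_gen set)"
    by (rule finite_subset[of _ "{HX, HY, E1, E2, E3, E4, E5, E6, E7, E8}"])
      (auto intro: pic_gen.exhaust)
qed

type_synonym pic = "int ^ pic_gen"

abbreviation cls :: "pic_gen \<Rightarrow> pic" where
  "cls g \<equiv> axis g 1"

definition intersection :: "pic \<Rightarrow> pic \<Rightarrow> int" (infixl "\<odot>" 70) where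
  "C \<odot> D = C $ HX * D $ HY + C $ HY * D $ HX - (\<Sum>g\<in>UNIV - {HX, HY}. C $ g * D $ g)"

definition delta :: pic where
  "delta = 2 *s cls HX + 2 *s cls HY - (\<Sum>g\<in>UNIV - {HX, HY}. cls g)"

definition reflection :: "pic \<Rightarrow> pic \<Rightarrow> pic" where
  "reflection r D = D + (r \<odot> D) *s r"

definition alpha :: "nat \<Rightarrow> pic" where
  "alpha i =
     [cls E1 - cls E2, cls HX - cls HY, cls HY - cls E1 - cls E2, cls E2 - cls E3,
      cls E3 - cls E4, cls E4 - cls E5, cls E5 - cls E6, cls E6 - cls E7, cls E7 - cls E8] ! i"

definition W_E8 :: "(pic \<Rightarrow> pic) monoid" where
  "W_E8 = subgroup_generated (BijGroup UNIV) ((\<lambda>i. reflection (alpha i)) ` {0..8})"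

fun beta :: "d6_node \<Rightarrow> pic" where
  "beta N0 = cls E1 - cls E2"
| "beta N1 = cls E5 - cls E6"
| "beta N2 = cls HY - cls E1 - cls E5"
| "beta N3 = cls HX - cls HY"
| "beta N4 = cls HY - cls E3 - cls E7"
| "beta N5 = cls E3 - cls E4"
| "beta N6 = cls E7 - cls E8"

definition sigma1 :: "pic \<Rightarrow> pic" where
  "sigma1 = permute_basis (cycle_of_list [E1, E3, E5, E7] \<circ> cycle_of_list [E2, E4, E6, E8])"

text \<open>
  The lattice map that transposes \<open>\<beta>\<^sub>0\<close> and \<open>\<beta>\<^sub>1\<close> and fixes the other simple roots.  The longer
  product \<open>(E\<^sub>1 E\<^sub>5) (E\<^sub>2 E\<^sub>6) (E\<^sub>3 E\<^sub>7) (E\<^sub>4 E\<^sub>8)\<close> is \<open>\<sigma>\<^sub>1\<^sup>2\<close>; it exchanges \<open>\<beta>\<^sub>5\<close> and \<open>\<beta>\<^sub>6\<close> as well.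
\<close>

definition sigma2 :: "pic \<Rightarrow> pic" where
  "sigma2 = permute_basis (cycle_of_list [E1, E5] \<circ> cycle_of_list [E2, E6])"

definition linear_extension :: "(pic_gen \<Rightarrow> pic) \<Rightarrow> pic \<Rightarrow> pic" where
  "linear_extension f D = (\<Sum>g\<in>UNIV. D $ g *s f g)"

fun phi_pull_gen :: "pic_gen \<Rightarrow> pic" where
  "phi_pull_gen HX = 2 *s cls HX + cls HY - cls E3 - cls E4 - cls E7 - cls E8"
| "phi_pull_gen HY = cls HX"
| "phi_pull_gen E1 = cls HX - cls E3"
| "phi_pull_gen E2 = cls HX - cls E4"
| "phi_pull_gen E3 = cls E2"
| "phi_pull_gen E4 = cls E1"
| "phi_pull_gen E5 = cls HX - cls E7"
| "phi_pull_gen E6 = cls HX - cls E8"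
| "phi_pull_gen E7 = cls E6"
| "phi_pull_gen E8 = cls E5"

fun phi_push_gen :: "pic_gen \<Rightarrow> pic" where
  "phi_push_gen HX = cls HY"
| "phi_push_gen HY = cls HX + 2 *s cls HY - cls E1 - cls E2 - cls E5 - cls E6"
| "phi_push_gen E1 = cls E4"
| "phi_push_gen E2 = cls E3"
| "phi_push_gen E3 = cls HY - cls E1"
| "phi_push_gen E4 = cls HY - cls E2"
| "phi_push_gen E5 = cls E8"
| "phi_push_gen E6 = cls E7"
| "phi_push_gen E7 = cls HY - cls E5"
| "phi_push_gen E8 = cls HY - cls E6"

definition phi_pull :: "pic \<Rightarrow> pic" where
  "phi_pull = linear_extension phi_pull_gen"

definition phi_push :: "pic \<Rightarrow> pic" where
  "phi_push = linear_extension phi_push_gen"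

definition is_translation_QB :: "(pic \<Rightarrow> pic) \<Rightarrow> bool" where
  "is_translation_QB f \<longleftrightarrow> (\<forall>i. \<exists>k. f (beta i) = beta i + k *s delta)"

lemma UNIV_pic_gen: "(UNIV :: pic_gen set) = {HX, HY, E1, E2, E3, E4, E5, E6, E7, E8}"
  by (auto intro: pic_gen.exhaust)

lemma all_pic_gen:
  "(\<forall>g. P g) \<longleftrightarrow> P HX \<and> P HY \<and> P E1 \<and> P E2 \<and> P E3 \<and> P E4 \<and> P E5 \<and> P E6 \<and> P E7 \<and> P E8"
  by (auto intro: pic_gen.induct)

lemma phi_push_pull_inverse: "phi_push \<circ> phi_pull = id" "phi_pull \<circ> phi_push = id"
  by (simp_all add: fun_eq_iff vec_eq_iff phi_push_def phi_pull_def linear_extension_def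
      UNIV_pic_gen axis_def all_pic_gen)


section \<open>Parameters on the elliptic curve\<close>

definition complex_group :: "complex monoid" where
  "complex_group = \<lparr>carrier = UNIV, mult = (+), one = 0\<rparr>"

definition period_lattice :: "complex \<Rightarrow> complex set" where
  "period_lattice \<tau> = {of_int m + of_int n * \<tau> | m n. True}"

text \<open>The group law of the elliptic curve is written multiplicatively below.\<close>

definition torus :: "complex \<Rightarrow> complex set monoid" where
  "torus \<tau> = complex_group Mod period_lattice \<tau>"

text \<open>
  The quotient topology: for a set \<open>U\<close> of cosets, \<open>\<Union>U\<close> is its preimage in the complex plane.
\<close>

definition torus_topology :: "complex \<Rightarrow> complex set topology" where
  "torus_topology \<tau> = topology (\<lambda>U. U \<subseteq> carrier (torus \<tau>) \<and> open (\<Union>U))"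

text \<open>
  Parameter values \<open>(h\<^sub>x, h\<^sub>y, e\<^sub>1, \<dots>, e\<^sub>8)\<close> are functions from \<^typ>\<open>pic_gen\<close> to the curve.  They
  determine the homomorphism \<open>\<iota>\<^sup>*\<close> from the Picard lattice (followed by summation) to the curve.
\<close>

definition iota_pull :: "complex \<Rightarrow> (pic_gen \<Rightarrow> complex set) \<Rightarrow> pic \<Rightarrow> complex set" where
  "iota_pull \<tau> p D = finprod (torus \<tau>) (\<lambda>g. p g [^]\<^bsub>torus \<tau>\<^esub> (D $ g)) UNIV"

definition star_condition :: "complex \<Rightarrow> (pic_gen \<Rightarrow> complex set) \<Rightarrow> bool" where
  "star_condition \<tau> p \<longleftrightarrow>
     p E1 \<otimes>\<^bsub>torus \<tau>\<^esub> p E2 \<otimes>\<^bsub>torus \<tau>\<^esub> inv\<^bsub>torus \<tau>\<^esub> (p E5) \<otimes>\<^bsub>torus \<tau>\<^esub> inv\<^bsub>torus \<tau>\<^esub> (p E6) = \<one>\<^bsub>torus \<tau>\<^esub> \<and>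
     p E3 \<otimes>\<^bsub>torus \<tau>\<^esub> p E4 \<otimes>\<^bsub>torus \<tau>\<^esub> inv\<^bsub>torus \<tau>\<^esub> (p E7) \<otimes>\<^bsub>torus \<tau>\<^esub> inv\<^bsub>torus \<tau>\<^esub> (p E8) = \<one>\<^bsub>torus \<tau>\<^esub>"

text \<open>The space of all parameter values that satisfy the condition.\<close>

definition star_space :: "complex \<Rightarrow> (pic_gen \<Rightarrow> complex set) topology" where
  "star_space \<tau> =
     subtopology (product_topology (\<lambda>_. torus_topology \<tau>) UNIV) {p. star_condition \<tau> p}"

text \<open>
  A property of the points of a space holds generically if it holds on the intersection of
  countably many dense open sets.
\<close>

definition generically :: "'a topology \<Rightarrow> ('a \<Rightarrow> bool) \<Rightarrow> bool" where
  "generically X P \<longleftrightarrow>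
     (\<exists>\<U>. countable \<U> \<and>
          (\<forall>U\<in>\<U>. openin X U \<and> X closure_of U = topspace X) \<and>
          (\<forall>p\<in>topspace X \<inter> \<Inter>\<U>. P p))"

text \<open>
  A group element \<open>w\<close> is identified with its push-forward action, so its pull-back action is the
  inverse map.
\<close>

definition transform_params ::
  "complex \<Rightarrow> (pic \<Rightarrow> pic) \<Rightarrow> (pic_gen \<Rightarrow> complex set) \<Rightarrow> pic_gen \<Rightarrow> complex set" where
  "transform_params \<tau> w p g = iota_pull \<tau> p (inv_into UNIV w (cls g))"

definition preserving_star :: "complex \<Rightarrow> (pic \<Rightarrow> pic) set" where
  "preserving_star \<tau> =
     {w \<in> carrier W_E8. generically (star_space \<tau>) (\<lambda>p. star_condition \<tau> (transform_params \<tau> w p))}"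

lemma normal_period_lattice: "period_lattice \<tau> \<lhd> complex_group"
proof -
  interpret comm_group complex_group
    by (rule comm_groupI) (auto simp: complex_group_def intro!: exI[of _ "- x" for x])
  have inv: "inv\<^bsub>complex_group\<^esub> x = - x" for x
    by (rule inv_equality) (auto simp: complex_group_def)
  have "subgroup (period_lattice \<tau>) complex_group"
  proof (rule subgroupI)
    show "period_lattice \<tau> \<subseteq> carrier complex_group"
      by (simp add: complex_group_def)
    show "period_lattice \<tau> \<noteq> {}"
      by (auto simp: period_lattice_def)
  next
    fix a assume "a \<in> period_lattice \<tau>"
    then obtain m n where "a = of_int m + of_int n * \<tau>" by (auto simp: period_lattice_def)
    then have "- a = of_int (- m) + of_int (- n) * \<tau>" by simp
    then show "inv\<^bsub>complex_group\<^esub> a \<in> period_lattice \<tau>"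
      unfolding inv period_lattice_def by blast
  next
    fix a b assume "a \<in> period_lattice \<tau>" "b \<in> period_lattice \<tau>"
    then obtain m n m' n' where "a = of_int m + of_int n * \<tau>" "b = of_int m' + of_int n' * \<tau>"
      by (auto simp: period_lattice_def)
    then have "a + b = of_int (m + m') + of_int (n + n') * \<tau>" by (simp add: algebra_simps)
    then show "a \<otimes>\<^bsub>complex_group\<^esub> b \<in> period_lattice \<tau>"
      unfolding complex_group_def period_lattice_def monoid.simps by blast
  qed
  then show ?thesis by (rule subgroup_imp_normal)
qed

lemma istopology_torus: "istopology (\<lambda>U. U \<subseteq> carrier (torus \<tau>) \<and> open (\<Union>U))"
proof -
  interpret normal "period_lattice \<tau>" complex_group by (rule normal_period_lattice)
  have disj: "A = B" if "A \<in> carrier (torus \<tau>)" "B \<in> carrier (torus \<tau>)" "z \<in> A" "z \<in> B" for A B z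
    using that rcos_disjoint[OF is_subgroup] unfolding torus_def FactGroup_def pairwise_def disjnt_def
    by auto
  have int: "\<Union>(S \<inter> T) = \<Union>S \<inter> \<Union>T" if "S \<subseteq> carrier (torus \<tau>)" "T \<subseteq> carrier (torus \<tau>)" for S T
  proof
    show "\<Union>S \<inter> \<Union>T \<subseteq> \<Union>(S \<inter> T)"
      using that disj by blast
  qed auto
  have un: "\<Union>(\<Union>\<K>) = (\<Union>K\<in>\<K>. \<Union>K)" for \<K> :: "complex set set set"
    by auto
  show ?thesis
    unfolding istopology_def by (auto simp: int un intro!: open_Int open_UN)
qed

lemma openin_torus_topology:
  "openin (torus_topology \<tau>) U \<longleftrightarrow> U \<subseteq> carrier (torus \<tau>) \<and> open (\<Union>U)"
  by (simp add: torus_topology_def topology_inverse'[OF istopology_torus])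

end

theory Submission
  imports Defs
begin

text \<open>
  Let \<open>star1\<close> and \<open>star2\<close> be the classes \<open>E\<^sub>1 + E\<^sub>2 - E\<^sub>5 - E\<^sub>6\<close> and \<open>E\<^sub>3 + E\<^sub>4 - E\<^sub>7 - E\<^sub>8\<close>, and let
  \<open>L\<close> be their span. Parameters are a homomorphism from the Picard lattice to the curve, and the
  condition says that this homomorphism kills \<open>L\<close>. A class outside \<open>L\<close> is not killed by generic
  parameters of this kind (\<open>generic_class_in_star_span\<close>, a Baire argument). Hence \<open>w\<close> preserves the
  condition iff \<open>w\<^sup>-\<^sup>1\<close> maps \<open>L\<close> into itself. As \<open>L\<close> is negative definite with only the four vectors
  \<open>\<plusminus>star1\<close>, \<open>\<plusminus>star2\<close> of square \<open>-4\<close>, this means that \<open>w\<close> permutes these four vectors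
  (\<open>preserving_star_eq\<close>).

  Such a \<open>w\<close> acts on the orthogonal complement of \<open>L\<close> and \<open>\<delta>\<close>, which is exactly \<open>Q\<^sub>B\<close>
  (\<open>range_root_embed\<close>). This restriction is the link to the Weyl group of type \<open>D\<^sub>6\<^sup>(\<^sup>1\<^sup>)\<close>:

  \<^item> It loses nothing (\<open>star_stabilizer_eqI\<close>). Over the rationals, \<open>Q\<^sub>B\<close> and \<open>L\<close> span the complement of
    \<open>\<delta>\<close>, but the Picard lattice contains halves such as \<open>E\<^sub>1 - E\<^sub>6 = (star1 + \<beta>\<^sub>0 + \<beta>\<^sub>1) / 2\<close>, and this
    gluing forces an automorphism that fixes \<open>Q\<^sub>B\<close> to fix \<open>L\<close> as well (\<open>fixes_beta_imp_id\<close>).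
  \<^item> It lands in the extended Weyl group (\<open>star_stabilizer_decomposition\<close>). A class that pairs to one
    with every \<open>\<beta>\<^sub>i\<close> serves as Weyl vector. Its image under \<open>w\<close> can be made dominant again by
    reflections (\<open>dominant_in_orbit\<close>), and an automorphism that keeps it dominant permutes the
    simple roots, since each root is a nonnegative or a nonpositive combination of them
    (\<open>preserves_simple_roots\<close>).
  \<^item> It reaches every pair of a Weyl group element and a diagram automorphism
    (\<open>extended_element_extends\<close>): the reflections in the \<open>\<beta>\<^sub>i\<close> are conjugate to simple ones in
    \<open>W(E\<^sub>8\<^sup>(\<^sup>1\<^sup>))\<close>, and \<open>\<sigma>\<^sub>1\<close>, \<open>\<sigma>\<^sub>2\<close> are products of transpositions of the \<open>E\<^sub>i\<close>.

  The isomorphism sends a pair to the unique element of the stabilizer that extends it, so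
  multiplicativity is automatic. Injectivity amounts to the fact that a nontrivial diagram
  automorphism is not in the Weyl group: the reflections in the \<open>\<beta>\<^sub>i\<close> fix \<open>star1\<close> and \<open>star2\<close>, whereas
  the eight products \<open>\<sigma>\<^sub>1\<^sup>i \<sigma>\<^sub>2\<^sup>j\<close> permute \<open>\<plusminus>star1\<close>, \<open>\<plusminus>star2\<close> in eight different ways. The presentation
  of the dihedral group is proved by reduction to the normal forms \<open>s\<^sub>1\<^sup>i s\<^sub>2\<^sup>j\<close>, and the statements
  on \<open>\<phi>\<close> are computations in coordinates.
\<close>

section \<open>Coordinates on the Picard lattice\<close>

text \<open>
  A normal form for computations: explicit identities between classes are proved by rewriting
  both sides to it.
\<close>

definition pv :: "int \<Rightarrow> int \<Rightarrow> int \<Rightarrow> int \<Rightarrow> int \<Rightarrow> int \<Rightarrow> int \<Rightarrow> int \<Rightarrow> int \<Rightarrow> int \<Rightarrow> pic" where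
  "pv a b c1 c2 c3 c4 c5 c6 c7 c8 =
     (\<chi> g. case g of HX \<Rightarrow> a | HY \<Rightarrow> b | E1 \<Rightarrow> c1 | E2 \<Rightarrow> c2 | E3 \<Rightarrow> c3 | E4 \<Rightarrow> c4
                  | E5 \<Rightarrow> c5 | E6 \<Rightarrow> c6 | E7 \<Rightarrow> c7 | E8 \<Rightarrow> c8)"

lemma pv_nth [simp]:
  "pv a b c1 c2 c3 c4 c5 c6 c7 c8 $ HX = a" "pv a b c1 c2 c3 c4 c5 c6 c7 c8 $ HY = b"
  "pv a b c1 c2 c3 c4 c5 c6 c7 c8 $ E1 = c1" "pv a b c1 c2 c3 c4 c5 c6 c7 c8 $ E2 = c2"
  "pv a b c1 c2 c3 c4 c5 c6 c7 c8 $ E3 = c3" "pv a b c1 c2 c3 c4 c5 c6 c7 c8 $ E4 = c4"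
  "pv a b c1 c2 c3 c4 c5 c6 c7 c8 $ E5 = c5" "pv a b c1 c2 c3 c4 c5 c6 c7 c8 $ E6 = c6"
  "pv a b c1 c2 c3 c4 c5 c6 c7 c8 $ E7 = c7" "pv a b c1 c2 c3 c4 c5 c6 c7 c8 $ E8 = c8"
  by (simp_all add: pv_def)

lemma pic_eq_iff:
  "C = D \<longleftrightarrow> C $ HX = D $ HX \<and> C $ HY = D $ HY \<and> C $ E1 = D $ E1 \<and> C $ E2 = D $ E2 \<and>
     C $ E3 = D $ E3 \<and> C $ E4 = D $ E4 \<and> C $ E5 = D $ E5 \<and> C $ E6 = D $ E6 \<and>
     C $ E7 = D $ E7 \<and> C $ E8 = D $ E8" for C D :: pic
  by (simp add: vec_eq_iff all_pic_gen)

lemma pic_cases [cases type]: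
  obtains a b c1 c2 c3 c4 c5 c6 c7 c8 where "D = pv a b c1 c2 c3 c4 c5 c6 c7 c8"
proof -
  have "D = pv (D $ HX) (D $ HY) (D $ E1) (D $ E2) (D $ E3) (D $ E4) (D $ E5) (D $ E6) (D $ E7) (D
    $ E8)"
    by (simp add: pic_eq_iff)
  then show ?thesis by (rule that)
qed

lemma pic_fun_eqI:
  fixes f g :: "pic \<Rightarrow> pic"
  assumes "\<And>a b c1 c2 c3 c4 c5 c6 c7 c8.
      f (pv a b c1 c2 c3 c4 c5 c6 c7 c8) = g (pv a b c1 c2 c3 c4 c5 c6 c7 c8)"
  shows "f = g"
  using assms by (metis ext pic_cases)

lemma pv_eq_iff:
  "pv a b c1 c2 c3 c4 c5 c6 c7 c8 = pv a' b' d1 d2 d3 d4 d5 d6 d7 d8 \<longleftrightarrow>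
     a = a' \<and> b = b' \<and> c1 = d1 \<and> c2 = d2 \<and> c3 = d3 \<and> c4 = d4 \<and> c5 = d5 \<and> c6 = d6 \<and> c7 = d7 \<and> c8 = d8"
  by (simp add: pic_eq_iff)

lemma pv_arith:
  "pv a b c1 c2 c3 c4 c5 c6 c7 c8 + pv a' b' d1 d2 d3 d4 d5 d6 d7 d8 =
   pv (a + a') (b + b') (c1 + d1) (c2 + d2) (c3 + d3) (c4 + d4) (c5 + d5) (c6 + d6) (c7 + d7) (c8 + d8)"
  "pv a b c1 c2 c3 c4 c5 c6 c7 c8 - pv a' b' d1 d2 d3 d4 d5 d6 d7 d8 =
   pv (a - a') (b - b') (c1 - d1) (c2 - d2) (c3 - d3) (c4 - d4) (c5 - d5) (c6 - d6) (c7 - d7) (c8 - d8)"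
  "- pv a b c1 c2 c3 c4 c5 c6 c7 c8 = pv (- a) (- b) (- c1) (- c2) (- c3) (- c4) (- c5) (- c6) (-
    c7) (- c8)"
  "k *s pv a b c1 c2 c3 c4 c5 c6 c7 c8 =
   pv (k * a) (k * b) (k * c1) (k * c2) (k * c3) (k * c4) (k * c5) (k * c6) (k * c7) (k * c8)"
  by (simp_all add: pic_eq_iff)

lemma cls_pv:
  "cls HX = pv 1 0 0 0 0 0 0 0 0 0" "cls HY = pv 0 1 0 0 0 0 0 0 0 0"
  "cls E1 = pv 0 0 1 0 0 0 0 0 0 0" "cls E2 = pv 0 0 0 1 0 0 0 0 0 0"
  "cls E3 = pv 0 0 0 0 1 0 0 0 0 0" "cls E4 = pv 0 0 0 0 0 1 0 0 0 0"
  "cls E5 = pv 0 0 0 0 0 0 1 0 0 0" "cls E6 = pv 0 0 0 0 0 0 0 1 0 0"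
  "cls E7 = pv 0 0 0 0 0 0 0 0 1 0" "cls E8 = pv 0 0 0 0 0 0 0 0 0 1"
  by (simp_all add: pic_eq_iff axis_def)

lemma pic_gen_minus_H: "UNIV - {HX, HY} = {E1, E2, E3, E4, E5, E6, E7, E8}"
  by (auto simp: UNIV_pic_gen)

lemma intersection_pv:
  "pv a b c1 c2 c3 c4 c5 c6 c7 c8 \<odot> pv a' b' d1 d2 d3 d4 d5 d6 d7 d8 =
   a * b' + b * a' - c1 * d1 - c2 * d2 - c3 * d3 - c4 * d4 - c5 * d5 - c6 * d6 - c7 * d7 - c8 * d8"
  by (simp add: intersection_def pic_gen_minus_H)

lemma delta_pv: "delta = pv 2 2 (- 1) (- 1) (- 1) (- 1) (- 1) (- 1) (- 1) (- 1)"
  by (simp add: delta_def pic_gen_minus_H cls_pv pv_arith)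

lemma beta_pv:
  "beta N0 = pv 0 0 1 (- 1) 0 0 0 0 0 0" "beta N1 = pv 0 0 0 0 0 0 1 (- 1) 0 0"
  "beta N2 = pv 0 1 (- 1) 0 0 0 (- 1) 0 0 0" "beta N3 = pv 1 (- 1) 0 0 0 0 0 0 0 0"
  "beta N4 = pv 0 1 0 0 (- 1) 0 0 0 (- 1) 0" "beta N5 = pv 0 0 0 0 1 (- 1) 0 0 0 0"
  "beta N6 = pv 0 0 0 0 0 0 0 0 1 (- 1)"
  by (simp_all add: cls_pv pv_arith)

declare beta.simps [simp del]

lemma alpha_pv:
  "alpha 0 = pv 0 0 1 (- 1) 0 0 0 0 0 0" "alpha 1 = pv 1 (- 1) 0 0 0 0 0 0 0 0"
  "alpha 2 = pv 0 1 (- 1) (- 1) 0 0 0 0 0 0" "alpha 3 = pv 0 0 0 1 (- 1) 0 0 0 0 0"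
  "alpha 4 = pv 0 0 0 0 1 (- 1) 0 0 0 0" "alpha 5 = pv 0 0 0 0 0 1 (- 1) 0 0 0"
  "alpha 6 = pv 0 0 0 0 0 0 1 (- 1) 0 0" "alpha 7 = pv 0 0 0 0 0 0 0 1 (- 1) 0"
  "alpha 8 = pv 0 0 0 0 0 0 0 0 1 (- 1)"
  by (simp_all add: alpha_def cls_pv pv_arith nth_Cons')

lemma all_d6_node: "(\<forall>i. P i) \<longleftrightarrow> P N0 \<and> P N1 \<and> P N2 \<and> P N3 \<and> P N4 \<and> P N5 \<and> P N6"
  by (auto intro: d6_node.induct)

lemma UNIV_d6_node: "(UNIV :: d6_node set) = {N0, N1, N2, N3, N4, N5, N6}"
  by (auto intro: d6_node.exhaust)

lemma sigma_node_simps [simp]: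
  "sigma1_node N0 = N5" "sigma1_node N1 = N6" "sigma1_node N2 = N4" "sigma1_node N3 = N3"
  "sigma1_node N4 = N2" "sigma1_node N5 = N1" "sigma1_node N6 = N0"
  "sigma2_node N0 = N1" "sigma2_node N1 = N0" "sigma2_node N2 = N2" "sigma2_node N3 = N3"
  "sigma2_node N4 = N4" "sigma2_node N5 = N5" "sigma2_node N6 = N6"
  by (simp_all add: sigma1_node_def sigma2_node_def transpose_def)

lemma d6_edge_iff [simp]:
  "{i, j} \<in> d6_edges \<longleftrightarrow> (i, j) \<in> {(N0, N2), (N2, N0), (N1, N2), (N2, N1), (N2, N3), (N3, N2),
     (N3, N4), (N4, N3), (N4, N5), (N5, N4), (N4, N6), (N6, N4)}"
  by (auto simp: d6_edges_def doubleton_eq_iff)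

lemma beta_intersection: "beta i \<odot> beta j = - cartan d6_edges i j"
  by (cases i; cases j; simp add: beta_pv intersection_pv cartan_def)

section \<open>The root basis and the mapping in coordinates\<close>

lemma permute_basis_eqI:
  assumes "bij \<pi>" "\<And>g. c' $ \<pi> g = c $ g" shows "permute_basis \<pi> c = c'"
proof (subst vec_eq_iff, intro allI)
  fix i
  have "\<pi> (inv_into UNIV \<pi> i) = i" using assms(1) by (simp add: bij_is_surj surj_f_inv_f)
  then show "permute_basis \<pi> c $ i = c' $ i"
    using assms(2)[of "inv_into UNIV \<pi> i"] by (simp add: permute_basis_def)
qed

lemma sigma1_pv [simp]:
  "sigma1 (pv a b c1 c2 c3 c4 c5 c6 c7 c8) = pv a b c7 c8 c1 c2 c3 c4 c5 c6"
  unfolding sigma1_def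
proof (rule permute_basis_eqI)
  show "bij (cycle_of_list [E1, E3, E5, E7] \<circ> cycle_of_list [E2, E4, E6, E8])"
    by (intro bij_comp permutes_bij[OF cycle_permutes])
  show "pv a b c7 c8 c1 c2 c3 c4 c5 c6 $ (cycle_of_list [E1, E3, E5, E7]
    \<circ> cycle_of_list [E2, E4, E6, E8]) g
     = pv a b c1 c2 c3 c4 c5 c6 c7 c8 $ g" for g
    by (cases g) (simp_all add: transpose_def)
qed

lemma sigma2_pv [simp]:
  "sigma2 (pv a b c1 c2 c3 c4 c5 c6 c7 c8) = pv a b c5 c6 c3 c4 c1 c2 c7 c8"
  unfolding sigma2_def
proof (rule permute_basis_eqI)
  show "bij (cycle_of_list [E1, E5] \<circ> cycle_of_list [E2, E6])"
    by (intro bij_comp permutes_bij[OF cycle_permutes])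
  show "pv a b c5 c6 c3 c4 c1 c2 c7 c8 $ (cycle_of_list [E1, E5] \<circ> cycle_of_list [E2, E6]) g
     = pv a b c1 c2 c3 c4 c5 c6 c7 c8 $ g" for g
    by (cases g) (simp_all add: transpose_def)
qed

lemma phi_pull_pv:
  "phi_pull (pv a b c1 c2 c3 c4 c5 c6 c7 c8) =
   pv (2 * a + b + c1 + c2 + c5 + c6) a c4 c3 (- a - c1) (- a - c2) c8 c7 (- a - c5) (- a - c6)"
  by (simp add: phi_pull_def linear_extension_def UNIV_pic_gen cls_pv pv_arith pv_eq_iff)

lemma phi_push_pv:
  "phi_push (pv a b c1 c2 c3 c4 c5 c6 c7 c8) =
   pv b (a + 2 * b + c3 + c4 + c7 + c8) (- b - c3) (- b - c4) c2 c1 (- b - c7) (- b - c8) c6 c5"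
  by (simp add: phi_push_def linear_extension_def UNIV_pic_gen cls_pv pv_arith pv_eq_iff)

lemma reflection_beta_pv:
  "reflection (beta N0) (pv a b c1 c2 c3 c4 c5 c6 c7 c8) = pv a b c2 c1 c3 c4 c5 c6 c7 c8"
  "reflection (beta N1) (pv a b c1 c2 c3 c4 c5 c6 c7 c8) = pv a b c1 c2 c3 c4 c6 c5 c7 c8"
  "reflection (beta N2) (pv a b c1 c2 c3 c4 c5 c6 c7 c8) =
     pv a (b + a + c1 + c5) (- a - c5) c2 c3 c4 (- a - c1) c6 c7 c8"
  "reflection (beta N3) (pv a b c1 c2 c3 c4 c5 c6 c7 c8) = pv b a c1 c2 c3 c4 c5 c6 c7 c8"
  "reflection (beta N4) (pv a b c1 c2 c3 c4 c5 c6 c7 c8) =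
     pv a (b + a + c3 + c7) c1 c2 (- a - c7) c4 c5 c6 (- a - c3) c8"
  "reflection (beta N5) (pv a b c1 c2 c3 c4 c5 c6 c7 c8) = pv a b c1 c2 c4 c3 c5 c6 c7 c8"
  "reflection (beta N6) (pv a b c1 c2 c3 c4 c5 c6 c7 c8) = pv a b c1 c2 c3 c4 c5 c6 c8 c7"
  by (simp_all add: reflection_def beta_pv intersection_pv pv_arith pv_eq_iff)

lemma phi_factorizations:
  defines "w \<equiv> \<lambda>i. reflection (beta i)"
  shows "phi_pull =
          (sigma1 ^^ 3) \<circ> w N6 \<circ> w N5 \<circ> w N3 \<circ> w N2 \<circ> w N1 \<circ> w N0 \<circ> w N2 \<circ> w N1 \<circ> w N0"
    and "phi_push =
          w N0 \<circ> w N1 \<circ> w N2 \<circ> w N0 \<circ> w N1 \<circ> w N2 \<circ> w N3 \<circ> w N5 \<circ> w N6 \<circ> sigma1"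
    and "phi_pull ^^ 2 =
          (sigma1 ^^ 2) \<circ> w N3 \<circ> w N4 \<circ> w N6 \<circ> w N5 \<circ> w N4 \<circ> w N3 \<circ> w N2 \<circ> w N1 \<circ> w N0 \<circ> w N2"
    and "phi_push ^^ 2 =
          w N2 \<circ> w N0 \<circ> w N1 \<circ> w N2 \<circ> w N3 \<circ> w N4 \<circ> w N5 \<circ> w N6 \<circ> w N4 \<circ> w N3 \<circ> (sigma1 ^^ 2)"
proof -
  note rules = w_def reflection_beta_pv phi_pull_pv phi_push_pv numeral_2_eq_2 numeral_3_eq_3 pv_eq_iff
  show "phi_pull =
          (sigma1 ^^ 3) \<circ> w N6 \<circ> w N5 \<circ> w N3 \<circ> w N2 \<circ> w N1 \<circ> w N0 \<circ> w N2 \<circ> w N1 \<circ> w N0"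
    by (rule pic_fun_eqI) (simp add: rules)
  show "phi_push =
          w N0 \<circ> w N1 \<circ> w N2 \<circ> w N0 \<circ> w N1 \<circ> w N2 \<circ> w N3 \<circ> w N5 \<circ> w N6 \<circ> sigma1"
    by (rule pic_fun_eqI) (simp add: rules)
  show "phi_pull ^^ 2 =
          (sigma1 ^^ 2) \<circ> w N3 \<circ> w N4 \<circ> w N6 \<circ> w N5 \<circ> w N4 \<circ> w N3 \<circ> w N2 \<circ> w N1 \<circ> w N0 \<circ> w N2"
    by (rule pic_fun_eqI) (simp add: rules)
  show "phi_push ^^ 2 =
          w N2 \<circ> w N0 \<circ> w N1 \<circ> w N2 \<circ> w N3 \<circ> w N4 \<circ> w N5 \<circ> w N6 \<circ> w N4 \<circ> w N3 \<circ> (sigma1 ^^ 2)"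
    by (rule pic_fun_eqI) (simp add: rules)
qed

lemmas pv_rules = beta_pv alpha_pv delta_pv phi_pull_pv phi_push_pv pv_arith pv_eq_iff

lemma funpow_2: "(f ^^ 2) x = f (f x)"
  by (simp add: numeral_2_eq_2)

lemma explicit_root_identities:
  "beta N0 = alpha 0"
  "beta N1 = alpha 6"
  "beta N2 = alpha 2 + alpha 3 + alpha 4 + alpha 5"
  "beta N3 = alpha 1"
  "beta N4 = alpha 0 + alpha 2 + 2 *s alpha 3 + alpha 4 + alpha 5 + alpha 6 + alpha 7"
  "beta N5 = alpha 4"
  "beta N6 = alpha 8"
  "(\<forall>i. sigma1 (beta i) = beta (sigma1_node i))"
  "(\<forall>i. sigma2 (beta i) = beta (sigma2_node i))"
  "phi_pull (beta N0) = - beta N5"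
  "phi_pull (beta N1) = - beta N6"
  "phi_pull (beta N2) = - beta N3 - beta N4"
  "phi_pull (beta N3) = beta N3 + 2 *s beta N4 + beta N5 + beta N6"
  "phi_pull (beta N4) = beta N0 + beta N1 + beta N2 + beta N3"
  "phi_pull (beta N5) = - beta N0"
  "phi_pull (beta N6) = - beta N1"
  "(phi_pull ^^ 2) (beta N0) = beta N0"
  "(phi_pull ^^ 2) (beta N1) = beta N1"
  "(phi_pull ^^ 2) (beta N2) = beta N2 - delta"
  "(phi_pull ^^ 2) (beta N3) = beta N3 + delta"
  "(phi_pull ^^ 2) (beta N4) = beta N4"
  "(phi_pull ^^ 2) (beta N5) = beta N5"
  "(phi_pull ^^ 2) (beta N6) = beta N6"
  "delta = beta N0 + beta N1 + 2 *s beta N2 + 2 *s beta N3 + 2 *s beta N4 + beta N5 + beta N6"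
  "(sigma1 ^^ 2) (beta N0) = beta N1"
  "(sigma1 ^^ 2) (beta N1) = beta N0"
  "(sigma1 ^^ 2) (beta N2) = beta N2"
  "(sigma1 ^^ 2) (beta N3) = beta N3"
  "(sigma1 ^^ 2) (beta N4) = beta N4"
  "(sigma1 ^^ 2) (beta N5) = beta N6"
  "(sigma1 ^^ 2) (beta N6) = beta N5"
  by (simp_all add: pv_rules all_d6_node funpow_2 del: One_nat_def)

lemma phi_pull_not_translation: "\<not> is_translation_QB phi_pull"
  unfolding is_translation_QB_def by (auto simp: pv_rules all_d6_node)

lemma phi_pull_square_translation: "is_translation_QB (phi_pull ^^ 2)"
proof -
  have "\<exists>k. (phi_pull ^^ 2) (beta i) = beta i + k *s delta" for i
    by (rule exI[of _ "case i of N2 \<Rightarrow> - 1 | N3 \<Rightarrow> 1 | _ \<Rightarrow> 0"], cases i)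
      (simp_all add: pv_rules numeral_2_eq_2)
  then show ?thesis by (simp add: is_translation_QB_def)
qed

section \<open>Automorphisms of the Picard lattice\<close>

lemma intersection_commute: "C \<odot> D = D \<odot> C"
  by (cases C; cases D) (simp add: intersection_pv algebra_simps)

lemma intersection_linear:
  "(C + C') \<odot> D = C \<odot> D + C' \<odot> D" "D \<odot> (C + C') = D \<odot> C + D \<odot> C'"
  "(C - C') \<odot> D = C \<odot> D - C' \<odot> D" "D \<odot> (C - C') = D \<odot> C - D \<odot> C'"
  "(- C) \<odot> D = - (C \<odot> D)" "D \<odot> (- C) = - (D \<odot> C)"
  "(k *s C) \<odot> D = k * (C \<odot> D)" "D \<odot> (k *s C) = k * (D \<odot> C)"
  "0 \<odot> D = 0" "D \<odot> 0 = 0"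
  by (simp_all add: intersection_def pic_gen_minus_H algebra_simps)

definition lattice_aut :: "(pic \<Rightarrow> pic) \<Rightarrow> bool" where
  "lattice_aut f \<longleftrightarrow> bij f \<and> (\<forall>C D. f (C + D) = f C + f D) \<and> (\<forall>C D. f C \<odot> f D = C \<odot> D) \<and>
     f delta = delta"

lemma lattice_aut_bij: "lattice_aut f \<Longrightarrow> bij f"
  by (simp add: lattice_aut_def)

lemma lattice_aut_id: "lattice_aut id"
  by (simp add: lattice_aut_def)

lemma lattice_aut_comp: "lattice_aut f \<Longrightarrow> lattice_aut g \<Longrightarrow> lattice_aut (f \<circ> g)"
  by (simp add: lattice_aut_def bij_comp)

lemma lattice_aut_inv: assumes "lattice_aut f" shows "lattice_aut (inv_into UNIV f)"
proof -
  have [simp]: "f (inv_into UNIV f x) = x" "inv_into UNIV f (f x) = x" for x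
    using assms by (simp_all add: lattice_aut_def bij_is_inj bij_is_surj surj_f_inv_f)
  have inj: "f x = f y \<Longrightarrow> x = y" for x y using lattice_aut_bij[OF assms] by (auto dest: bij_is_inj injD)
  have "inv_into UNIV f (C + D) = inv_into UNIV f C + inv_into UNIV f D" for C D
    by (rule inj) (use assms in \<open>simp add: lattice_aut_def\<close>)
  moreover have "inv_into UNIV f C \<odot> inv_into UNIV f D = C \<odot> D" for C D
    using assms unfolding lattice_aut_def by (metis \<open>\<And>x. f (inv_into UNIV f x) = x\<close>)
  moreover have "inv_into UNIV f delta = delta"
    by (rule inj) (use assms in \<open>simp add: lattice_aut_def\<close>)
  ultimately show ?thesis
    using lattice_aut_bij[OF assms] by (simp add: lattice_aut_def bij_imp_bij_inv)
qed

lemma lattice_aut_linear: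
  assumes "lattice_aut f"
  shows "f (C + D) = f C + f D" "f (C - D) = f C - f D" "f (- C) = - f C" "f 0 = 0"
    "f (k *s C) = k *s f C"
proof -
  show add: "f (C + D) = f C + f D" for C D
    using assms by (simp add: lattice_aut_def)
  show zero: "f 0 = 0" using add[of 0 0] by simp
  show minus: "f (- C) = - f C" for C
    using add[of C "- C"] zero by (simp add: eq_neg_iff_add_eq_0 add.commute)
  show "f (C - D) = f C - f D"
    using add[of C "- D"] minus[of D] by simp
  have nat: "f (int n *s C) = int n *s f C" for n
  proof (induction n)
    case (Suc n)
    have "int (Suc n) *s D = int n *s D + D" for D :: pic
      by (simp add: vec_eq_iff algebra_simps)
    then show ?case using Suc by (simp add: add)
  qed (simp add: zero)
  show "f (k *s C) = k *s f C"
  proof (cases k rule: int_cases2)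
    case (nonneg n) then show ?thesis by (simp add: nat)
  next
    case (nonpos n)
    have "(- int n) *s D = - (int n *s D)" for D :: pic by (simp add: vec_eq_iff)
    then show ?thesis using nonpos by (simp add: nat minus)
  qed
qed

lemma lattice_aut_intersection: "lattice_aut f \<Longrightarrow> f C \<odot> f D = C \<odot> D"
  by (simp add: lattice_aut_def)

lemma lattice_aut_delta: "lattice_aut f \<Longrightarrow> f delta = delta"
  by (simp add: lattice_aut_def)

lemma reflection_involution:
  assumes "r \<odot> r = - 2" shows "reflection r (reflection r D) = D"
  by (simp add: reflection_def intersection_linear assms vec_eq_iff algebra_simps)

lemma lattice_aut_reflection:
  assumes "r \<odot> r = - 2" "r \<odot> delta = 0"
  shows "lattice_aut (reflection r)"
  unfolding lattice_aut_def
proof (intro conjI allI)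
  show "bij (reflection r)"
    by (rule o_bij[of "reflection r"]) (simp_all add: fun_eq_iff reflection_involution assms)
  show "reflection r (C + D) = reflection r C + reflection r D" for C D
    by (simp add: reflection_def intersection_linear vec_eq_iff algebra_simps)
  show "reflection r C \<odot> reflection r D = C \<odot> D" for C D
    by (simp add: reflection_def intersection_linear assms algebra_simps intersection_commute[of C r]
      intersection_commute[of D r])
  show "reflection r delta = delta"
    by (simp add: reflection_def assms vec_eq_iff)
qed

lemma conj_reflection:
  assumes "lattice_aut w" shows "w \<circ> reflection r \<circ> inv_into UNIV w = reflection (w r)"
proof
  fix D
  have "w (inv_into UNIV w D) = D" using lattice_aut_bij[OF assms]
    by (simp add: bij_is_surj surj_f_inv_f)
  then show "(w \<circ> reflection r \<circ> inv_into UNIV w) D = reflection (w r) D"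
    using lattice_aut_intersection[OF assms, of r "inv_into UNIV w D"]
    by (simp add: reflection_def lattice_aut_linear[OF assms])
qed

lemma lattice_aut_reflection_beta: "lattice_aut (reflection (beta i))"
  by (rule lattice_aut_reflection; cases i) (simp_all add: beta_pv delta_pv intersection_pv)

text \<open>
  The condition on the parameters says that the homomorphism to the curve kills these two
  classes.
\<close>

definition star1 :: pic where "star1 = cls E1 + cls E2 - cls E5 - cls E6"
definition star2 :: pic where "star2 = cls E3 + cls E4 - cls E7 - cls E8"
definition star_set :: "pic set" where "star_set = {star1, - star1, star2, - star2}"

lemma star_pv: "star1 = pv 0 0 1 1 0 0 (- 1) (- 1) 0 0" "star2 = pv 0 0 0 0 1 1 0 0 (- 1) (- 1)"
  by (simp_all add: star1_def star2_def cls_pv pv_arith)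

text \<open>
  Fixing the \<open>\<beta>\<^sub>i\<close>, the automorphism moves both members of each pair \<open>(E\<^sub>1, E\<^sub>2)\<close>, \<open>(E\<^sub>5, E\<^sub>6)\<close>,
  \<open>(E\<^sub>3, E\<^sub>4)\<close>, \<open>(E\<^sub>7, E\<^sub>8)\<close> by one class, say \<open>x\<close>, \<open>y\<close>, \<open>z\<close>, \<open>t\<close>, and \<open>\<beta>\<^sub>2\<close>, \<open>\<beta>\<^sub>4\<close> give \<open>x + y
  = z + t\<close>. The image of \<open>star1\<close> is \<open>star1 + 2 (x - y)\<close>, which leaves only \<open>x - y = 0\<close> or \<open>x - y
  = - star1\<close>, and likewise for \<open>z - t\<close>. Since \<open>x - y\<close> and \<open>z - t\<close> agree modulo two but no two of
  \<open>0\<close>, \<open>star1\<close> and \<open>star2\<close> do, all four displacements are equal, and preservation of the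
  intersection form makes the common one zero.
\<close>

lemma fixes_beta_imp_id:
  assumes w: "lattice_aut w" and fix_beta: "\<And>i. w (beta i) = beta i"
    and star_set: "w star1 \<in> star_set" "w star2 \<in> star_set"
  shows "w = id"
proof -
  note lin = lattice_aut_linear[OF w]
  define x where "x = w (cls E1) - cls E1"
  define y where "y = w (cls E5) - cls E5"
  define z where "z = w (cls E3) - cls E3"
  define t where "t = w (cls E7) - cls E7"
  have E: "w (cls E1) = cls E1 + x" "w (cls E2) = cls E2 + x" "w (cls E5) = cls E5 + y"
    "w (cls E6) = cls E6 + y" "w (cls E3) = cls E3 + z" "w (cls E4) = cls E4 + z"
    "w (cls E7) = cls E7 + t" "w (cls E8) = cls E8 + t"
    "w (cls HY) = cls HY + x + y" "w (cls HY) = cls HY + z + t"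
      "w (cls HX) = w (cls HY) + cls HX - cls HY"
    using fix_beta[of N0] fix_beta[of N1] fix_beta[of N2] fix_beta[of N3] fix_beta[of N4]
      fix_beta[of N5] fix_beta[of N6]
    by (simp_all add: beta.simps lin x_def y_def z_def t_def algebra_simps)
  have HX: "w (cls HX) = cls HX + x + y"
    unfolding E(11) by (simp add: E(9))
  have sum: "x + y = z + t" using E(9,10) by simp
  have wA: "w star1 = star1 + 2 *s (x - y)" "w star2 = star2 + 2 *s (z - t)"
    by (simp_all add: star1_def star2_def lin E vec_eq_iff algebra_simps)
  \<comment> \<open>The sum and the difference of \<open>star1\<close> and \<open>star2\<close> are not divisible by two.\<close>
  have half: "d = 0 \<or> d = - star1" if "star1 + 2 *s d \<in> star_set" for d
    using that by (cases d) (auto simp: star_set_def star_pv pv_arith pic_eq_iff; presburger)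
  have half': "d = 0 \<or> d = - star2" if "star2 + 2 *s d \<in> star_set" for d
    using that by (cases d) (auto simp: star_set_def star_pv pv_arith pic_eq_iff; presburger)
  have dxy: "x - y = 0 \<or> x - y = - star1" and dzt: "z - t = 0 \<or> z - t = - star2"
    using half half' star_set unfolding wA by blast+
  have comp: "x $ g + y $ g = z $ g + t $ g" for g
    using arg_cong[OF sum, of "\<lambda>v. v $ g"] by simp
  have "x - y \<noteq> - star1"
  proof
    assume "x - y = - star1"
    then have "(x - y) $ E1 = (- star1) $ E1" by simp
    then have "x $ E1 - y $ E1 = - 1" by (simp add: star_pv)
    moreover have "(z - t) $ E1 = 0"
      using dzt by (auto simp del: vector_minus_component simp: star_pv pv_arith)
    then have "z $ E1 - t $ E1 = 0" by simp
    ultimately show False using comp[of E1] by presburger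
  qed
  moreover have "z - t \<noteq> - star2"
  proof
    assume "z - t = - star2"
    then have "(z - t) $ E3 = (- star2) $ E3" by simp
    then have "z $ E3 - t $ E3 = - 1" by (simp add: star_pv)
    moreover have "(x - y) $ E3 = 0"
      using dxy by (auto simp del: vector_minus_component simp: star_pv pv_arith)
    then have "x $ E3 - y $ E3 = 0" by simp
    ultimately show False using comp[of E3] by presburger
  qed
  ultimately have "x = y" "z = t" using dxy dzt by auto
  moreover from this have "x = z" using comp by (simp add: vec_eq_iff)
  ultimately have eqs: "x = z \<and> y = z \<and> t = z" by simp
  note E = E(1-10) HX
  have ww: "(cls g + z) \<odot> (cls h + z) = cls g \<odot> cls h" if "g \<in> {E1,E2,E3,E4,E5,E6,E7,E8}"
    "h \<in> {E1,E2,E3,E4,E5,E6,E7,E8}" for g h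
    using that E eqs lattice_aut_intersection[OF w, of "cls g" "cls h"] by auto
  have hh: "(cls HY + z + z) \<odot> (cls HY + z + z) = 0" "(cls HX + z + z) \<odot> (cls HX + z + z) = 0"
    using E eqs lattice_aut_intersection[OF w, of "cls HY"
      "cls HY"] lattice_aut_intersection[OF w, of "cls HX" "cls HX"]
    by (simp_all add: cls_pv intersection_pv)
  have z0: "z = 0"
  proof (cases z)
    case (1 a b c1 c2 c3 c4 c5 c6 c7 c8)
    define s where "s = z \<odot> z"
    \<comment> \<open>The pairings with the basis determine \<open>z\<close> as a multiple of \<open>\<delta>\<close> with factor \<open>- k\<close>.\<close>
    have zE: "2 * (z \<odot> cls g) = - s" if "g \<in> {E1,E2,E3,E4,E5,E6,E7,E8}" for g
      using ww[OF that that] intersection_commute[of "cls g" z] unfolding s_def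
      by (simp add: intersection_linear)
    have zH: "z \<odot> cls HX = - s" "z \<odot> cls HY = - s"
      using hh[unfolded intersection_linear] intersection_commute[of "cls HX" z]
        intersection_commute[of "cls HY" z] unfolding s_def
      by (simp_all add: cls_pv intersection_pv)
    have c: "2 * c1 = s" "2 * c2 = s" "2 * c3 = s" "2 * c4 = s" "2 * c5 = s" "2 * c6 = s"
      "2 * c7 = s" "2 * c8 = s" "a = - s" "b = - s"
      using zE[of E1] zE[of E2] zE[of E3] zE[of E4] zE[of E5] zE[of E6] zE[of E7] zE[of E8] zH
      by (simp_all add: 1 cls_pv intersection_pv)
    define k where "k = c1"
    have c': "a = - 2 * k" "b = - 2 * k" "c1 = k" "c2 = k" "c3 = k" "c4 = k" "c5 = k" "c6 = k"
      "c7 = k" "c8 = k" "s = 2 * k"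
      using c by (simp_all add: k_def)
    have "s = 0" unfolding s_def 1 c' by (simp add: intersection_pv)
    then have "k = 0" using c' by simp
    then show ?thesis using c' 1 by (simp add: pic_eq_iff)
  qed
  have "w D = D" for D
  proof (cases D)
    case (1 a b c1 c2 c3 c4 c5 c6 c7 c8)
    have D: "D = a *s cls HX + b *s cls HY + c1 *s cls E1 + c2 *s cls E2 + c3 *s cls E3 + c4 *s cls E4
       + c5 *s cls E5 + c6 *s cls E6 + c7 *s cls E7 + c8 *s cls E8"
      by (simp add: 1 cls_pv pv_arith)
    show ?thesis using E eqs z0 by (simp add: D lin)
  qed
  then show ?thesis by auto
qed

section \<open>The root lattice of type \<open>D\<^sub>6\<^sup>(\<^sup>1\<^sup>)\<close>\<close>

definition root_embed :: "int ^ d6_node \<Rightarrow> pic" where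
  "root_embed c = (\<Sum>i\<in>UNIV. c $ i *s beta i)"

lemma root_embed_pv:
  "root_embed c = pv (c $ N3) (c $ N2 + c $ N4 - c $ N3) (c $ N0 - c $ N2) (- c $ N0) (c $ N5 - c $
    N4) (- c $ N5)
     (c $ N1 - c $ N2) (- c $ N1) (c $ N6 - c $ N4) (- c $ N6)"
  by (simp add: root_embed_def UNIV_d6_node beta_pv pv_arith pv_eq_iff)

lemma root_embed_inject: "root_embed c = root_embed c' \<longleftrightarrow> c = c'"
  unfolding vec_eq_iff[of c c'] by (auto simp: root_embed_pv pv_eq_iff all_d6_node)

lemma root_embed_linear:
  "root_embed (c + c') = root_embed c + root_embed c'"
    "root_embed (c - c') = root_embed c - root_embed c'" "root_embed (k *s c) = k *s root_embed c"
  by (simp_all add: root_embed_pv pv_arith pv_eq_iff algebra_simps)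

lemma root_embed_axis: "root_embed (axis i 1) = beta i"
  by (cases i) (simp_all add: root_embed_pv beta_pv axis_def)

lemma lattice_aut_root_embed:
  assumes "lattice_aut f" shows "f (root_embed c) = (\<Sum>i\<in>UNIV. c $ i *s f (beta i))"
  by (simp add: root_embed_def UNIV_d6_node lattice_aut_linear[OF assms])

text \<open>
  Seven of the coordinates of such a class determine the other three by orthogonality, and the
  coefficients with respect to the \<open>\<beta>\<^sub>i\<close> can be read off from these seven; they are integers.
  This is what lets lattice automorphisms that respect \<open>L\<close> and \<open>\<delta>\<close> act on the span of the \<open>\<beta>\<^sub>i\<close>.
\<close>

lemma range_root_embed: "D \<in> range root_embed \<longleftrightarrow> D \<odot> delta = 0 \<and> D \<odot> star1 = 0 \<and> D \<odot> star2 = 0"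
proof (cases D)
  case (1 a b c1 c2 c3 c4 c5 c6 c7 c8)
  have "D \<in> range root_embed" if "D \<odot> delta = 0" "D \<odot> star1 = 0" "D \<odot> star2 = 0"
  proof
    show "D = root_embed (\<chi> i. case i of N0 \<Rightarrow> - c2 | N1 \<Rightarrow> - c6 | N2 \<Rightarrow> - c1 - c2 | N3 \<Rightarrow> a
       | N4 \<Rightarrow> - c3 - c4 | N5 \<Rightarrow> - c4 | N6 \<Rightarrow> - c8)"
      using that by (simp add: 1 root_embed_pv star_pv delta_pv intersection_pv pv_eq_iff)
  qed simp
  then show ?thesis by (auto simp: root_embed_pv star_pv delta_pv intersection_pv)
qed

definition D6_form :: "int ^ d6_node \<Rightarrow> int" where
  "D6_form c = (c $ N0)\<^sup>2 + (c $ N1)\<^sup>2 + (c $ N2)\<^sup>2 + (c $ N3)\<^sup>2 + (c $ N4)\<^sup>2 + (c $ N5)\<^sup>2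
    + (c $ N6)\<^sup>2 -
     (c $ N0 * c $ N2 + c $ N1 * c $ N2 + c $ N2 * c $ N3 + c $ N3 * c $ N4 + c $ N4 * c $ N5
     + c $ N4 * c $ N6)"

lemma root_embed_square: "root_embed c \<odot> root_embed c = - 2 * D6_form c"
  by (simp add: root_embed_pv intersection_pv D6_form_def power2_eq_square algebra_simps)

lemma D6_form_sum_of_squares:
  "4 * D6_form c = (2 * c $ N0 - c $ N2)\<^sup>2 + (2 * c $ N1 - c $ N2)\<^sup>2 + 2 * (c $ N2 - c $ N3)\<^sup>2 +
     2 * (c $ N3 - c $ N4)\<^sup>2 + (2 * c $ N5 - c $ N4)\<^sup>2 + (2 * c $ N6 - c $ N4)\<^sup>2"
  by (simp add: D6_form_def power2_eq_square algebra_simps)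

lemma D6_form_nonneg: "D6_form c \<ge> 0"
proof -
  have "0 \<le> 4 * D6_form c" unfolding D6_form_sum_of_squares by simp
  then show ?thesis by simp
qed

text \<open>
  The radical is spanned by the coefficient vector \<open>(1, 1, 2, 2, 2, 1, 1)\<close> of \<open>\<delta>\<close>.
\<close>

lemma D6_form_zero:
  assumes "D6_form c = 0"
  shows "c $ N1 = c $ N0 \<and> c $ N2 = 2 * c $ N0 \<and> c $ N3 = 2 * c $ N0 \<and> c $ N4 = 2 * c $ N0 \<and>
     c $ N5 = c $ N0 \<and> c $ N6 = c $ N0"
proof -
  have "(2 * c $ N0 - c $ N2)\<^sup>2 + (2 * c $ N1 - c $ N2)\<^sup>2 + 2 * (c $ N2 - c $ N3)\<^sup>2 +
     2 * (c $ N3 - c $ N4)\<^sup>2 + (2 * c $ N5 - c $ N4)\<^sup>2 + (2 * c $ N6 - c $ N4)\<^sup>2 = 0"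
    using D6_form_sum_of_squares[of c] assms by simp
  then have "2 * c $ N0 - c $ N2 = 0 \<and> 2 * c $ N1 - c $ N2 = 0 \<and> c $ N2 - c $ N3 = 0 \<and>
     c $ N3 - c $ N4 = 0 \<and> 2 * c $ N5 - c $ N4 = 0 \<and> 2 * c $ N6 - c $ N4 = 0"
    by (simp add: add_nonneg_eq_0_iff)
  then show ?thesis by simp
qed

text \<open>
  Let \<open>c = p - q\<close> be the decomposition into positive and negative part. The supports are
  disjoint and distinct simple roots have nonnegative intersection, so the mixed term only
  increases the form: \<open>D6_form p + D6_form q \<le> D6_form c = 1\<close>. One of the two parts thus lies in
  the radical, whose nonzero elements have full support. If that part is nonzero, the other one
  vanishes.
\<close>

lemma root_positive_or_negative:
  assumes "root_embed c \<odot> root_embed c = - 2"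
  shows "(\<forall>i. c $ i \<ge> 0) \<or> (\<forall>i. c $ i \<le> 0)"
proof -
  define p :: "int ^ d6_node" where "p = (\<chi> i. max (c $ i) 0)"
  define q :: "int ^ d6_node" where "q = (\<chi> i. max (- c $ i) 0)"
  have c: "c = p - q" by (auto simp: p_def q_def vec_eq_iff)
  have pos: "p $ i \<ge> 0" "q $ i \<ge> 0" and pq: "p $ i * q $ i = 0" for i
    by (auto simp: p_def q_def)
  have "D6_form (p - q) = D6_form p + D6_form q +
     (p $ N0 * q $ N2 + p $ N1 * q $ N2 + p $ N2 * q $ N3 + p $ N3 * q $ N4 + p $ N4 * q $ N5
     + p $ N4 * q $ N6 +
     q $ N0 * p $ N2 + q $ N1 * p $ N2 + q $ N2 * p $ N3 + q $ N3 * p $ N4 + q $ N4 * p $ N5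
     + q $ N4 * p $ N6)
     - 2 * (p $ N0 * q $ N0 + p $ N1 * q $ N1 + p $ N2 * q $ N2 + p $ N3 * q $ N3 + p $ N4 * q $ N4
       + p $ N5 * q $ N5 + p $ N6 * q $ N6)"
    by (simp add: D6_form_def power2_eq_square algebra_simps)
  also have "\<dots> \<ge> D6_form p + D6_form q"
    by (simp add: pq pos)
  finally have "D6_form p + D6_form q \<le> 1"
    using assms unfolding root_embed_square c by simp
  then consider "D6_form p = 0" | "D6_form q = 0"
    using D6_form_nonneg[of p] D6_form_nonneg[of q] by linarith
  then show ?thesis
  proof cases
    case 1
    note z = D6_form_zero[OF 1]
    show ?thesis
    proof (cases "p $ N0 = 0")
      case True
      then have "p $ i = 0" for i using z by (cases i) auto
      then show ?thesis using pos by (simp add: c)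
    next
      case False
      then have "p $ i \<noteq> 0" for i using z by (cases i) auto
      then have "q $ i = 0" for i using pq[of i] by simp
      then show ?thesis using pos by (simp add: c)
    qed
  next
    case 2
    note z = D6_form_zero[OF 2]
    show ?thesis
    proof (cases "q $ N0 = 0")
      case True
      then have "q $ i = 0" for i using z by (cases i) auto
      then show ?thesis using pos by (simp add: c)
    next
      case False
      then have "q $ i \<noteq> 0" for i using z by (cases i) auto
      then have "p $ i = 0" for i using pq[of i] by simp
      then show ?thesis using pos by (simp add: c)
    qed
  qed
qed

text \<open>
  This class pairs to one with each simple root, so it plays the part of the Weyl vector.
\<close>

definition rho_class :: pic where "rho_class = cls HX + 2 *s cls HY + cls E2 + cls E4 + cls E6 + cls E8"

lemma rho_class_pv: "rho_class = pv 1 2 0 1 0 1 0 1 0 1"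
  by (simp add: rho_class_def cls_pv pv_arith)

lemma rho_class_beta: "rho_class \<odot> beta i = 1"
  by (cases i) (simp_all add: rho_class_pv beta_pv intersection_pv)

lemma rho_class_root_embed: "rho_class \<odot> root_embed c = (\<Sum>i\<in>UNIV. c $ i)"
  by (simp add: rho_class_pv root_embed_pv intersection_pv UNIV_d6_node)

text \<open>
  If \<open>D = a H\<^sub>x + b H\<^sub>y + \<Sum> c\<^sub>i E\<^sub>i\<close> is orthogonal to \<open>\<delta>\<close>, then \<open>4 (a + b)\<^sup>2 = (\<Sum> c\<^sub>i)\<^sup>2 \<le> 8 \<Sum>
  c\<^sub>i\<^sup>2\<close>, and \<open>2 (a + b)\<^sup>2 \<ge> 8 a b\<close>, hence \<open>2 a b \<le> \<Sum> c\<^sub>i\<^sup>2\<close>.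
\<close>

lemma intersection_semidefinite:
  assumes "D \<odot> delta = 0" shows "D \<odot> D \<le> 0"
proof (cases D)
  case (1 a b c1 c2 c3 c4 c5 c6 c7 c8)
  have s: "2 * (a + b) = - (c1 + c2 + c3 + c4 + c5 + c6 + c7 + c8)"
    using assms by (simp add: 1 delta_pv intersection_pv)
  define Q where "Q = c1\<^sup>2 + c2\<^sup>2 + c3\<^sup>2 + c4\<^sup>2 + c5\<^sup>2 + c6\<^sup>2 + c7\<^sup>2 + c8\<^sup>2"
  define d where "d = a + b"
  \<comment> \<open>The \<open>c\<^sub>i\<close> have mean \<open>- d / 4\<close>; that their variance is nonnegative is the inequality above.\<close>
  have "0 \<le> (4 * c1 + d)\<^sup>2 + (4 * c2 + d)\<^sup>2 + (4 * c3 + d)\<^sup>2 + (4 * c4 + d)\<^sup>2 + (4 * c5 + d)\<^sup>2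
     + (4 * c6 + d)\<^sup>2 + (4 * c7 + d)\<^sup>2 + (4 * c8 + d)\<^sup>2"
    by simp
  also have "\<dots> = 16 * Q + 8 * d * (c1 + c2 + c3 + c4 + c5 + c6 + c7 + c8) + 8 * d\<^sup>2"
    by (simp add: Q_def power2_eq_square algebra_simps)
  also have "\<dots> = 16 * Q - 8 * d\<^sup>2"
  proof -
    have "c1 + c2 + c3 + c4 + c5 + c6 + c7 + c8 = - 2 * d" using s by (simp add: d_def)
    then show ?thesis by (simp add: power2_eq_square)
  qed
  finally have "d\<^sup>2 \<le> 2 * Q" by simp
  moreover have "d\<^sup>2 = (a - b)\<^sup>2 + 4 * (a * b)" by (simp add: d_def power2_eq_square algebra_simps)
  ultimately have "2 * (a * b) \<le> Q" using zero_le_power2[of "a - b"] by linarith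
  then show ?thesis by (simp add: 1 intersection_pv Q_def power2_eq_square)
qed

definition refl_word :: "d6_node list \<Rightarrow> pic \<Rightarrow> pic" where
  "refl_word is = foldr (\<lambda>i f. reflection (beta i) \<circ> f) is id"

lemma refl_word_simps [simp]:
  "refl_word [] = id" "refl_word (i # is) = reflection (beta i) \<circ> refl_word is"
  by (simp_all add: refl_word_def)

lemma refl_word_append: "refl_word (is @ js) = refl_word is \<circ> refl_word js"
  by (induction "is") (simp_all add: comp_assoc)

text \<open>
  Reflecting \<open>D\<close> in a simple root with negative pairing lowers the intersection with
  \<open>rho_class\<close>, which cannot go on forever: \<open>D - rho_class\<close> is orthogonal to \<open>\<delta>\<close>, so
  semidefiniteness gives \<open>rho_class \<odot> D \<ge> rho_class \<odot> rho_class\<close> on the whole orbit.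
\<close>

lemma dominant_in_orbit:
  assumes "D \<odot> delta = rho_class \<odot> delta" "D \<odot> D = rho_class \<odot> rho_class"
  shows "\<exists>is. \<forall>i. refl_word is D \<odot> beta i \<ge> 0"
  using assms
proof (induction "nat (rho_class \<odot> D - rho_class \<odot> rho_class)" arbitrary: D rule: less_induct)
  case less
  show ?case
  proof (cases "\<forall>i. D \<odot> beta i \<ge> 0")
    case True
    then show ?thesis by (intro exI[of _ "[]"]) simp
  next
    case False
    then obtain i where i: "D \<odot> beta i < 0" by (auto simp: not_le)
    define D' where "D' = reflection (beta i) D"
    have "(D - rho_class) \<odot> (D - rho_class) \<le> 0"
      by (rule intersection_semidefinite) (simp add: intersection_linear less.prems)
    then have lower: "rho_class \<odot> D \<ge> rho_class \<odot> rho_class" if "D \<odot> D = rho_class \<odot> rho_class"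
      "D \<odot> delta = rho_class \<odot> delta" for D
      using that intersection_semidefinite[of "D - rho_class"] intersection_commute[of D rho_class]
        by (simp add: intersection_linear)
    have D': "D' \<odot> delta = rho_class \<odot> delta" "D' \<odot> D' = rho_class \<odot> rho_class"
      using less.prems lattice_aut_intersection[OF lattice_aut_reflection_beta, of i D]
        lattice_aut_delta[OF lattice_aut_reflection_beta, of i] unfolding D'_def by metis+
    have "rho_class \<odot> D' = rho_class \<odot> D + D \<odot> beta i"
      by (simp add: D'_def reflection_def intersection_linear rho_class_beta
        intersection_commute[of "beta i" D])
    then have "nat (rho_class \<odot> D' - rho_class \<odot> rho_class) < nat (rho_class \<odot> D - rho_class \<odot>
      rho_class)"
      using i lower[OF D'(2,1)] by simp
    from less.hyps[OF this D'] obtain "is" where "\<forall>i. refl_word is D' \<odot> beta i \<ge> 0" ..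
    then show ?thesis
      by (intro exI[of _ "is @ [i]"]) (simp add: refl_word_append D'_def)
  qed
qed

text \<open>
  Let \<open>h\<close> be the inverse of \<open>g\<close>. Each \<open>h \<beta>\<^sub>i\<close> is a root, and its height is the pairing of \<open>g
  rho_class\<close> with \<open>\<beta>\<^sub>i\<close>; as this is not negative, \<open>h\<close> maps positive roots to positive roots.
  Then so does \<open>g\<close>, and applying \<open>h\<close> to the expansion of \<open>g \<beta>\<^sub>i\<close> gives \<open>\<beta>\<^sub>i\<close>, of height one, as
  a combination of roots of height at least one with nonnegative coefficients. Hence there is
  only one term in it.
\<close>

lemma preserves_simple_roots:
  assumes g: "lattice_aut g" and star_set: "g star1 \<in> star_set" "g star2 \<in> star_set"
    "inv_into UNIV g star1 \<in> star_set" "inv_into UNIV g star2 \<in> star_set"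
    and dom: "\<And>i. g rho_class \<odot> beta i \<ge> 0"
  shows "\<exists>\<pi>. bij \<pi> \<and> (\<forall>i. g (beta i) = beta (\<pi> i)) \<and> (\<forall>i j. {\<pi> i, \<pi> j} \<in> d6_edges \<longleftrightarrow> {i, j} \<in> d6_edges)"
proof -
  define h where "h = inv_into UNIV g"
  have h: "lattice_aut h" unfolding h_def by (rule lattice_aut_inv[OF g])
  have gh: "g (h x) = x" "h (g x) = x" for x
    using lattice_aut_bij[OF g] by (simp_all add: h_def bij_is_inj bij_is_surj surj_f_inv_f)
  have range: "f (beta i) \<in> range root_embed"
    if f: "lattice_aut f" "lattice_aut f'" "\<And>x. f (f' x) = x" "f' star1 \<in> star_set"
    "f' star2 \<in> star_set" for f f' i
  proof -
    have *: "beta i \<odot> D = 0" if "D \<in> star_set" for D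
      using that by (cases i) (auto simp: star_set_def star_pv beta_pv intersection_pv pv_arith)
    have "beta i \<odot> delta = 0" by (cases i) (auto simp: delta_pv beta_pv intersection_pv pv_arith)
    then show ?thesis
      using *[OF f(4)] *[OF f(5)] lattice_aut_intersection[OF f(1)] lattice_aut_delta[OF f(1)] f(3)
      unfolding range_root_embed by metis
  qed
  have "\<forall>i. \<exists>c. h (beta i) = root_embed c" "\<forall>i. \<exists>c. g (beta i) = root_embed c"
    using range[OF h g] range[OF g h] gh star_set unfolding h_def by blast+
  then obtain N M where N: "\<And>i. h (beta i) = root_embed (N i)"
    and M: "\<And>i. g (beta i) = root_embed (M i)"
    by metis
  have root: "(\<forall>j. c $ j \<ge> 0) \<or> (\<forall>j. c $ j \<le> 0)" if "f (beta i) = root_embed c"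
    "lattice_aut f" for f i c
    by (rule root_positive_or_negative)
      (use that lattice_aut_intersection[OF that(2), of "beta i" "beta i"] beta_intersection[of i i]
       in \<open>simp add: cartan_def\<close>)
  have Nsum: "(\<Sum>j\<in>UNIV. N i $ j) \<ge> 0" for i
    using dom[of i] lattice_aut_intersection[OF h, of "g rho_class" "beta i"]
    by (simp add: gh N rho_class_root_embed)
  have Npos: "N i $ j \<ge> 0" for i j
    using root[OF N h]
  proof
    assume neg: "\<forall>j. N i $ j \<le> 0"
    have "(\<Sum>j\<in>UNIV. - N i $ j) = 0" using Nsum[of i] neg by (simp add: sum_negf sum_nonpos eq_iff)
    then show ?thesis using neg by (subst (asm) sum_nonneg_eq_0_iff) auto
  qed blast
  have rel: "axis i 1 = (\<Sum>j\<in>UNIV. M i $ j *s N j)" for i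
  proof -
    have "root_embed (axis i 1) = h (g (beta i))" by (simp add: root_embed_axis gh)
    also have "\<dots> = (\<Sum>j\<in>UNIV. M i $ j *s root_embed (N j))"
      by (simp add: M lattice_aut_root_embed[OF h] N)
    also have "\<dots> = root_embed (\<Sum>j\<in>UNIV. M i $ j *s N j)"
      by (simp add: UNIV_d6_node root_embed_linear)
    finally show ?thesis by (simp add: root_embed_inject)
  qed
  have Mpos: "M i $ j \<ge> 0" for i j
    using root[OF M g]
  proof
    assume neg: "\<forall>j. M i $ j \<le> 0"
    have "1 = (\<Sum>j\<in>UNIV. M i $ j * N j $ i)"
      using arg_cong[OF rel[of i], of "\<lambda>v. v $ i"] by simp
    also have "\<dots> \<le> 0" using neg Npos by (intro sum_nonpos mult_nonpos_nonneg) auto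
    finally show ?thesis by simp
  qed blast
  have height: "(\<Sum>k\<in>UNIV. N j $ k) \<ge> 1" for j
  proof -
    have "(\<Sum>k\<in>UNIV. N j $ k) \<noteq> 0"
    proof
      assume "(\<Sum>k\<in>UNIV. N j $ k) = 0"
      then have "N j = 0" using Npos by (subst (asm) sum_nonneg_eq_0_iff) (auto simp: vec_eq_iff)
      then have "h (beta j) \<odot> h (beta j) = 0" by (simp add: N root_embed_square D6_form_def)
      then show False using beta_intersection[of j j] lattice_aut_intersection[OF h, of "beta j"
        "beta j"]
        by (simp add: cartan_def)
    qed
    then show ?thesis using Nsum[of j] by simp
  qed
  have "\<exists>j. M i = axis j 1" for i
  proof -
    have "1 = (\<Sum>k\<in>UNIV. (axis i 1 :: int ^ d6_node) $ k)" by (simp add: axis_def)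
    also have "\<dots> = (\<Sum>k\<in>UNIV. \<Sum>j\<in>UNIV. M i $ j * N j $ k)"
      by (simp add: rel[of i])
    also have "\<dots> = (\<Sum>j\<in>UNIV. M i $ j * (\<Sum>k\<in>UNIV. N j $ k))"
      by (subst sum.swap) (simp add: sum_distrib_left)
    also have "\<dots> \<ge> (\<Sum>j\<in>UNIV. M i $ j * 1)"
      using Mpos height by (intro sum_mono mult_left_mono) auto
    finally have le: "(\<Sum>j\<in>UNIV. M i $ j) \<le> 1" by simp
    have "\<not> (\<forall>j. M i $ j = 0)"
    proof
      assume "\<forall>j. M i $ j = 0"
      then have "(axis i 1 :: int ^ d6_node) $ i = 0" by (simp add: rel[of i])
      then show False by (simp add: axis_def)
    qed
    then obtain j where j: "M i $ j \<noteq> 0" by blast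
    have "M i $ j + M i $ k \<le> 1" if "k \<noteq> j" for k
    proof -
      have "(\<Sum>l\<in>{j, k}. M i $ l) \<le> (\<Sum>l\<in>UNIV. M i $ l)" using Mpos by (intro sum_mono2) auto
      then show ?thesis using le that by simp
    qed
    moreover have "M i $ j \<le> 1"
      using le member_le_sum[of j UNIV "\<lambda>j. M i $ j"] Mpos by simp
    ultimately have "M i $ k = (if k = j then 1 else 0)" for k
      using j Mpos[of i j] Mpos[of i k] by (smt (verit))
    then show ?thesis by (intro exI[of _ j]) (simp add: vec_eq_iff axis_def)
  qed
  then obtain \<pi> where "\<And>i. M i = axis (\<pi> i) 1" by metis
  then have \<pi>: "g (beta i) = beta (\<pi> i)" for i by (simp add: M root_embed_axis)
  have cart: "cartan d6_edges (\<pi> i) (\<pi> j) = cartan d6_edges i j" for i j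
    using lattice_aut_intersection[OF g, of "beta i" "beta j"] beta_intersection \<pi> by simp
  have "inj \<pi>"
  proof (rule injI)
    fix i j assume "\<pi> i = \<pi> j"
    then show "i = j" using cart[of i j] by (simp add: cartan_def split: if_splits)
  qed
  then have "bij \<pi>" by (simp add: bij_def finite_UNIV_inj_surj)
  moreover have "{\<pi> i, \<pi> j} \<in> d6_edges \<longleftrightarrow> {i, j} \<in> d6_edges" for i j
  proof (cases "i = j")
    case True then show ?thesis by (auto simp: d6_edges_def doubleton_eq_iff)
  next
    case False
    then have "\<pi> i \<noteq> \<pi> j" using \<open>inj \<pi>\<close> by (simp add: inj_eq)
    then show ?thesis using cart[of i j] False
      by (simp add: cartan_def del: d6_edge_iff split: if_splits)
  qed
  ultimately show ?thesis using \<pi> by blast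
qed

section \<open>Generic parameters\<close>

definition coset :: "complex \<Rightarrow> complex \<Rightarrow> complex set" where
  "coset \<tau> z = period_lattice \<tau> #>\<^bsub>complex_group\<^esub> z"

lemma comm_group_complex_group: "comm_group complex_group"
  by (rule comm_groupI) (auto simp: complex_group_def intro!: exI[of _ "- x" for x])

lemma complex_group_simps [simp]:
  "carrier complex_group = UNIV" "x \<otimes>\<^bsub>complex_group\<^esub> y = x + y" "\<one>\<^bsub>complex_group\<^esub> = 0"
  by (simp_all add: complex_group_def)

lemma complex_group_inv [simp]: "inv\<^bsub>complex_group\<^esub> x = - x"
proof -
  interpret comm_group complex_group by (rule comm_group_complex_group)
  show ?thesis by (rule inv_equality) auto
qed

lemma comm_group_torus: "comm_group (torus \<tau>)"
  unfolding torus_def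
  using comm_group.abelian_FactGroup[OF comm_group_complex_group] normal_imp_subgroup
    normal_period_lattice
  by blast

lemma group_hom_coset: "group_hom complex_group (torus \<tau>) (coset \<tau>)"
  unfolding group_hom_def group_hom_axioms_def
  using comm_group.axioms(2)[OF comm_group_complex_group] comm_group.axioms(2)[OF comm_group_torus]
    normal.r_coset_hom_Mod[OF normal_period_lattice]
  by (auto simp: torus_def coset_def[abs_def])

lemma coset_add: "coset \<tau> x \<otimes>\<^bsub>torus \<tau>\<^esub> coset \<tau> y = coset \<tau> (x + y)"
  using group_hom.hom_mult[OF group_hom_coset, of x y \<tau>] by simp

lemma coset_inv: "inv\<^bsub>torus \<tau>\<^esub> (coset \<tau> x) = coset \<tau> (- x)"
  using group_hom.hom_inv[OF group_hom_coset, of x \<tau>] by simp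

lemma coset_0: "coset \<tau> 0 = \<one>\<^bsub>torus \<tau>\<^esub>"
  using group_hom.hom_one[OF group_hom_coset, of \<tau>] by simp

lemma coset_closed [simp]: "coset \<tau> x \<in> carrier (torus \<tau>)"
  using group_hom.hom_closed[OF group_hom_coset, of x \<tau>] by simp

lemma carrier_torus: "carrier (torus \<tau>) = range (coset \<tau>)"
  by (simp add: torus_def carrier_FactGroup coset_def)

lemma coset_int_pow: "coset \<tau> x [^]\<^bsub>torus \<tau>\<^esub> (k :: int) = coset \<tau> (of_int k * x)"
proof -
  interpret comm_group complex_group by (rule comm_group_complex_group)
  have nat: "x [^]\<^bsub>complex_group\<^esub> n = of_nat n * x" for n :: nat
    by (induction n) (auto simp: algebra_simps)
  have "x [^]\<^bsub>complex_group\<^esub> k = of_int k * x"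
    by (cases k rule: int_cases2) (simp_all add: int_pow_int int_pow_neg nat)
  then show ?thesis using group_hom.hom_int_pow[OF group_hom_coset, of x \<tau> k] by simp
qed

lemma coset_eq_one_iff: "coset \<tau> x = \<one>\<^bsub>torus \<tau>\<^esub> \<longleftrightarrow> x \<in> period_lattice \<tau>"
proof -
  interpret comm_group complex_group by (rule comm_group_complex_group)
  have "subgroup (period_lattice \<tau>) complex_group"
    by (rule normal_imp_subgroup[OF normal_period_lattice])
  then show ?thesis
    unfolding torus_def coset_def one_FactGroup
    using coset_join1[of "period_lattice \<tau>" x] coset_join2[of x "period_lattice \<tau>"] by auto
qed

lemma coset_finprod:
  "finite A \<Longrightarrow> finprod (torus \<tau>) (\<lambda>g. coset \<tau> (f g)) A = coset \<tau> (\<Sum>g\<in>A. f g)"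
proof (induction A rule: finite_induct)
  interpret comm_group "torus \<tau>" by (rule comm_group_torus)
  case empty
  show ?case by (simp add: coset_0)
next
  interpret comm_group "torus \<tau>" by (rule comm_group_torus)
  case (insert x F)
  then show ?case by (simp add: finprod_insert coset_add)
qed

definition eval_class :: "(pic_gen \<Rightarrow> complex) \<Rightarrow> pic \<Rightarrow> complex" where
  "eval_class v D = (\<Sum>g\<in>UNIV. of_int (D $ g) * v g)"

lemma iota_pull_coset: "iota_pull \<tau> (\<lambda>g. coset \<tau> (v g)) D = coset \<tau> (eval_class v D)"
  by (simp add: iota_pull_def coset_int_pow coset_finprod eval_class_def)

lemma eval_class_linear:
  "eval_class v (C + D) = eval_class v C + eval_class v D"
  "eval_class v (C - D) = eval_class v C - eval_class v D"
  "eval_class v (k *s C) = of_int k * eval_class v C"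
  by (simp_all add: eval_class_def algebra_simps sum.distrib sum_subtractf sum_distrib_left)

lemma eval_class_cls: "eval_class v (cls g) = v g"
  by (simp add: eval_class_def axis_def if_distrib[of of_int] if_distrib[of "\<lambda>x. x * _"] cong: if_cong)

lemma star_condition_coset:
  "star_condition \<tau> (\<lambda>g. coset \<tau> (v g)) \<longleftrightarrow>
     eval_class v star1 \<in> period_lattice \<tau> \<and> eval_class v star2 \<in> period_lattice \<tau>"
  by (simp add: star_condition_def coset_add coset_inv coset_eq_one_iff star1_def star2_def
      eval_class_linear eval_class_cls)

lemma star_condition_transform:
  assumes "lattice_aut (inv_into UNIV w)"
  shows "star_condition \<tau> (transform_params \<tau> w (\<lambda>g. coset \<tau> (v g))) \<longleftrightarrow>
     eval_class v (inv_into UNIV w star1) \<in> period_lattice \<tau> \<and>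
     eval_class v (inv_into UNIV w star2) \<in> period_lattice \<tau>"
proof -
  have t: "transform_params \<tau> w (\<lambda>g. coset \<tau> (v g)) =
      (\<lambda>g. coset \<tau> (eval_class v (inv_into UNIV w (cls g))))"
    by (simp add: transform_params_def iota_pull_coset fun_eq_iff)
  have *: "eval_class (\<lambda>g. eval_class v (inv_into UNIV w (cls g))) star1
    = eval_class v (inv_into UNIV w star1)"
    "eval_class (\<lambda>g. eval_class v (inv_into UNIV w (cls g))) star2
      = eval_class v (inv_into UNIV w star2)"
    by (simp_all add: star1_def star2_def lattice_aut_linear[OF assms] eval_class_linear eval_class_cls)
  show ?thesis unfolding t star_condition_coset * ..
qed

lemma Union_coset_image: "\<Union> (coset \<tau> ` B) = (\<Union>l\<in>period_lattice \<tau>. (+) l ` B)"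
  by (auto simp: coset_def r_coset_def)

lemma openin_coset_image: "open B \<Longrightarrow> openin (torus_topology \<tau>) (coset \<tau> ` B)"
  unfolding openin_torus_topology Union_coset_image
  by (auto intro!: open_UN open_translation)

lemma topspace_torus: "topspace (torus_topology \<tau>) = carrier (torus \<tau>)"
proof
  show "topspace (torus_topology \<tau>) \<subseteq> carrier (torus \<tau>)"
    using openin_torus_topology[of \<tau> "topspace (torus_topology \<tau>)"] by simp
  show "carrier (torus \<tau>) \<subseteq> topspace (torus_topology \<tau>)"
    using openin_coset_image[of UNIV \<tau>] openin_subset unfolding carrier_torus by blast
qed

lemma topspace_star_space:
  "p \<in> topspace (star_space \<tau>) \<longleftrightarrow> (\<exists>v. p = (\<lambda>g. coset \<tau> (v g)) \<and>
     eval_class v star1 \<in> period_lattice \<tau> \<and> eval_class v star2 \<in> period_lattice \<tau>)"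
proof
  assume p: "p \<in> topspace (star_space \<tau>)"
  then have "\<forall>g. p g \<in> range (coset \<tau>)" and s: "star_condition \<tau> p"
    by (auto simp: star_space_def topspace_torus carrier_torus PiE_def)
  then have "\<forall>g. \<exists>z. p g = coset \<tau> z" by blast
  then obtain v where "p = (\<lambda>g. coset \<tau> (v g))" by metis
  then show "\<exists>v. p = (\<lambda>g. coset \<tau> (v g)) \<and>
     eval_class v star1 \<in> period_lattice \<tau> \<and> eval_class v star2 \<in> period_lattice \<tau>"
    using s star_condition_coset by blast
next
  assume "\<exists>v. p = (\<lambda>g. coset \<tau> (v g)) \<and>
     eval_class v star1 \<in> period_lattice \<tau> \<and> eval_class v star2 \<in> period_lattice \<tau>"
  then show "p \<in> topspace (star_space \<tau>)"
    by (auto simp: star_space_def topspace_torus carrier_torus star_condition_coset)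
qed

lemma continuous_coset: "continuous_map euclidean (torus_topology \<tau>) (coset \<tau>)"
  unfolding continuous_map_def
proof (intro conjI allI impI)
  show "coset \<tau> \<in> topspace euclidean \<rightarrow> topspace (torus_topology \<tau>)"
    by (simp add: topspace_torus)
  fix U assume U: "openin (torus_topology \<tau>) U"
  have self: "z \<in> coset \<tau> z" for z
    unfolding coset_def r_coset_def period_lattice_def by (auto intro!: exI[of _ 0])
  have "coset \<tau> z \<in> U" if "X \<in> U" "z \<in> X" for X z
  proof -
    interpret comm_group complex_group by (rule comm_group_complex_group)
    have "X \<in> range (coset \<tau>)" using that U unfolding openin_torus_topology carrier_torus by blast
    then obtain y where "X = coset \<tau> y" by auto
    then have "X = coset \<tau> z"
      using repr_independence[of z "period_lattice \<tau>" y] that normal_imp_subgroup[OF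
        normal_period_lattice]
      by (simp add: coset_def)
    then show ?thesis using that by simp
  qed
  then have "{z \<in> topspace euclidean. coset \<tau> z \<in> U} = \<Union>U"
    using self by auto
  then show "openin euclidean {z \<in> topspace euclidean. coset \<tau> z \<in> U}"
    using U unfolding openin_torus_topology by simp
qed

text \<open>
  A chart of the space of parameters that satisfy the condition: the condition is solved for
  \<open>e\<^sub>6\<close> and \<open>e\<^sub>8\<close>, and the entries of the argument at \<open>E6\<close> and \<open>E8\<close> are ignored. The domain is a
  Euclidean space, hence a Baire space.
\<close>

definition star_lift :: "complex ^ pic_gen \<Rightarrow> pic_gen \<Rightarrow> complex" where
  "star_lift v g = (if g = E6 then v $ E1 + v $ E2 - v $ E5
                    else if g = E8 then v $ E3 + v $ E4 - v $ E7 else v $ g)"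

definition star_chart :: "complex \<Rightarrow> complex ^ pic_gen \<Rightarrow> pic_gen \<Rightarrow> complex set" where
  "star_chart \<tau> v = (\<lambda>g. coset \<tau> (star_lift v g))"

lemma eval_star_lift:
  "eval_class (star_lift v) D =
     of_int (D $ HX) * v $ HX + of_int (D $ HY) * v $ HY + of_int (D $ E1 + D $ E6) * v $ E1 +
     of_int (D $ E2 + D $ E6) * v $ E2 + of_int (D $ E3 + D $ E8) * v $ E3 +
     of_int (D $ E4 + D $ E8) * v $ E4 + of_int (D $ E5 - D $ E6) * v $ E5 +
     of_int (D $ E7 - D $ E8) * v $ E7"
  by (simp add: eval_class_def UNIV_pic_gen star_lift_def algebra_simps)

lemma zero_in_lattice: "0 \<in> period_lattice \<tau>"
  unfolding period_lattice_def by (auto intro!: exI[of _ 0])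

lemma star_chart_in_space: "star_chart \<tau> v \<in> topspace (star_space \<tau>)"
  unfolding topspace_star_space star_chart_def
  by (rule exI[of _ "star_lift v"]) (simp add: eval_star_lift star_pv zero_in_lattice)

lemma continuous_star_chart: "continuous_map euclidean (star_space \<tau>) (star_chart \<tau>)"
  unfolding star_space_def continuous_map_in_subtopology
proof
  show "star_chart \<tau> \<in> topspace euclidean \<rightarrow> {p. star_condition \<tau> p}"
    using star_chart_in_space[of \<tau>] by (auto simp: star_space_def)
  have "continuous_map euclidean (torus_topology \<tau>) (coset \<tau> \<circ> (\<lambda>v. star_lift v g))" for g
  proof (rule continuous_map_compose[OF _ continuous_coset])
    show "continuous_map euclidean euclidean (\<lambda>v. star_lift v g)"
      by (cases g) (auto simp: star_lift_def intro!: continuous_intros)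
  qed
  then show "continuous_map euclidean (product_topology (\<lambda>_. torus_topology \<tau>) UNIV) (star_chart \<tau>)"
    unfolding continuous_map_componentwise_UNIV star_chart_def by (simp add: comp_def)
qed

text \<open>
  Openness of the chart is what makes preimages of dense sets dense. A box around a point of
  \<open>O'\<close> is mapped onto all parameters that satisfy the condition and whose free entries lie in
  the images of the sides of the box, because the two remaining entries are determined by the
  free ones.
\<close>

lemma star_chart_open:
  assumes "open O'" "O' \<noteq> {}"
  shows "\<exists>T. openin (star_space \<tau>) T \<and> T \<noteq> {} \<and> T \<subseteq> star_chart \<tau> ` O'"
proof -
  obtain v0 where v0: "v0 \<in> O'" using assms by blast
  obtain B where B: "\<And>g. open (B g)" "\<And>g. v0 $ g \<in> B g" "\<And>v. (\<And>g. v $ g \<in> B g) \<Longrightarrow> v \<in> O'"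
    using assms(1) v0 unfolding open_vec_def by metis
  define T' where "T' = (\<Pi>\<^sub>E g\<in>UNIV. if g \<in> {E6, E8} then topspace (torus_topology \<tau>) else coset \<tau>
    ` B g)"
  define T where "T = T' \<inter> {p. star_condition \<tau> p}"
  have "openin (product_topology (\<lambda>_. torus_topology \<tau>) UNIV) T'"
    unfolding T'_def by (rule product_topology_basis) (auto simp: openin_coset_image B)
  then have "openin (star_space \<tau>) T"
    by (auto simp: star_space_def openin_subtopology T_def)
  moreover have "star_chart \<tau> v0 \<in> T"
    using star_chart_in_space[of \<tau> v0] B(2)
    by (auto simp: T_def T'_def star_space_def star_chart_def star_lift_def topspace_torus)
  moreover have "T \<subseteq> star_chart \<tau> ` O'"
  proof
    fix p assume p: "p \<in> T"
    then have "p \<in> topspace (star_space \<tau>)"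
      using \<open>openin (star_space \<tau>) T\<close> openin_subset by blast
    then obtain u where u: "p = (\<lambda>g. coset \<tau> (u g))" unfolding topspace_star_space by blast
    have "\<exists>z. z \<in> B g \<and> (g \<notin> {E6, E8} \<longrightarrow> p g = coset \<tau> z)" for g
    proof (cases "g \<in> {E6, E8}")
      case True then show ?thesis using B(2) by blast
    next
      case False
      then have "p g \<in> coset \<tau> ` B g" using p unfolding T_def T'_def
        by (auto simp: PiE_iff split: if_splits)
      then show ?thesis by blast
    qed
    then obtain z where z: "\<And>g. z g \<in> B g" "\<And>g. g \<notin> {E6, E8} \<Longrightarrow> p g = coset \<tau> (z g)"
      by metis
    define v where "v = (\<chi> g. z g)"
    have v: "v \<in> O'" by (rule B(3)) (simp add: v_def z)
    interpret G: comm_group "torus \<tau>" by (rule comm_group_torus)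
    have star: "star_condition \<tau> p" using p by (simp add: T_def)
    have solve: "d = a \<otimes>\<^bsub>torus \<tau>\<^esub> b \<otimes>\<^bsub>torus \<tau>\<^esub> inv\<^bsub>torus \<tau>\<^esub> c"
      if "a \<otimes>\<^bsub>torus \<tau>\<^esub> b \<otimes>\<^bsub>torus \<tau>\<^esub> inv\<^bsub>torus \<tau>\<^esub> c \<otimes>\<^bsub>torus \<tau>\<^esub> inv\<^bsub>torus \<tau>\<^esub> d = \<one>\<^bsub>torus \<tau>\<^esub>"
        "a \<in> carrier (torus \<tau>)" "b \<in> carrier (torus \<tau>)" "c \<in> carrier (torus \<tau>)" "d \<in> carrier (torus \<tau>)"
      for a b c d
      using that G.inv_solve_right[of "\<one>\<^bsub>torus \<tau>\<^esub>" "a \<otimes>\<^bsub>torus \<tau>\<^esub> b \<otimes>\<^bsub>torus \<tau>\<^esub> inv\<^bsub>torus \<tau>\<^esub> c" d] by auto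
    have "p g \<in> carrier (torus \<tau>)" for g by (simp add: u)
    then have "p E6 = p E1 \<otimes>\<^bsub>torus \<tau>\<^esub> p E2 \<otimes>\<^bsub>torus \<tau>\<^esub> inv\<^bsub>torus \<tau>\<^esub> p E5"
      "p E8 = p E3 \<otimes>\<^bsub>torus \<tau>\<^esub> p E4 \<otimes>\<^bsub>torus \<tau>\<^esub> inv\<^bsub>torus \<tau>\<^esub> p E7"
      using star unfolding star_condition_def by (metis solve)+
    then have "p g = star_chart \<tau> v g" for g
      by (cases "g = E6 \<or> g = E8") (auto simp: star_chart_def star_lift_def z v_def coset_add coset_inv)
    then show "p \<in> star_chart \<tau> ` O'" using v by blast
  qed
  ultimately show ?thesis by blast
qed

lemma countable_period_lattice: "countable (period_lattice \<tau>)"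
proof -
  have "period_lattice \<tau> = (\<lambda>(m, n). of_int m + of_int n * \<tau>) ` (UNIV :: (int \<times> int) set)"
    unfolding period_lattice_def by auto
  then show ?thesis by (simp only: countable_image countableI_type)
qed

definition star_span :: "pic set" where
  "star_span = {m *s star1 + n *s star2 | m n. True}"

text \<open>
  On the chart, the value of the class \<open>D\<close> is a linear form, and it vanishes identically only
  for \<open>D\<close> in the span of \<open>star1\<close> and \<open>star2\<close>.
\<close>

lemma dense_avoiding_hyperplane:
  assumes "D \<notin> star_span"
  shows "open {v. eval_class (star_lift v) D \<noteq> c} \<and> closure {v. eval_class (star_lift v) D \<noteq> c} = UNIV"
proof
  let ?l = "\<lambda>v. eval_class (star_lift v) D"
  have "continuous_on UNIV ?l"
    unfolding eval_star_lift by (intro continuous_intros)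
  then show "open {v. ?l v \<noteq> c}"
    using open_Collect_neq[of ?l "\<lambda>_. c"] by simp
  have "D \<in> star_span" if "\<And>g. ?l (axis g 1) = 0"
  proof -
    have "D = (- (D $ E6)) *s star1 + (- (D $ E8)) *s star2"
      using that[of HX] that[of HY] that[of E1] that[of E2] that[of E3] that[of E4] that[of E5]
        that[of E7]
      unfolding eval_star_lift by (simp add: axis_def pic_eq_iff star_pv flip: of_int_add of_int_diff)
    then show ?thesis unfolding star_span_def by blast
  qed
  then obtain g where g: "?l (axis g 1) \<noteq> 0" using assms by blast
  have line: "?l (v + t *\<^sub>R axis g 1) = ?l v + t *\<^sub>R ?l (axis g 1)" for v t
    unfolding eval_star_lift by (simp add: algebra_simps scaleR_conv_of_real[where 'a = complex])
  have "v \<in> closure {v. ?l v \<noteq> c}" for v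
    unfolding closure_approachable
  proof (intro allI impI)
    fix e :: real assume e: "e > 0"
    show "\<exists>y\<in>{v. ?l v \<noteq> c}. dist y v < e"
    proof (cases "?l v = c")
      case True
      then have "?l (v + (e / 2) *\<^sub>R axis g 1) \<noteq> c" using g e by (simp add: line)
      moreover have "dist (v + (e / 2) *\<^sub>R axis g 1) v < e" using e by (simp add: dist_norm)
      ultimately show ?thesis by blast
    next
      case False
      then show ?thesis using e by (intro bexI[of _ v]) auto
    qed
  qed
  then show "closure {v. ?l v \<noteq> c} = UNIV" by blast
qed

text \<open>
  Suppose that \<open>D\<close> is not in the span. Then the preimages of the given dense open sets, together
  with the complements of the hyperplanes on which \<open>D\<close> takes a given value in the period
  lattice, are countably many dense open sets. A common point contradicts the hypothesis on \<open>P\<close>.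
\<close>

lemma generic_class_in_star_span:
  assumes gen: "generically (star_space \<tau>) P"
    and P: "\<And>v. P (\<lambda>g. coset \<tau> (v g)) \<Longrightarrow> eval_class v D \<in> period_lattice \<tau>"
  shows "D \<in> star_span"
proof (rule ccontr)
  assume D: "D \<notin> star_span"
  obtain \<U> where \<U>: "countable \<U> \<and>
      (\<forall>U\<in>\<U>. openin (star_space \<tau>) U \<and> star_space \<tau> closure_of U = topspace (star_space \<tau>)) \<and>
      (\<forall>p\<in>topspace (star_space \<tau>) \<inter> \<Inter>\<U>. P p)"
    using gen unfolding generically_def ..
  have U: "countable \<U>" "\<And>U. U \<in> \<U> \<Longrightarrow> openin (star_space \<tau>) U"
    "\<And>U. U \<in> \<U> \<Longrightarrow> star_space \<tau> closure_of U = topspace (star_space \<tau>)"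
    using \<U> by simp_all
  define \<G> where "\<G> = (\<lambda>U. {v. star_chart \<tau> v \<in> U}) ` \<U> \<union>
     (\<lambda>c. {v. eval_class (star_lift v) D \<noteq> c}) ` period_lattice \<tau>"
  have "UNIV \<subseteq> closure (\<Inter>\<G>)"
  proof (rule Baire)
    show "closed (UNIV :: (complex ^ pic_gen) set)" by simp
    show "countable \<G>" by (simp add: \<G>_def U countable_period_lattice)
    fix T assume "T \<in> \<G>"
    then consider (space) U where "U \<in> \<U>" "T = {v. star_chart \<tau> v \<in> U}"
      | (lattice) c where "T = {v. eval_class (star_lift v) D \<noteq> c}"
      unfolding \<G>_def by (elim UnE imageE)
    then show "openin (top_of_set UNIV) T \<and> UNIV \<subseteq> closure T"
    proof cases
      case space
      have "open T"
        using continuous_star_chart[of \<tau>] U(2)[OF space(1)] unfolding continuous_map_def space(2)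
          by simp
      moreover have "UNIV \<subseteq> closure T"
      proof (rule ccontr)
        assume "\<not> UNIV \<subseteq> closure T"
        then have "- closure T \<noteq> {}" by blast
        with star_chart_open[of "- closure T" \<tau>] obtain V
          where V: "openin (star_space \<tau>) V" "V \<noteq> {}" "V \<subseteq> star_chart \<tau> ` (- closure T)"
          by (auto simp: open_Compl)
        then have "U \<inter> V \<noteq> {}"
          using U(3)[OF space(1)] unfolding dense_intersects_open by simp
        then obtain u where "star_chart \<tau> u \<in> U" "u \<in> - closure T" using V(3) by auto
        then show False using closure_subset[of T] by (auto simp: space(2))
      qed
      ultimately show ?thesis by simp
    next
      case lattice
      then show ?thesis using dense_avoiding_hyperplane[OF D] by simp
    qed
  qed
  then have "\<Inter>\<G> \<noteq> {}" by auto
  then obtain v where v: "v \<in> \<Inter>\<G>" by blast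
  have "star_chart \<tau> v \<in> U" if "U \<in> \<U>" for U
  proof -
    have "{v. star_chart \<tau> v \<in> U} \<in> \<G>" using that by (simp add: \<G>_def)
    then show ?thesis using v by auto
  qed
  then have "star_chart \<tau> v \<in> \<Inter>\<U>" by simp
  then have "P (star_chart \<tau> v)" using \<U> star_chart_in_space by simp
  then have "eval_class (star_lift v) D \<in> period_lattice \<tau>"
    unfolding star_chart_def by (rule P)
  then have "{u. eval_class (star_lift u) D \<noteq> eval_class (star_lift v) D} \<in> \<G>" by (simp add: \<G>_def)
  then show False using v by auto
qed

lemma star_span_norm:
  assumes "D \<in> star_span" "D \<odot> D = - 4" shows "D \<in> star_set"
proof -
  obtain m n where D: "D = m *s star1 + n *s star2" using assms(1) unfolding star_span_def by blast
  have mn: "m\<^sup>2 + n\<^sup>2 = 1" using assms(2)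
    by (simp add: D star_pv pv_arith intersection_pv power2_eq_square)
  then have "m\<^sup>2 \<le> 1" "n\<^sup>2 \<le> 1" using zero_le_power2[of m] zero_le_power2[of n] by linarith+
  then have "\<bar>m\<bar> \<le> 1" "\<bar>n\<bar> \<le> 1" by (simp_all add: abs_square_le_1)
  then have "m \<in> {-1, 0, 1}" "n \<in> {-1, 0, 1}" by auto
  then show ?thesis using mn by (auto simp: D star_set_def vec_eq_iff)
qed

lemma star_square: "star1 \<odot> star1 = - 4" "star2 \<odot> star2 = - 4"
  by (simp_all add: star_pv intersection_pv)

text \<open>
  The transformed parameters satisfy the condition iff the original ones kill the two inverse
  images. Being isometric images of \<open>star1\<close> and \<open>star2\<close>, these lie in the span only if they are
  among the four vectors of square \<open>-4\<close>.
\<close>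

lemma preserves_star_iff:
  assumes "lattice_aut w"
  shows "generically (star_space \<tau>) (\<lambda>p. star_condition \<tau> (transform_params \<tau> w p)) \<longleftrightarrow>
    inv_into UNIV w star1 \<in> star_set \<and> inv_into UNIV w star2 \<in> star_set"
proof
  have f: "lattice_aut (inv_into UNIV w)" by (rule lattice_aut_inv[OF assms])
  assume gen: "generically (star_space \<tau>) (\<lambda>p. star_condition \<tau> (transform_params \<tau> w p))"
  have "inv_into UNIV w star1 \<in> star_span" "inv_into UNIV w star2 \<in> star_span"
    by (rule generic_class_in_star_span[OF gen]; simp add: star_condition_transform[OF f])+
  then show "inv_into UNIV w star1 \<in> star_set \<and> inv_into UNIV w star2 \<in> star_set"
    using lattice_aut_intersection[OF f, of star1 star1] lattice_aut_intersection[OF f, of star2 star2]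
    by (simp_all add: star_span_norm star_square)
next
  have f: "lattice_aut (inv_into UNIV w)" by (rule lattice_aut_inv[OF assms])
  assume star_set: "inv_into UNIV w star1 \<in> star_set \<and> inv_into UNIV w star2 \<in> star_set"
  have neg: "- x \<in> period_lattice \<tau>" if "x \<in> period_lattice \<tau>" for x
    using subgroup.m_inv_closed[OF normal_imp_subgroup[OF normal_period_lattice] that] by simp
  have uminus: "eval_class v (- C) = - eval_class v C" for v C
    using eval_class_linear(2)[of v 0 C] by (simp add: eval_class_def)
  have "star_condition \<tau> (transform_params \<tau> w p)" if "p \<in> topspace (star_space \<tau>)" for p
    using that star_set unfolding topspace_star_space
    by (auto simp: star_condition_transform[OF f] star_set_def uminus neg)
  then show "generically (star_space \<tau>) (\<lambda>p. star_condition \<tau> (transform_params \<tau> w p))"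
    unfolding generically_def by (intro exI[of _ "{}"]) simp
qed

section \<open>Diagram automorphisms and the dihedral group\<close>

lemma word_eq_context: "word_eq R u v \<Longrightarrow> word_eq R (a @ u @ b) (a @ v @ b)"
proof (induction rule: word_eq.induct)
  case (cancel u x c v)
  show ?case using word_eq.cancel[of R "a @ u" x c "v @ b"] by simp
next
  case (relator r u v)
  then show ?case using word_eq.relator[of r R "a @ u" "v @ b"] by simp
qed (blast intro: word_eq.intros)+

lemma word_class_eq_iff: "word_class R u = word_class R v \<longleftrightarrow> word_eq R u v"
  unfolding word_class_def using word_eq.refl word_eq.sym word_eq.trans by blast

lemma presented_group_mult:
  "word_class R u \<otimes>\<^bsub>presented_group R\<^esub> word_class R v = word_class R (u @ v)"
proof -
  have "word_class R (u' @ v') = word_class R (u @ v)"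
    if "u' \<in> word_class R u" "v' \<in> word_class R v" for u' v'
  proof -
    have "word_eq R u u'" "word_eq R v v'" using that by (simp_all add: word_class_def)
    then have "word_eq R (u @ v) (u' @ v)" "word_eq R (u' @ v) (u' @ v')"
      using word_eq_context[of R u u' "[]" v] word_eq_context[of R v v' u' "[]"] by simp_all
    then show ?thesis unfolding word_class_eq_iff using word_eq.sym word_eq.trans by blast
  qed
  moreover have "u \<in> word_class R u" "v \<in> word_class R v"
    by (simp_all add: word_class_def word_eq.refl)
  ultimately have "(\<Union>u'\<in>word_class R u. \<Union>v'\<in>word_class R v. word_class R (u' @ v'))
  = word_class R (u @ v)"
    by blast
  then show ?thesis by (simp add: presented_group_def)
qed

lemma word_eq_append_cong:
  "word_eq R u u' \<Longrightarrow> word_eq R v v' \<Longrightarrow> word_eq R (u @ v) (u' @ v')"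
  using word_eq_context[of R u u' "[]" v] word_eq_context[of R v v' u' "[]"] word_eq.trans
  by fastforce

abbreviation D4_eq (infix "\<approx>" 50) where "u \<approx> v \<equiv> word_eq dihedral_D4 u v"

abbreviation "s1 \<equiv> (S1, True)"
abbreviation "s2 \<equiv> (S2, True)"

lemma D4_relators: "[s1, s1, s1, s1] \<approx> []" "[s2, s2] \<approx> []" "[s2, s1, s2, s1] \<approx> []"
  by (rule word_eq.relator[of _ dihedral_D4 "[]" "[]", simplified];
      simp add: dihedral_D4_def numeral_eq_Suc)+

lemma D4_swap: "[s2, s1] \<approx> [s1, s1, s1, s2]"
proof -
  note trans [trans] = word_eq.trans
  \<comment> \<open>Insert \<open>s\<^sub>2\<^sup>2\<close> and \<open>s\<^sub>1\<^sup>4\<close> so that the mixed relator appears at the front.\<close>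
  have "[s2, s1] \<approx> [s2, s1, s2, s2]"
    using word_eq_append_cong[OF word_eq.refl[of _ "[s2, s1]"] D4_relators(2)]
      by (simp add: word_eq.sym)
  also have "\<dots> \<approx> [s2, s1, s2, s1, s1, s1, s1, s2]"
    using word_eq_context[OF D4_relators(1), of "[s2, s1, s2]" "[s2]"] by (simp add: word_eq.sym)
  also have "\<dots> \<approx> [s1, s1, s1, s2]"
    using word_eq_context[OF D4_relators(3), of "[]" "[s1, s1, s1, s2]"] by simp
  finally show ?thesis .
qed

lemma D4_reduce_s1: "replicate k s1 @ u \<approx> replicate (k mod 4) s1 @ u"
proof (induction k rule: less_induct)
  case (less k)
  show ?case
  proof (cases "k < 4")
    case True then show ?thesis by (simp add: word_eq.refl)
  next
    case False
    then obtain m where m: "k = 4 + m" using le_Suc_ex by (metis not_less)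
    have "replicate k s1 @ u \<approx> replicate m s1 @ u"
      using word_eq_context[OF D4_relators(1), of "[]" "replicate m s1 @ u"]
      by (simp add: m numeral_eq_Suc)
    then show ?thesis using less[of m] m word_eq.trans by fastforce
  qed
qed

lemma D4_reduce_s2: "replicate k s2 \<approx> replicate (k mod 2) s2"
proof (induction k rule: less_induct)
  case (less k)
  show ?case
  proof (cases "k < 2")
    case True then show ?thesis by (simp add: word_eq.refl)
  next
    case False
    then obtain m where m: "k = 2 + m" using le_Suc_ex by (metis not_less)
    have "replicate k s2 \<approx> replicate m s2"
      using word_eq_context[OF D4_relators(2), of "[]" "replicate m s2"]
      by (simp add: m numeral_eq_Suc)
    then show ?thesis using less[of m] m word_eq.trans by fastforce
  qed
qed

lemma D4_move: "s2 # replicate i s1 @ u \<approx> replicate (3 * i) s1 @ s2 # u"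
proof (induction i)
  note trans [trans] = word_eq.trans
  case (Suc i)
  have "s2 # replicate (Suc i) s1 @ u \<approx> [s1, s1, s1] @ (s2 # replicate i s1 @ u)"
    using word_eq_context[OF D4_swap, of "[]" "replicate i s1 @ u"] by simp
  also have "\<dots> \<approx> [s1, s1, s1] @ (replicate (3 * i) s1 @ s2 # u)"
    by (rule word_eq_append_cong[OF word_eq.refl Suc])
  finally show ?case by (simp add: numeral_eq_Suc)
qed (simp add: word_eq.refl)

definition D4_nf :: "nat \<Rightarrow> nat \<Rightarrow> (dihedral_gen \<times> bool) list" where
  "D4_nf i j = replicate i s1 @ replicate j s2"

lemma D4_nf_reduce: "D4_nf i j \<approx> D4_nf (i mod 4) (j mod 2)"
  unfolding D4_nf_def
  using word_eq.trans[OF D4_reduce_s1 word_eq_append_cong[OF word_eq.refl D4_reduce_s2]] .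

lemma D4_inverse_letters: "[(S1, False)] \<approx> [s1, s1, s1]" "[(S2, False)] \<approx> [s2]"
proof -
  note trans [trans] = word_eq.trans
  have "[(S1, False)] \<approx> [(S1, False), s1, s1, s1, s1]"
    using word_eq_context[OF D4_relators(1), of "[(S1, False)]" "[]"] by (simp add: word_eq.sym)
  also have "\<dots> \<approx> [s1, s1, s1]"
    using word_eq.cancel[of dihedral_D4 "[]" S1 False "[s1, s1, s1]"] by simp
  finally show "[(S1, False)] \<approx> [s1, s1, s1]" .
  have "[(S2, False)] \<approx> [(S2, False), s2, s2]"
    using word_eq_context[OF D4_relators(2), of "[(S2, False)]" "[]"] by (simp add: word_eq.sym)
  also have "\<dots> \<approx> [s2]"
    using word_eq.cancel[of dihedral_D4 "[]" S2 False "[s2]"] by simp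
  finally show "[(S2, False)] \<approx> [s2]" .
qed

lemma D4_s1_nf: "s1 # D4_nf i j \<approx> D4_nf (Suc i) j"
  by (simp add: D4_nf_def word_eq.refl)

lemma D4_s2_nf: "s2 # D4_nf i j \<approx> D4_nf (3 * i) (Suc j)"
  using D4_move[of i "replicate j s2"] by (simp add: D4_nf_def)

text \<open>
  There are at most eight classes of words: letters are moved past each other by \<open>s\<^sub>2 s\<^sub>1 =
  s\<^sub>1\<^sup>3 s\<^sub>2\<close>, inverses are powers, and exponents are reduced.
\<close>

lemma D4_normal_form: "\<exists>i < 4. \<exists>j < 2. u \<approx> D4_nf i j"
proof -
  have "\<exists>i j. u \<approx> D4_nf i j"
  proof (induction u)
    case Nil
    show ?case by (intro exI[of _ 0]) (simp add: D4_nf_def word_eq.refl)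
  next
    case (Cons l u)
    then obtain i j where ij: "u \<approx> D4_nf i j" by blast
    have l: "l # u \<approx> w @ D4_nf i j" if "[l] \<approx> w" for w
      using word_eq_append_cong[OF that ij] by simp
    consider "l = s1" | "l = (S1, False)" | "l = s2" | "l = (S2, False)"
      by (cases l; cases "fst l"; cases "snd l") auto
    then show ?case
    proof cases
      case 1
      then show ?thesis using word_eq.trans[OF l[OF word_eq.refl]] D4_s1_nf[of i j] by auto
    next
      case 2
      have "[s1, s1, s1] @ D4_nf i j = D4_nf (3 + i) j" by (simp add: D4_nf_def numeral_3_eq_3)
      then show ?thesis using l[OF D4_inverse_letters(1)[folded 2]] by metis
    next
      case 3
      then show ?thesis using word_eq.trans[OF l[OF word_eq.refl]] D4_s2_nf[of i j] by auto
    next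
      case 4
      then show ?thesis using word_eq.trans[OF l[OF D4_inverse_letters(2)[folded 4]]] D4_s2_nf[of i
        j] by auto
    qed
  qed
  then obtain i j where "u \<approx> D4_nf i j" by blast
  then have "u \<approx> D4_nf (i mod 4) (j mod 2)" using D4_nf_reduce word_eq.trans by blast
  moreover have "i mod 4 < 4" "j mod 2 < 2" by simp_all
  ultimately show ?thesis by blast
qed

lemma node_fun_eq_iff: "f = g \<longleftrightarrow> f N0 = g N0 \<and> f N1 = g N1 \<and> f N2 = g N2 \<and> f N3 = g N3 \<and>
    f N4 = g N4 \<and> f N5 = g N5 \<and> f N6 = g N6"
  by (simp add: fun_eq_iff all_d6_node)

fun D4_letter :: "dihedral_gen \<times> bool \<Rightarrow> d6_node \<Rightarrow> d6_node" where
  "D4_letter (S1, True) = sigma1_node"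
| "D4_letter (S1, False) = sigma1_node ^^ 3"
| "D4_letter (S2, _) = sigma2_node"

definition D4_eval :: "(dihedral_gen \<times> bool) list \<Rightarrow> d6_node \<Rightarrow> d6_node" where
  "D4_eval u = foldr (\<lambda>l f. D4_letter l \<circ> f) u id"

lemma D4_eval_simps [simp]: "D4_eval [] = id" "D4_eval (l # u) = D4_letter l \<circ> D4_eval u"
  by (simp_all add: D4_eval_def)

lemma D4_eval_append: "D4_eval (u @ v) = D4_eval u \<circ> D4_eval v"
  by (induction u) (simp_all add: comp_assoc)

lemma D4_eval_word_eq: "u \<approx> v \<Longrightarrow> D4_eval u = D4_eval v"
proof (induction rule: word_eq.induct)
  case (cancel u x b v)
  have "D4_letter (x, b) \<circ> D4_letter (x, \<not> b) = id"
    by (cases x; cases b) (simp_all add: node_fun_eq_iff numeral_3_eq_3)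
  then show ?case by (simp add: D4_eval_append flip: comp_assoc)
next
  case (relator r u v)
  have "D4_eval r = id"
    using relator by (auto simp: dihedral_D4_def numeral_eq_Suc node_fun_eq_iff)
  then show ?case by (simp add: D4_eval_append)
qed auto

lemma D4_eval_nf: "D4_eval (D4_nf i j) = sigma1_node ^^ i \<circ> sigma2_node ^^ j"
proof -
  have "D4_eval (replicate i s1) = sigma1_node ^^ i" "D4_eval (replicate j s2) = sigma2_node ^^ j"
    by (induction i; simp) (induction j; simp)
  then show ?thesis by (simp add: D4_nf_def D4_eval_append)
qed

lemma less_4: "(i :: nat) < 4 \<longleftrightarrow> i \<in> {0, 1, 2, 3}" and less_2: "(i :: nat) < 2 \<longleftrightarrow> i \<in> {0, 1}"
  by auto

lemma sigma_powers_inject: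
  assumes "i < 4" "j < 2" "i' < 4" "j' < 2"
    and "sigma1_node ^^ i \<circ> sigma2_node ^^ j = sigma1_node ^^ i' \<circ> sigma2_node ^^ j'"
  shows "i = i' \<and> j = j'"
  using assms unfolding less_4 less_2
  by (auto simp: node_fun_eq_iff numeral_eq_Suc)

definition is_diagram_aut :: "(d6_node \<Rightarrow> d6_node) \<Rightarrow> bool" where
  "is_diagram_aut \<pi> \<longleftrightarrow> bij \<pi> \<and> (\<forall>i j. {\<pi> i, \<pi> j} \<in> d6_edges \<longleftrightarrow> {i, j} \<in> d6_edges)"

lemma carrier_diagram_aut: "carrier (diagram_aut_group d6_edges) = {\<pi>. is_diagram_aut \<pi>}"
  by (simp add: diagram_aut_group_def is_diagram_aut_def)

lemma is_diagram_aut_comp: "is_diagram_aut f \<Longrightarrow> is_diagram_aut g \<Longrightarrow> is_diagram_aut (f \<circ> g)"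
  unfolding is_diagram_aut_def by (auto simp: bij_comp simp del: d6_edge_iff)

lemma is_diagram_aut_inv:
  assumes "is_diagram_aut \<rho>" shows "is_diagram_aut (inv_into UNIV \<rho>)"
proof -
  have "bij \<rho>" using assms by (simp add: is_diagram_aut_def)
  then have "\<rho> (inv_into UNIV \<rho> i) = i" for i by (simp add: bij_is_surj surj_f_inv_f)
  then show ?thesis
    using assms[unfolded is_diagram_aut_def, THEN conjunct2, rule_format,
        of "inv_into UNIV \<rho> _" "inv_into UNIV \<rho> _"] bij_imp_bij_inv[OF \<open>bij \<rho>\<close>]
    unfolding is_diagram_aut_def by (simp del: d6_edge_iff)
qed

lemma d6_no_loop [simp]: "{i} \<notin> d6_edges"
  by (simp add: d6_edges_def doubleton_eq_iff)

lemma is_diagram_aut_sigma: "is_diagram_aut sigma1_node" "is_diagram_aut sigma2_node"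
proof -
  have b1: "bij sigma1_node"
    by (rule o_bij[of "sigma1_node ^^ 3"]; unfold node_fun_eq_iff; simp add: numeral_3_eq_3)
  have b2: "bij sigma2_node"
    by (rule o_bij[of sigma2_node]; unfold node_fun_eq_iff; simp)
  have e1: "{sigma1_node i, sigma1_node j} \<in> d6_edges \<longleftrightarrow> {i, j} \<in> d6_edges" for i j
    by (cases i; cases j; simp)
  have e2: "{sigma2_node i, sigma2_node j} \<in> d6_edges \<longleftrightarrow> {i, j} \<in> d6_edges" for i j
    by (cases i; cases j; simp)
  show "is_diagram_aut sigma1_node" unfolding is_diagram_aut_def using b1 e1 by blast
  show "is_diagram_aut sigma2_node" unfolding is_diagram_aut_def using b2 e2 by blast
qed

lemma is_diagram_aut_D4_eval: "is_diagram_aut (D4_eval u)"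
proof (induction u)
  case Nil
  show ?case unfolding is_diagram_aut_def D4_eval_simps by (intro conjI bij_id) (simp del: d6_edge_iff)
next
  case (Cons l u)
  have "is_diagram_aut (D4_letter l)"
    by (cases l rule: D4_letter.cases)
      (simp_all add: is_diagram_aut_sigma is_diagram_aut_comp numeral_3_eq_3)
  then show ?case unfolding D4_eval_simps using Cons by (rule is_diagram_aut_comp)
qed

text \<open>
  The nodes \<open>N2\<close> and \<open>N4\<close> are the only ones with three neighbours, so they are fixed or
  exchanged, and \<open>N3\<close> is fixed as their common neighbour. What is left is the choice of the
  images of the two leaves at \<open>N2\<close> and of the two leaves at \<open>N4\<close>.
\<close>

lemma diagram_aut_is_sigma_power:
  assumes "is_diagram_aut \<pi>"
  shows "\<exists>i < 4. \<exists>j < 2. \<pi> = sigma1_node ^^ i \<circ> sigma2_node ^^ j"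
proof -
  have "\<forall>i j. {i, j} \<in> d6_edges \<longrightarrow> {\<pi> i, \<pi> j} \<in> d6_edges"
    using assms by (simp add: is_diagram_aut_def del: d6_edge_iff)
  then have edge: "{\<pi> N2, \<pi> N0} \<in> d6_edges" "{\<pi> N2, \<pi> N1} \<in> d6_edges" "{\<pi> N2, \<pi> N3} \<in> d6_edges"
    "{\<pi> N4, \<pi> N3} \<in> d6_edges" "{\<pi> N4, \<pi> N5} \<in> d6_edges" "{\<pi> N4, \<pi> N6} \<in> d6_edges"
    by (simp_all only: d6_edge_iff) auto
  have neq: "i \<noteq> j \<Longrightarrow> \<pi> i \<noteq> \<pi> j" for i j
    using assms by (auto simp: is_diagram_aut_def dest: bij_is_inj injD)
  have deg2: "\<pi> N2 = N2 \<or> \<pi> N2 = N4"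
    using edge(1-3) neq[of N0 N1] neq[of N0 N3] neq[of N1 N3] by (cases "\<pi> N2") auto
  have deg4: "\<pi> N4 = N2 \<or> \<pi> N4 = N4"
    using edge(4-6) neq[of N3 N5] neq[of N3 N6] neq[of N5 N6] by (cases "\<pi> N4") auto
  have mid: "\<pi> N3 = N3"
    using deg2 deg4 neq[of N2 N4] edge(3,4) by (elim disjE) auto
  have leaves: "(\<pi> N0 = x \<and> \<pi> N1 = y) \<or> (\<pi> N0 = y \<and> \<pi> N1 = x)"
    if "(\<pi> N2, x, y) \<in> {(N2, N0, N1), (N4, N5, N6)}" for x y
    using that edge(1,2) neq[of N0 N1] neq[of N0 N3] neq[of N1 N3] unfolding mid by (elim insertE) auto
  have leaves': "(\<pi> N5 = x \<and> \<pi> N6 = y) \<or> (\<pi> N5 = y \<and> \<pi> N6 = x)"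
    if "(\<pi> N4, x, y) \<in> {(N2, N0, N1), (N4, N5, N6)}" for x y
    using that edge(5,6) neq[of N5 N6] neq[of N5 N3] neq[of N6 N3] unfolding mid by (elim insertE) auto
  have ex: "(\<exists>i < 4. \<exists>j < 2. P i j) \<longleftrightarrow> P 0 0 \<or> P 0 1 \<or> P 1 0 \<or> P 1 1 \<or> P 2 0 \<or> P 2 1 \<or> P 3 0 \<or> P 3 1"
    for P :: "nat \<Rightarrow> nat \<Rightarrow> bool"
    unfolding less_4 less_2 by auto
  consider "\<pi> N2 = N2" "\<pi> N4 = N4" | "\<pi> N2 = N4" "\<pi> N4 = N2"
    using deg2 deg4 neq[of N2 N4] by auto
  then show ?thesis
  proof cases
    case 1
    then show ?thesis using leaves[of N0 N1] leaves'[of N5 N6] mid unfolding ex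
      by (auto simp: node_fun_eq_iff numeral_eq_Suc)
  next
    case 2
    then show ?thesis using leaves[of N5 N6] leaves'[of N0 N1] mid unfolding ex
      by (auto simp: node_fun_eq_iff numeral_eq_Suc)
  qed
qed

lemma diagram_aut_mult:
  assumes "is_diagram_aut f" "is_diagram_aut g"
  shows "f \<otimes>\<^bsub>diagram_aut_group d6_edges\<^esub> g = f \<circ> g"
  using assms by (simp add: diagram_aut_group_def BijGroup_def Bij_def is_diagram_aut_def compose_def
      restrict_UNIV comp_def)

text \<open>
  Evaluation of words is well defined on classes. It is injective because the eight normal forms
  have eight different values, and surjective because these are all diagram automorphisms.
\<close>

lemma dihedral_presentation:
  "\<exists>\<Psi> \<in> iso (presented_group dihedral_D4) (diagram_aut_group d6_edges).
        \<Psi> (word_class dihedral_D4 (gen_word S1)) = sigma1_node \<and>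
        \<Psi> (word_class dihedral_D4 (gen_word S2)) = sigma2_node"
proof -
  define \<Psi> where "\<Psi> A = D4_eval (SOME u. u \<in> A)" for A
  have \<Psi>: "\<Psi> (word_class dihedral_D4 u) = D4_eval u" for u
  proof -
    have "(SOME v. v \<in> word_class dihedral_D4 u) \<in> word_class dihedral_D4 u"
      by (rule someI[of _ u]) (simp add: word_class_def word_eq.refl)
    then show ?thesis using D4_eval_word_eq by (auto simp: \<Psi>_def word_class_def)
  qed
  have carrier: "carrier (presented_group dihedral_D4) = range (word_class dihedral_D4)"
    by (simp add: presented_group_def)
  have "\<Psi> \<in> iso (presented_group dihedral_D4) (diagram_aut_group d6_edges)"
  proof (rule isoI)
    show "\<Psi> \<in> hom (presented_group dihedral_D4) (diagram_aut_group d6_edges)"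
      by (rule homI) (auto simp: carrier \<Psi> carrier_diagram_aut is_diagram_aut_D4_eval
          presented_group_mult D4_eval_append diagram_aut_mult)
    show "bij_betw \<Psi> (carrier (presented_group dihedral_D4)) (carrier (diagram_aut_group d6_edges))"
      unfolding bij_betw_def carrier carrier_diagram_aut
    proof
      show "inj_on \<Psi> (range (word_class dihedral_D4))"
      proof (rule inj_onI, elim rangeE)
        fix A B u v assume eq: "\<Psi> A = \<Psi> B" and A: "A = word_class dihedral_D4 u"
          and B: "B = word_class dihedral_D4 v"
        obtain i j i' j' where nf: "i < 4" "j < 2" "u \<approx> D4_nf i j" "i' < 4" "j' < 2" "v \<approx> D4_nf i' j'"
          using D4_normal_form by meson
        have "sigma1_node ^^ i \<circ> sigma2_node ^^ j = sigma1_node ^^ i' \<circ> sigma2_node ^^ j'"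
          using eq D4_eval_word_eq[OF nf(3)] D4_eval_word_eq[OF nf(6)] by (simp add: A B \<Psi> D4_eval_nf)
        then have "i = i'" "j = j'" using sigma_powers_inject nf by blast+
        then show "A = B" unfolding A B word_class_eq_iff using nf word_eq.sym word_eq.trans by blast
      qed
      show "\<Psi> ` range (word_class dihedral_D4) = {\<pi>. is_diagram_aut \<pi>}"
      proof
        show "\<Psi> ` range (word_class dihedral_D4) \<subseteq> {\<pi>. is_diagram_aut \<pi>}"
          by (auto simp: \<Psi> is_diagram_aut_D4_eval)
        show "{\<pi>. is_diagram_aut \<pi>} \<subseteq> \<Psi> ` range (word_class dihedral_D4)"
        proof
          fix \<pi> assume "\<pi> \<in> {\<pi>. is_diagram_aut \<pi>}"
          then obtain i j where "\<pi> = sigma1_node ^^ i \<circ> sigma2_node ^^ j"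
            using diagram_aut_is_sigma_power by blast
          then have "\<pi> = \<Psi> (word_class dihedral_D4 (D4_nf i j))" by (simp add: \<Psi> D4_eval_nf)
          then show "\<pi> \<in> \<Psi> ` range (word_class dihedral_D4)" by blast
        qed
      qed
    qed
  qed
  then show ?thesis by (rule bexI[rotated]) (simp add: \<Psi>)
qed

section \<open>Groups generated by involutions\<close>

lemma carrier_BijGroup: "carrier (BijGroup UNIV) = {f. bij f}"
  by (auto simp: BijGroup_def Bij_def)

lemma BijGroup_mult: "bij f \<Longrightarrow> bij g \<Longrightarrow> f \<otimes>\<^bsub>BijGroup UNIV\<^esub> g = f \<circ> g"
  by (auto simp: BijGroup_def Bij_def compose_def fun_eq_iff)

lemma BijGroup_one: "\<one>\<^bsub>BijGroup UNIV\<^esub> = id"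
  by (auto simp: BijGroup_def fun_eq_iff)

lemma BijGroup_inv: "bij f \<Longrightarrow> inv\<^bsub>BijGroup UNIV\<^esub> f = inv_into UNIV f"
  by (subst inv_BijGroup) (auto simp: Bij_def fun_eq_iff)

lemma subgroup_generated_BijGroup_mult:
  "bij f \<Longrightarrow> bij g \<Longrightarrow> f \<otimes>\<^bsub>subgroup_generated (BijGroup UNIV) S\<^esub> g = f \<circ> g"
  by (simp add: subgroup_generated_def BijGroup_mult)

text \<open>
  The inverse of an involution is the involution itself, which disposes of the case of inverses.
\<close>

lemma involutions_generate_induct [consumes 1, case_names involution id gen comp]:
  assumes "f \<in> carrier (subgroup_generated (BijGroup UNIV) S)"
    and involutions: "\<And>s. s \<in> S \<Longrightarrow> s \<circ> s = id"
    and "P id" "\<And>s. s \<in> S \<Longrightarrow> P s"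
    and "\<And>f g. f \<in> carrier (subgroup_generated (BijGroup UNIV) S) \<Longrightarrow>
      g \<in> carrier (subgroup_generated (BijGroup UNIV) S) \<Longrightarrow> P f \<Longrightarrow> P g \<Longrightarrow> P (f \<circ> g)"
  shows "P f"
proof -
  have bij: "bij g" if "g \<in> generate (BijGroup UNIV) (carrier (BijGroup UNIV) \<inter> S)" for g
    using group.generate_in_carrier[OF group_BijGroup, of "carrier (BijGroup UNIV) \<inter> S" UNIV g] that
    by (simp add: carrier_BijGroup)
  have "f \<in> generate (BijGroup UNIV) (carrier (BijGroup UNIV) \<inter> S)"
    using assms(1) by (simp add: subgroup_generated_def)
  then show ?thesis
  proof (induction rule: generate.induct)
    case one
    show ?case unfolding BijGroup_one by (rule assms(3))
  next
    case (incl h)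
    then show ?case by (simp add: assms)
  next
    case (inv h)
    then have "bij h" "h \<circ> h = id" by (auto simp: carrier_BijGroup involutions)
    then have "inv_into UNIV h = h" by (intro inv_unique_comp)
    then show ?case using inv \<open>bij h\<close> by (simp add: BijGroup_inv assms)
  next
    case (eng h1 h2)
    show ?case unfolding BijGroup_mult[OF bij[OF eng.hyps(1)] bij[OF eng.hyps(2)]]
      by (rule assms(5)) (use eng in \<open>simp_all add: subgroup_generated_def\<close>)
  qed
qed

lemma subgroup_generated_BijGroup_closed:
  fixes S :: "('a \<Rightarrow> 'a) set"
  defines "G \<equiv> subgroup_generated (BijGroup UNIV) S"
  shows "f \<in> carrier G \<Longrightarrow> bij f" "id \<in> carrier G" "s \<in> S \<Longrightarrow> bij s \<Longrightarrow> s \<in> carrier G"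
    "f \<in> carrier G \<Longrightarrow> g \<in> carrier G \<Longrightarrow> f \<circ> g \<in> carrier G"
    "f \<in> carrier G \<Longrightarrow> inv_into UNIV f \<in> carrier G"
proof -
  interpret G: Group.group G
    unfolding G_def by (rule group.group_subgroup_generated[OF group_BijGroup])
  show bij: "bij f" if "f \<in> carrier G" for f
    using that group.generate_in_carrier[OF group_BijGroup, of "carrier (BijGroup UNIV) \<inter> S" UNIV f]
    by (simp add: G_def subgroup_generated_def carrier_BijGroup)
  show "id \<in> carrier G"
    using G.one_closed by (simp add: G_def subgroup_generated_def BijGroup_one)
  show "s \<in> carrier G" if "s \<in> S" "bij s" for s
    using that by (simp add: G_def subgroup_generated_def carrier_BijGroup generate.incl)
  show "f \<circ> g \<in> carrier G" if "f \<in> carrier G" "g \<in> carrier G" for f g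
    using G.m_closed[OF that] unfolding G_def subgroup_generated_BijGroup_mult[OF bij[OF that(1)]
      bij[OF that(2)]] .
  show "inv_into UNIV f \<in> carrier G" if f: "f \<in> carrier G" for f
  proof -
    have "inv\<^bsub>BijGroup UNIV\<^esub> f \<in> carrier G"
      using group.generate_m_inv_closed[OF group_BijGroup, of "carrier (BijGroup UNIV) \<inter> S" UNIV f] f
      by (simp add: G_def subgroup_generated_def)
    then show ?thesis using BijGroup_inv[OF bij[OF f]] by simp
  qed
qed

section \<open>The affine Weyl group of type \<open>E\<^sub>8\<^sup>(\<^sup>1\<^sup>)\<close>\<close>

lemma nat_le_8: "{0..8 :: nat} = {0, 1, 2, 3, 4, 5, 6, 7, 8}"
  by auto

lemma alpha_root:
  assumes "i \<in> {0..8}" shows "alpha i \<odot> alpha i = - 2" "alpha i \<odot> delta = 0"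
  using assms unfolding nat_le_8
  by (auto simp: alpha_pv intersection_pv delta_pv simp del: One_nat_def)

lemma W_E8_reflection_alpha:
  assumes "i \<in> {0..8}" shows "reflection (alpha i) \<in> carrier W_E8"
  unfolding W_E8_def
  using assms lattice_aut_bij[OF lattice_aut_reflection[OF alpha_root[OF assms]]]
  by (intro subgroup_generated_BijGroup_closed(3)) auto

lemma W_E8_lattice_aut: "w \<in> carrier W_E8 \<Longrightarrow> lattice_aut w"
  unfolding W_E8_def
proof (induction rule: involutions_generate_induct)
  case (involution s)
  then obtain i where i: "i \<in> {0..8}" "s = reflection (alpha i)" by blast
  show ?case unfolding i(2) by (rule ext) (simp add: reflection_involution alpha_root(1)[OF i(1)])
next
  case (gen s)
  then obtain i where i: "i \<in> {0..8}" "s = reflection (alpha i)" by blast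
  show ?case unfolding i(2) by (rule lattice_aut_reflection[OF alpha_root[OF i(1)]])
next
  case id
  show ?case by (rule lattice_aut_id)
next
  case (comp f g)
  then show ?case by (intro lattice_aut_comp)
qed

lemma W_E8_closed:
  "id \<in> carrier W_E8" "f \<in> carrier W_E8 \<Longrightarrow> g \<in> carrier W_E8 \<Longrightarrow> f \<circ> g \<in> carrier W_E8"
  "f \<in> carrier W_E8 \<Longrightarrow> inv_into UNIV f \<in> carrier W_E8"
  unfolding W_E8_def
  by (fact subgroup_generated_BijGroup_closed)+

lemma W_E8_bij: "f \<in> carrier W_E8 \<Longrightarrow> bij f"
  by (rule lattice_aut_bij[OF W_E8_lattice_aut])

lemma W_E8_mult: "f \<in> carrier W_E8 \<Longrightarrow> g \<in> carrier W_E8 \<Longrightarrow> f \<otimes>\<^bsub>W_E8\<^esub> g = f \<circ> g"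
  using subgroup_generated_BijGroup_mult[OF W_E8_bij W_E8_bij] unfolding W_E8_def .

lemma W_E8_reflection_conj:
  assumes "w \<in> carrier W_E8" "reflection r \<in> carrier W_E8"
  shows "reflection (w r) \<in> carrier W_E8"
  unfolding conj_reflection[OF W_E8_lattice_aut[OF assms(1)], of r, symmetric]
  by (intro W_E8_closed assms)

text \<open>
  Each of these roots is reached from simple roots by successive reflections, and the conjugate
  of a reflection in the group is again in the group.
\<close>

lemma W_E8_reflections:
  "reflection (beta i) \<in> carrier W_E8"
  "reflection (cls E1 - cls E3) \<in> carrier W_E8" "reflection (cls E3 - cls E5) \<in> carrier W_E8"
  "reflection (cls E5 - cls E7) \<in> carrier W_E8" "reflection (cls E2 - cls E4) \<in> carrier W_E8"
  "reflection (cls E4 - cls E6) \<in> carrier W_E8" "reflection (cls E6 - cls E8) \<in> carrier W_E8"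
  "reflection (cls E1 - cls E5) \<in> carrier W_E8" "reflection (cls E2 - cls E6) \<in> carrier W_E8"
proof -
  have step: "reflection t \<in> carrier W_E8"
    if "reflection r \<in> carrier W_E8" "reflection s \<in> carrier W_E8" "reflection r s = t" for r s t
    using W_E8_reflection_conj[OF that(1,2)] that(3) by simp
  have alphas: "reflection (alpha 0) \<in> carrier W_E8" "reflection (alpha 1) \<in> carrier W_E8"
    "reflection (alpha 2) \<in> carrier W_E8" "reflection (alpha 3) \<in> carrier W_E8"
    "reflection (alpha 4) \<in> carrier W_E8" "reflection (alpha 5) \<in> carrier W_E8"
    "reflection (alpha 6) \<in> carrier W_E8" "reflection (alpha 7) \<in> carrier W_E8"
    "reflection (alpha 8) \<in> carrier W_E8"
    by (rule W_E8_reflection_alpha, simp)+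
  note compute = reflection_def alpha_pv beta_pv cls_pv pv_arith intersection_pv pv_eq_iff
  show r13: "reflection (cls E1 - cls E3) \<in> carrier W_E8"
    by (rule step[OF alphas(1) alphas(4)]) (simp add: compute)
  show r24: "reflection (cls E2 - cls E4) \<in> carrier W_E8"
    by (rule step[OF alphas(4) alphas(5)]) (simp add: compute)
  show r35: "reflection (cls E3 - cls E5) \<in> carrier W_E8"
    by (rule step[OF alphas(5) alphas(6)]) (simp add: compute)
  show r46: "reflection (cls E4 - cls E6) \<in> carrier W_E8"
    by (rule step[OF alphas(6) alphas(7)]) (simp add: compute)
  show r57: "reflection (cls E5 - cls E7) \<in> carrier W_E8"
    by (rule step[OF alphas(7) alphas(8)]) (simp add: compute)
  show "reflection (cls E6 - cls E8) \<in> carrier W_E8"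
    by (rule step[OF alphas(8) alphas(9)]) (simp add: compute)
  show "reflection (cls E1 - cls E5) \<in> carrier W_E8"
    by (rule step[OF r13 r35]) (simp add: compute)
  show "reflection (cls E2 - cls E6) \<in> carrier W_E8"
    by (rule step[OF r24 r46]) (simp add: compute)
  have r25: "reflection (cls E2 - cls E5) \<in> carrier W_E8"
    by (rule step[OF alphas(4) r35]) (simp add: compute)
  have r27: "reflection (cls E2 - cls E7) \<in> carrier W_E8"
    by (rule step[OF r25 r57]) (simp add: compute)
  have "reflection (cls HY - cls E2 - cls E3) \<in> carrier W_E8"
    by (rule step[OF r13 alphas(3)]) (simp add: compute)
  from step[OF r27 this] have b4: "reflection (beta N4) \<in> carrier W_E8"
    by (simp add: compute)
  have b2: "reflection (beta N2) \<in> carrier W_E8"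
    by (rule step[OF r25 alphas(3)]) (simp add: compute)
  have "beta N0 = alpha 0" "beta N1 = alpha 6" "beta N3 = alpha 1" "beta N5 = alpha 4"
    "beta N6 = alpha 8"
    by (simp_all only: alpha_pv beta_pv)
  then show "reflection (beta i) \<in> carrier W_E8"
    using alphas b2 b4 by (cases i) (simp_all only:)
qed

lemma sigma_as_reflections:
  "sigma1 = reflection (cls E1 - cls E3) \<circ> reflection (cls E3 - cls E5) \<circ> reflection (cls E5 - cls E7) \<circ>
     reflection (cls E2 - cls E4) \<circ> reflection (cls E4 - cls E6) \<circ> reflection (cls E6 - cls E8)"
  "sigma2 = reflection (cls E1 - cls E5) \<circ> reflection (cls E2 - cls E6)"
proof -
  note compute = reflection_def cls_pv pv_arith intersection_pv pv_eq_iff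
  show "sigma1 = reflection (cls E1 - cls E3) \<circ> reflection (cls E3 - cls E5)
    \<circ> reflection (cls E5 - cls E7) \<circ>
     reflection (cls E2 - cls E4) \<circ> reflection (cls E4 - cls E6) \<circ> reflection (cls E6 - cls E8)"
    by (rule pic_fun_eqI) (simp add: compute)
  show "sigma2 = reflection (cls E1 - cls E5) \<circ> reflection (cls E2 - cls E6)"
    by (rule pic_fun_eqI) (simp add: compute)
qed

lemma W_E8_sigma: "sigma1 \<in> carrier W_E8" "sigma2 \<in> carrier W_E8"
  unfolding sigma_as_reflections by (intro W_E8_closed(2) W_E8_reflections)+

section \<open>The stabilizer of the condition\<close>

definition star_stabilizer :: "(pic \<Rightarrow> pic) set" where
  "star_stabilizer = {w \<in> carrier W_E8. w star1 \<in> star_set \<and> w star2 \<in> star_set}"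

lemma star_set_image:
  assumes "lattice_aut w" "w star1 \<in> star_set" "w star2 \<in> star_set"
  shows "w ` star_set = star_set"
proof (rule endo_inj_surj)
  have neg: "- D \<in> star_set" if "D \<in> star_set" for D
    using that unfolding star_set_def by (elim insertE) simp_all
  have image: "w ` star_set = {w star1, - w star1, w star2, - w star2}"
    by (simp add: star_set_def lattice_aut_linear[OF assms(1)])
  show "w ` star_set \<subseteq> star_set"
    unfolding image using neg[OF assms(2)] neg[OF assms(3)] assms(2,3) by simp
  show "inj_on w star_set"
    by (rule inj_on_subset[OF bij_is_inj[OF lattice_aut_bij[OF assms(1)]]]) simp
qed (simp add: star_set_def)

lemma star_set_inv:
  assumes "lattice_aut w" "w star1 \<in> star_set" "w star2 \<in> star_set"
  shows "inv_into UNIV w star1 \<in> star_set" "inv_into UNIV w star2 \<in> star_set"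
proof -
  have "inv_into UNIV w D \<in> star_set" if "D \<in> star_set" for D
  proof -
    have "D \<in> w ` star_set" using star_set_image[OF assms] that by simp
    then obtain C where "C \<in> star_set" "D = w C" by (elim imageE)
    then show ?thesis using bij_is_inj[OF lattice_aut_bij[OF assms(1)]] by simp
  qed
  then show "inv_into UNIV w star1 \<in> star_set" "inv_into UNIV w star2 \<in> star_set"
    by (simp_all add: star_set_def)
qed

text \<open>
  The pull-back action is the inverse of the push-forward action, but on the finite set
  \<open>star_set\<close> an injective map and its inverse preserve the set simultaneously.
\<close>

lemma preserving_star_eq: "preserving_star \<tau> = star_stabilizer"
proof -
  have "inv_into UNIV w star1 \<in> star_set \<and> inv_into UNIV w star2 \<in> star_set \<longleftrightarrow> w star1 \<in> star_set
    \<and> w star2 \<in> star_set"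
    if w: "lattice_aut w" for w
    using star_set_inv[OF w] star_set_inv[OF lattice_aut_inv[OF w]]
    unfolding inv_inv_eq[OF lattice_aut_bij[OF w]] by fast
  then show ?thesis
    unfolding preserving_star_def star_stabilizer_def
    by (intro Collect_cong conj_cong) (simp_all add: preserves_star_iff W_E8_lattice_aut)
qed

lemma star_stabilizer_lattice_aut: "w \<in> star_stabilizer \<Longrightarrow> lattice_aut w"
  by (simp add: star_stabilizer_def W_E8_lattice_aut)

lemma star_stabilizer_closed:
  "id \<in> star_stabilizer" "f \<in> star_stabilizer \<Longrightarrow> g \<in> star_stabilizer \<Longrightarrow> f \<circ> g \<in> star_stabilizer"
    "f \<in> star_stabilizer \<Longrightarrow> inv_into UNIV f \<in> star_stabilizer"
proof -
  show "id \<in> star_stabilizer" by (simp add: star_stabilizer_def star_set_def W_E8_closed)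
  show "f \<circ> g \<in> star_stabilizer" if f: "f \<in> star_stabilizer" and g: "g \<in> star_stabilizer"
  proof -
    have "f ` star_set = star_set" using f
      by (intro star_set_image) (simp_all add: star_stabilizer_def W_E8_lattice_aut)
    then have "f D \<in> star_set" if "D \<in> star_set" for D using that by blast
    then show ?thesis using f g W_E8_closed(2) by (simp add: star_stabilizer_def)
  qed
  show "inv_into UNIV f \<in> star_stabilizer" if f: "f \<in> star_stabilizer"
    using f star_set_inv[OF star_stabilizer_lattice_aut[OF f]]
      by (simp add: star_stabilizer_def W_E8_closed)
qed

lemma group_W_E8: "Group.group W_E8"
  unfolding W_E8_def by (rule group.group_subgroup_generated[OF group_BijGroup])

lemma W_E8_inv: assumes "f \<in> carrier W_E8" shows "inv\<^bsub>W_E8\<^esub> f = inv_into UNIV f"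
proof -
  have "bij f" using W_E8_lattice_aut[OF assms] lattice_aut_bij by blast
  then have "inv_into UNIV f \<circ> f = id" by (simp add: bij_is_inj)
  moreover have "\<one>\<^bsub>W_E8\<^esub> = id" by (simp add: W_E8_def subgroup_generated_def BijGroup_one)
  ultimately show ?thesis
    using group.inv_equality[OF group_W_E8, of "inv_into UNIV f" f] assms W_E8_closed(3)[OF assms]
    by (simp add: W_E8_mult)
qed

lemma star_stabilizer_subgroup: "subgroup star_stabilizer W_E8"
proof
  show "star_stabilizer \<subseteq> carrier W_E8" by (auto simp: star_stabilizer_def)
  show "f \<otimes>\<^bsub>W_E8\<^esub> g \<in> star_stabilizer" if "f \<in> star_stabilizer" "g \<in> star_stabilizer" for f g
    using that star_stabilizer_closed(2)[OF that] by (simp add: W_E8_mult star_stabilizer_def)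
  show "\<one>\<^bsub>W_E8\<^esub> \<in> star_stabilizer"
    using star_stabilizer_closed(1) by (simp add: W_E8_def subgroup_generated_def BijGroup_one)
  show "inv\<^bsub>W_E8\<^esub> f \<in> star_stabilizer" if "f \<in> star_stabilizer" for f
    using that star_stabilizer_closed(3)[OF that] by (simp add: W_E8_inv star_stabilizer_def)
qed

section \<open>The extended Weyl group as the stabilizer\<close>

lemma root_embed_simple_reflection:
  "root_embed (simple_reflection d6_edges i c) = reflection (beta i) (root_embed c)"
proof -
  have "beta i \<odot> root_embed c = (\<Sum>j\<in>UNIV. c $ j * (beta i \<odot> beta j))"
    by (simp add: root_embed_def UNIV_d6_node intersection_linear)
  then have "beta i \<odot> root_embed c = - (\<Sum>j\<in>UNIV. cartan d6_edges i j * c $ j)"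
    by (simp add: beta_intersection sum_negf mult.commute)
  moreover have "(- k) *s v = - (k *s v)" for k and v :: pic by (simp add: vec_eq_iff)
  ultimately show ?thesis
    by (simp add: simple_reflection_def root_embed_linear root_embed_axis reflection_def)
qed

lemma reflection_beta_square: "reflection (beta i) (reflection (beta i) D) = D"
  using beta_intersection[of i i] by (intro reflection_involution) (simp add: cartan_def)

lemma simple_reflection_involution:
  "simple_reflection d6_edges i \<circ> simple_reflection d6_edges i = id"
  by (simp add: fun_eq_iff root_embed_simple_reflection reflection_beta_square flip: root_embed_inject)

lemma weyl_group_closed:
  "w \<in> carrier (weyl_group d6_edges) \<Longrightarrow> bij w" "id \<in> carrier (weyl_group d6_edges)"
  "simple_reflection d6_edges i \<in> carrier (weyl_group d6_edges)"
  "v \<in> carrier (weyl_group d6_edges) \<Longrightarrow> w \<in> carrier (weyl_group d6_edges) \<Longrightarrow>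
     v \<circ> w \<in> carrier (weyl_group d6_edges)"
  "w \<in> carrier (weyl_group d6_edges) \<Longrightarrow> inv_into UNIV w \<in> carrier (weyl_group d6_edges)"
proof -
  have "bij (simple_reflection d6_edges i)"
    by (rule o_bij[OF simple_reflection_involution simple_reflection_involution])
  then show "simple_reflection d6_edges i \<in> carrier (weyl_group d6_edges)"
    unfolding weyl_group_def by (intro subgroup_generated_BijGroup_closed(3)) auto
qed (unfold weyl_group_def, (fact subgroup_generated_BijGroup_closed)+)

lemma reflection_beta_star: "reflection (beta i) star1 = star1" "reflection (beta i) star2 = star2"
  by (cases i; simp add: reflection_beta_pv star_pv)+

text \<open>
  The extension is by the same word in the reflections of the Picard lattice. That it fixes
  \<open>star1\<close> and \<open>star2\<close>, to which all the \<open>\<beta>\<^sub>i\<close> are orthogonal, is used later to separate it from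
  the diagram automorphisms.
\<close>

lemma weyl_element_extends:
  assumes "n \<in> carrier (weyl_group d6_edges)"
  shows "\<exists>w \<in> carrier W_E8. w \<circ> root_embed = root_embed \<circ> n \<and> w star1 = star1 \<and> w star2 = star2"
  using assms unfolding weyl_group_def
proof (induction rule: involutions_generate_induct)
  case (involution s)
  then show ?case using simple_reflection_involution by auto
next
  case id
  show ?case using W_E8_closed(1) by (intro bexI[of _ id]) auto
next
  case (gen s)
  then obtain i where "s = simple_reflection d6_edges i" by blast
  then show ?case
    by (intro bexI[of _ "reflection (beta i)"])
      (auto simp: root_embed_simple_reflection reflection_beta_star W_E8_reflections)
next
  case (comp f g)
  then obtain v w where v: "v \<in> carrier W_E8" "v \<circ> root_embed = root_embed \<circ> f" "v star1 = star1"
    "v star2 = star2"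
    and w: "w \<in> carrier W_E8" "w \<circ> root_embed = root_embed \<circ> g" "w star1 = star1"
      "w star2 = star2" by blast
  have "v \<circ> w \<circ> root_embed = root_embed \<circ> (f \<circ> g)"
    using fun_cong[OF v(2)] fun_cong[OF w(2)] by (simp add: fun_eq_iff)
  moreover have "(v \<circ> w) star1 = star1" "(v \<circ> w) star2 = star2" using v(3,4) w(3,4) by simp_all
  ultimately show ?case
    using W_E8_closed(2)[OF v(1) w(1)] by blast
qed

lemma refl_word_restricts:
  "refl_word is \<in> carrier W_E8 \<and> refl_word is star1 = star1 \<and> refl_word is star2 = star2 \<and>
   (\<exists>n \<in> carrier (weyl_group d6_edges). refl_word is \<circ> root_embed = root_embed \<circ> n)"
proof (induction "is")
  case Nil
  show ?case unfolding refl_word_simps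
    by (intro conjI bexI[of _ id] W_E8_closed weyl_group_closed) simp_all
next
  case (Cons i "is")
  then obtain n where n: "n \<in> carrier (weyl_group d6_edges)"
    "refl_word is \<circ> root_embed = root_embed \<circ> n" by blast
  then have "refl_word (i # is) \<circ> root_embed = root_embed \<circ> (simple_reflection d6_edges i \<circ> n)"
    by (simp add: fun_eq_iff root_embed_simple_reflection)
  then have "\<exists>n \<in> carrier (weyl_group d6_edges). refl_word (i # is) \<circ> root_embed = root_embed \<circ> n"
    using weyl_group_closed(4)[OF weyl_group_closed(3) n(1)] by blast
  moreover have "refl_word (i # is) \<in> carrier W_E8"
    unfolding refl_word_simps using Cons W_E8_closed(2)[OF W_E8_reflections(1)] by blast
  moreover have "refl_word (i # is) star1 = star1" "refl_word (i # is) star2 = star2"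
    using Cons by (simp_all add: reflection_beta_star)
  ultimately show ?case by blast
qed

lemma permute_basis_comp:
  assumes "bij f" "bij g" shows "permute_basis (f \<circ> g) = permute_basis f \<circ> permute_basis g"
  using assms by (simp add: permute_basis_def fun_eq_iff o_inv_distrib)

lemma permute_basis_id: "permute_basis id = id"
  by (simp add: permute_basis_def fun_eq_iff)

lemma root_embed_permute_basis:
  assumes "bij \<pi>" shows "root_embed (permute_basis \<pi> c) = (\<Sum>i\<in>UNIV. c $ i *s beta (\<pi> i))"
proof -
  have "root_embed (permute_basis \<pi> c) = (\<Sum>i\<in>UNIV. permute_basis \<pi> c $ (\<pi> i) *s beta (\<pi> i))"
    unfolding root_embed_def by (rule sum.reindex_bij_betw[symmetric]) (use assms in simp)
  then show ?thesis using assms by (simp add: permute_basis_def bij_is_inj)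
qed

lemma intertwines_permute_basis_iff:
  assumes "lattice_aut w" "bij \<pi>"
  shows "w \<circ> root_embed = root_embed \<circ> permute_basis \<pi> \<longleftrightarrow> (\<forall>i. w (beta i) = beta (\<pi> i))"
proof
  assume *: "w \<circ> root_embed = root_embed \<circ> permute_basis \<pi>"
  show "\<forall>i. w (beta i) = beta (\<pi> i)"
  proof
    fix i
    have "w (beta i) = w (root_embed (axis i 1))" by (simp add: root_embed_axis)
    also have "\<dots> = root_embed (permute_basis \<pi> (axis i 1))" using fun_cong[OF *] by simp
    also have "\<dots> = (\<Sum>j\<in>UNIV. if j = i then beta (\<pi> j) else 0)"
      unfolding root_embed_permute_basis[OF assms(2)]
        by (rule sum.cong) (auto simp: axis_def vec_eq_iff)
    also have "\<dots> = beta (\<pi> i)" by simp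
    finally show "w (beta i) = beta (\<pi> i)" .
  qed
next
  assume "\<forall>i. w (beta i) = beta (\<pi> i)"
  then show "w \<circ> root_embed = root_embed \<circ> permute_basis \<pi>"
    by (simp add: fun_eq_iff lattice_aut_root_embed[OF assms(1)] root_embed_permute_basis[OF assms(2)])
qed

lemma sigma_star: "sigma1 star1 = star2" "sigma1 star2 = - star1" "sigma2 star1 = - star1"
  "sigma2 star2 = star2"
  by (simp_all add: star_pv pv_arith)

lemma sigma_in_star_stabilizer: "sigma1 \<in> star_stabilizer" "sigma2 \<in> star_stabilizer"
  by (simp_all add: star_stabilizer_def W_E8_sigma sigma_star star_set_def)

lemma star_stabilizer_funpow: "f \<in> star_stabilizer \<Longrightarrow> f ^^ k \<in> star_stabilizer"
  by (induction k) (simp_all add: star_stabilizer_closed[unfolded id_def] star_stabilizer_closed)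

lemma sigma_power_beta:
  "(sigma1 ^^ i \<circ> sigma2 ^^ j) (beta k) = beta ((sigma1_node ^^ i \<circ> sigma2_node ^^ j) k)"
proof -
  have "(sigma2 ^^ j) (beta k) = beta ((sigma2_node ^^ j) k)" for k
    by (induction j) (simp_all add: explicit_root_identities(8,9)[rule_format])
  moreover have "(sigma1 ^^ i) (beta k) = beta ((sigma1_node ^^ i) k)" for k
    by (induction i) (simp_all add: explicit_root_identities(8,9)[rule_format])
  ultimately show ?thesis by simp
qed

lemma sigma_power_fixes_star:
  assumes "i < 4" "j < 2" "(sigma1 ^^ i \<circ> sigma2 ^^ j) star1 = star1"
    "(sigma1 ^^ i \<circ> sigma2 ^^ j) star2 = star2"
  shows "i = 0 \<and> j = 0"
  using assms unfolding less_4 less_2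
  by (auto simp: numeral_eq_Suc star_pv pv_eq_iff pv_arith)

text \<open>
  The quotient of two elements with the same restriction to the root lattice fixes all the
  \<open>\<beta>\<^sub>i\<close>.
\<close>

lemma star_stabilizer_eqI:
  assumes v: "v \<in> star_stabilizer" and w: "w \<in> star_stabilizer"
    and eq: "v \<circ> root_embed = w \<circ> root_embed"
  shows "v = w"
proof -
  note av = star_stabilizer_lattice_aut[OF v] and aw = star_stabilizer_lattice_aut[OF w]
  let ?u = "inv_into UNIV w \<circ> v"
  have u: "?u \<in> star_stabilizer" using v w by (intro star_stabilizer_closed)
  have "?u = id"
  proof (rule fixes_beta_imp_id)
    show "lattice_aut ?u" by (rule star_stabilizer_lattice_aut[OF u])
    show "?u (beta i) = beta i" for i
      using fun_cong[OF eq, of "axis i 1"] lattice_aut_bij[OF aw]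
        by (simp add: root_embed_axis bij_is_inj)
    show "?u star1 \<in> star_set" "?u star2 \<in> star_set" using u by (simp_all add: star_stabilizer_def)
  qed
  then have "w (inv_into UNIV w (v D)) = w D" for D by (metis comp_apply id_apply)
  then show ?thesis using lattice_aut_bij[OF aw] by (auto simp: fun_eq_iff bij_is_surj surj_f_inv_f)
qed

text \<open>
  After composition with reflections in the \<open>\<beta>\<^sub>i\<close>, the image of \<open>rho_class\<close> is dominant, so the
  composed map permutes the simple roots.
\<close>

lemma star_stabilizer_decomposition:
  assumes w: "w \<in> star_stabilizer"
  shows "\<exists>n \<in> carrier (weyl_group d6_edges). \<exists>\<pi>. is_diagram_aut \<pi> \<and>
     w \<circ> root_embed = root_embed \<circ> (n \<circ> permute_basis \<pi>)"
proof -
  note aw = star_stabilizer_lattice_aut[OF w]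
  have "w rho_class \<odot> delta = rho_class \<odot> delta" "w rho_class \<odot> w rho_class = rho_class \<odot> rho_class"
    using lattice_aut_intersection[OF aw] lattice_aut_delta[OF aw] by metis+
  from dominant_in_orbit[OF this] obtain "is" where dom: "\<And>i. refl_word is (w rho_class) \<odot> beta i \<ge> 0"
    by blast
  obtain n where n: "n \<in> carrier (weyl_group d6_edges)" "refl_word is \<circ> root_embed = root_embed \<circ> n"
    using refl_word_restricts by blast
  have u: "refl_word is \<in> star_stabilizer" using refl_word_restricts[of "is"]
    by (simp add: star_stabilizer_def star_set_def)
  have g: "refl_word is \<circ> w \<in> star_stabilizer" using u w by (rule star_stabilizer_closed)
  note ag = star_stabilizer_lattice_aut[OF g]
  have star_set: "(refl_word is \<circ> w) star1 \<in> star_set" "(refl_word is \<circ> w) star2 \<in> star_set"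
    using g by (simp_all add: star_stabilizer_def)
  obtain \<pi> where \<pi>: "bij \<pi>" "\<forall>i. (refl_word is \<circ> w) (beta i) = beta (\<pi> i)"
    "\<forall>i j. {\<pi> i, \<pi> j} \<in> d6_edges \<longleftrightarrow> {i, j} \<in> d6_edges"
    using preserves_simple_roots[OF ag star_set star_set_inv[OF ag star_set]] dom by auto
  have "refl_word is \<circ> w \<circ> root_embed = root_embed \<circ> permute_basis \<pi>"
    using intertwines_permute_basis_iff[OF ag \<pi>(1)] \<pi>(2) by blast
  then have *: "refl_word is (w (root_embed c)) = root_embed (permute_basis \<pi> c)" for c
    by (simp add: fun_eq_iff)
  let ?m = "inv_into UNIV n"
  have nm: "n (?m c) = c" for c using weyl_group_closed(1)[OF n(1)]
    by (simp add: bij_is_surj surj_f_inv_f)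
  have "refl_word is (w (root_embed c)) = refl_word is (root_embed (?m (permute_basis \<pi> c)))" for c
    using fun_cong[OF n(2), of "?m (permute_basis \<pi> c)"] by (simp add: * nm)
  then have "w (root_embed c) = root_embed (?m (permute_basis \<pi> c))" for c
    using lattice_aut_bij[OF star_stabilizer_lattice_aut[OF u]] by (auto dest: bij_is_inj injD)
  then have "w \<circ> root_embed = root_embed \<circ> (?m \<circ> permute_basis \<pi>)" by (simp add: fun_eq_iff)
  moreover have "is_diagram_aut \<pi>" unfolding is_diagram_aut_def using \<pi> by blast
  ultimately show ?thesis using weyl_group_closed(5)[OF n(1)] by blast
qed

lemma extended_element_extends:
  assumes "n \<in> carrier (weyl_group d6_edges)" "is_diagram_aut \<pi>"
  shows "\<exists>w \<in> star_stabilizer. w \<circ> root_embed = root_embed \<circ> (n \<circ> permute_basis \<pi>)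
    \<and> (w star1 = star1 \<and> w star2 = star2 \<longrightarrow> \<pi> = id)"
proof -
  obtain v where v: "v \<in> carrier W_E8" "v \<circ> root_embed = root_embed \<circ> n" "v star1 = star1"
    "v star2 = star2"
    using weyl_element_extends[OF assms(1)] by blast
  obtain i j where ij: "i < 4" "j < 2" "\<pi> = sigma1_node ^^ i \<circ> sigma2_node ^^ j"
    using diagram_aut_is_sigma_power[OF assms(2)] by blast
  define s where "s = sigma1 ^^ i \<circ> sigma2 ^^ j"
  have s: "s \<in> star_stabilizer" unfolding s_def
    by (intro star_stabilizer_closed star_stabilizer_funpow sigma_in_star_stabilizer)
  have "bij \<pi>" using assms(2) by (simp add: is_diagram_aut_def)
  then have sb: "s \<circ> root_embed = root_embed \<circ> permute_basis \<pi>"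
    using intertwines_permute_basis_iff[OF star_stabilizer_lattice_aut[OF s]] sigma_power_beta
    by (simp add: s_def ij)
  have "v \<in> star_stabilizer" using v by (simp add: star_stabilizer_def star_set_def)
  then have "v \<circ> s \<in> star_stabilizer" using s by (rule star_stabilizer_closed)
  moreover have "v \<circ> s \<circ> root_embed = root_embed \<circ> (n \<circ> permute_basis \<pi>)"
    using fun_cong[OF sb] fun_cong[OF v(2)] by (simp add: fun_eq_iff)
  moreover have "\<pi> = id" if "(v \<circ> s) star1 = star1" "(v \<circ> s) star2 = star2"
  proof -
    have "v (s star1) = v star1" "v (s star2) = v star2" using that v by simp_all
    then have "s star1 = star1" "s star2 = star2"
      using lattice_aut_bij[OF W_E8_lattice_aut[OF v(1)]] by (auto dest: bij_is_inj injD)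
    then have "i = 0 \<and> j = 0" using sigma_power_fixes_star ij(1,2) by (simp add: s_def)
    then show ?thesis using ij by simp
  qed
  ultimately show ?thesis by blast
qed

text \<open>
  The description is unique by \<open>star_stabilizer_eqI\<close>; an extension exists for the maps of the
  form \<open>n \<circ> permute_basis \<pi>\<close> with \<open>n\<close> in the Weyl group and \<open>\<pi>\<close> a diagram automorphism.
\<close>

definition lattice_lift :: "(int ^ d6_node \<Rightarrow> int ^ d6_node) \<Rightarrow> pic \<Rightarrow> pic" where
  "lattice_lift f = (THE w. w \<in> star_stabilizer \<and> w \<circ> root_embed = root_embed \<circ> f)"

lemma lattice_lift_eq:
  assumes "w \<in> star_stabilizer" "w \<circ> root_embed = root_embed \<circ> f" shows "lattice_lift f = w"
  unfolding lattice_lift_def using assms star_stabilizer_eqI by (intro the_equality) auto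

lemma permute_basis_inv:
  assumes "bij \<pi>"
  shows "permute_basis (inv_into UNIV \<pi>) \<circ> permute_basis \<pi> = id"
    "permute_basis \<pi> \<circ> permute_basis (inv_into UNIV \<pi>) = id"
proof -
  have "inv_into UNIV \<pi> \<circ> \<pi> = id" by (rule inv_o_cancel[OF bij_is_inj[OF assms]])
  moreover have "\<pi> \<circ> inv_into UNIV \<pi> = id"
    using bij_is_surj[OF assms] unfolding surj_iff .
  ultimately show "permute_basis (inv_into UNIV \<pi>) \<circ> permute_basis \<pi> = id"
    "permute_basis \<pi> \<circ> permute_basis (inv_into UNIV \<pi>) = id"
    by (simp_all only: permute_basis_comp[symmetric] assms bij_imp_bij_inv permute_basis_id)
qed

lemma bij_permute_basis: "bij \<pi> \<Longrightarrow> bij (permute_basis \<pi>)"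
  by (rule o_bij[OF permute_basis_inv])

definition extended_lift :: "(d6_node \<Rightarrow> d6_node) \<times> (int ^ d6_node \<Rightarrow> int ^ d6_node) \<Rightarrow> pic \<Rightarrow> pic" where
  "extended_lift = (\<lambda>(\<pi>, n). lattice_lift (n \<circ> permute_basis \<pi>))"

lemma extended_lift_generators:
  "extended_lift (id, simple_reflection d6_edges i) = reflection (beta i)"
  "extended_lift (sigma1_node, id) = sigma1"
  "extended_lift (sigma2_node, id) = sigma2"
proof -
  have "reflection (beta i) \<in> star_stabilizer"
    by (simp add: star_stabilizer_def W_E8_reflections reflection_beta_star star_set_def)
  moreover have "reflection (beta i) \<circ> root_embed = root_embed \<circ> (simple_reflection d6_edges i
    \<circ> permute_basis id)"
    unfolding permute_basis_id by (simp add: fun_eq_iff root_embed_simple_reflection)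
  ultimately show "extended_lift (id, simple_reflection d6_edges i) = reflection (beta i)"
    unfolding extended_lift_def prod.case by (rule lattice_lift_eq)
  have sigma: "extended_lift (\<pi>, id) = s"
    if "s \<in> star_stabilizer" "bij \<pi>" "\<forall>i. s (beta i) = beta (\<pi> i)" for \<pi> s
    unfolding extended_lift_def prod.case id_comp
    using intertwines_permute_basis_iff[OF star_stabilizer_lattice_aut[OF that(1)] that(2)] that
    by (intro lattice_lift_eq) simp_all
  have "bij sigma1_node" "bij sigma2_node"
    using is_diagram_aut_sigma by (simp_all add: is_diagram_aut_def)
  then show "extended_lift (sigma1_node, id) = sigma1" "extended_lift (sigma2_node, id) = sigma2"
    using sigma sigma_in_star_stabilizer explicit_root_identities(8,9) by simp_all
qed

text \<open>
  The composition of two extensions extends the composition of the restricted maps, so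
  uniqueness gives multiplicativity. For injectivity, two pairs with the same image combine to a
  pair with image the identity; it fixes \<open>star1\<close> and \<open>star2\<close>, and therefore its diagram
  automorphism is trivial.
\<close>

lemma extended_lift_iso:
  "extended_lift \<in> iso (extended_weyl_group d6_edges) (W_E8\<lparr>carrier := star_stabilizer\<rparr>)"
proof -
  define \<Phi> where "\<Phi> = extended_lift"
  note \<Phi>_def = \<Phi>_def extended_lift_def
  have carrier: "(\<pi>, n) \<in> carrier (extended_weyl_group d6_edges) \<longleftrightarrow>
      is_diagram_aut \<pi> \<and> n \<in> carrier (weyl_group d6_edges)" for \<pi> n
    by (simp add: extended_weyl_group_def semidirect_product_def carrier_diagram_aut)
  have \<Phi>: "\<Phi> (\<pi>, n) \<in> star_stabilizer" "\<Phi> (\<pi>, n) \<circ> root_embed = root_embed \<circ> (n \<circ> permute_basis \<pi>)"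
    "\<Phi> (\<pi>, n) star1 = star1 \<Longrightarrow> \<Phi> (\<pi>, n) star2 = star2 \<Longrightarrow> \<pi> = id"
    if \<pi>n: "(\<pi>, n) \<in> carrier (extended_weyl_group d6_edges)" for \<pi> n
  proof -
    obtain w where w: "w \<in> star_stabilizer" "w \<circ> root_embed = root_embed \<circ> (n \<circ> permute_basis \<pi>)"
      "w star1 = star1 \<and> w star2 = star2 \<longrightarrow> \<pi> = id"
      using extended_element_extends[of n \<pi>] \<pi>n[unfolded carrier] by blast
    then have "\<Phi> (\<pi>, n) = w" by (simp add: \<Phi>_def lattice_lift_eq)
    then show "\<Phi> (\<pi>, n) \<in> star_stabilizer" "\<Phi> (\<pi>, n) \<circ> root_embed = root_embed \<circ> (n \<circ> permute_basis \<pi>)"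
      "\<Phi> (\<pi>, n) star1 = star1 \<Longrightarrow> \<Phi> (\<pi>, n) star2 = star2 \<Longrightarrow> \<pi> = id" using w by auto
  qed
  have mult: "\<Phi> ((\<pi>, n) \<otimes>\<^bsub>extended_weyl_group d6_edges\<^esub> (\<rho>, m)) = \<Phi> (\<pi>, n) \<circ> \<Phi> (\<rho>, m)"
    if \<pi>n: "(\<pi>, n) \<in> carrier (extended_weyl_group d6_edges)"
      and \<rho>m: "(\<rho>, m) \<in> carrier (extended_weyl_group d6_edges)" for \<pi> n \<rho> m
  proof -
    have \<pi>: "is_diagram_aut \<pi>" "bij \<pi>" and \<rho>: "is_diagram_aut \<rho>" "bij \<rho>" and "bij n" "bij m"
      using \<pi>n \<rho>m unfolding carrier by (auto simp: is_diagram_aut_def weyl_group_closed(1))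
    define \<theta> where "\<theta> = permute_basis \<pi> \<circ> m \<circ> permute_basis (inv_into UNIV \<pi>)"
    have "bij \<theta>" unfolding \<theta>_def
      using \<pi>(2) \<open>bij m\<close> by (intro bij_comp bij_permute_basis bij_imp_bij_inv)
    then have "n \<otimes>\<^bsub>weyl_group d6_edges\<^esub> \<theta> = n \<circ> \<theta>"
      using \<open>bij n\<close> unfolding weyl_group_def by (intro subgroup_generated_BijGroup_mult)
    then have "(\<pi>, n) \<otimes>\<^bsub>extended_weyl_group d6_edges\<^esub> (\<rho>, m) = (\<pi> \<circ> \<rho>, n \<circ> \<theta>)"
      using diagram_aut_mult[OF \<pi>(1) \<rho>(1)]
      by (simp add: extended_weyl_group_def semidirect_product_def \<theta>_def)
    moreover have "\<Phi> (\<pi> \<circ> \<rho>, n \<circ> \<theta>) = \<Phi> (\<pi>, n) \<circ> \<Phi> (\<rho>, m)"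
      unfolding \<Phi>_def prod.case
    proof (rule lattice_lift_eq)
      show "lattice_lift (n \<circ> permute_basis \<pi>) \<circ> lattice_lift (m \<circ> permute_basis \<rho>) \<in> star_stabilizer"
        using star_stabilizer_closed(2)[OF \<Phi>(1)[OF \<pi>n] \<Phi>(1)[OF \<rho>m]] by (simp only: \<Phi>_def prod.case)
      have "\<theta> (permute_basis (\<pi> \<circ> \<rho>) c) = permute_basis \<pi> (m (permute_basis \<rho> c))" for c
        using fun_cong[OF permute_basis_inv(1)[OF \<pi>(2)], of "permute_basis \<rho> c"]
        unfolding \<theta>_def permute_basis_comp[OF \<pi>(2) \<rho>(2)] by simp
      then show "lattice_lift (n \<circ> permute_basis \<pi>) \<circ> lattice_lift (m \<circ> permute_basis \<rho>) \<circ> root_embed =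
          root_embed \<circ> (n \<circ> \<theta> \<circ> permute_basis (\<pi> \<circ> \<rho>))"
        using fun_cong[OF \<Phi>(2)[OF \<pi>n]] fun_cong[OF \<Phi>(2)[OF \<rho>m]]
        by (simp add: fun_eq_iff \<Phi>_def)
    qed
    ultimately show ?thesis by (simp only:)
  qed
  show ?thesis
    unfolding \<Phi>_def(1)[symmetric]
  proof (rule isoI)
    show "\<Phi> \<in> hom (extended_weyl_group d6_edges) (W_E8\<lparr>carrier := star_stabilizer\<rparr>)"
    proof (rule homI)
      fix x y assume x: "x \<in> carrier (extended_weyl_group d6_edges)"
        and y: "y \<in> carrier (extended_weyl_group d6_edges)"
      show "\<Phi> x \<in> carrier (W_E8\<lparr>carrier := star_stabilizer\<rparr>)" using \<Phi>(1) x by (cases x) simp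
      have "\<Phi> x \<in> star_stabilizer" "\<Phi> y \<in> star_stabilizer" using \<Phi>(1) x y by (cases x; cases y; simp)+
      then have "\<Phi> x \<otimes>\<^bsub>W_E8\<^esub> \<Phi> y = \<Phi> x \<circ> \<Phi> y" by (simp add: W_E8_mult star_stabilizer_def)
      then show "\<Phi> (x \<otimes>\<^bsub>extended_weyl_group d6_edges\<^esub> y) = \<Phi> x \<otimes>\<^bsub>W_E8\<lparr>carrier := star_stabilizer\<rparr>\<^esub> \<Phi> y"
        using mult x y by (cases x; cases y) simp
    qed
    show "bij_betw \<Phi> (carrier (extended_weyl_group d6_edges)) (carrier (W_E8\<lparr>carrier :=
      star_stabilizer\<rparr>))"
      unfolding bij_betw_def
    proof
      show "inj_on \<Phi> (carrier (extended_weyl_group d6_edges))"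
      proof (rule inj_onI, clarify)
        fix \<pi> n \<rho> m
        assume \<pi>n: "(\<pi>, n) \<in> carrier (extended_weyl_group d6_edges)"
          and \<rho>m: "(\<rho>, m) \<in> carrier (extended_weyl_group d6_edges)"
          and eq: "\<Phi> (\<pi>, n) = \<Phi> (\<rho>, m)"
        have \<pi>: "is_diagram_aut \<pi>" "bij \<pi>" and \<rho>: "is_diagram_aut \<rho>" "bij \<rho>" and "bij n" "bij m"
          and n: "n \<in> carrier (weyl_group d6_edges)" and m: "m \<in> carrier (weyl_group d6_edges)"
          using \<pi>n \<rho>m unfolding carrier by (auto simp: is_diagram_aut_def weyl_group_closed(1))
        have "root_embed (n (permute_basis \<pi> c)) = root_embed (m (permute_basis \<rho> c))" for c
          using fun_cong[OF \<Phi>(2)[OF \<pi>n], of c] fun_cong[OF \<Phi>(2)[OF \<rho>m], of c] eq by simp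
        then have nm: "n (permute_basis \<pi> c) = m (permute_basis \<rho> c)" for c
          by (simp add: root_embed_inject)
        \<comment> \<open>The pair \<open>(\<kappa>, k)\<close> acts trivially on the root lattice.\<close>
        define \<kappa> where "\<kappa> = \<pi> \<circ> inv_into UNIV \<rho>"
        define k where "k = inv_into UNIV m \<circ> n"
        have "(\<kappa>, k) \<in> carrier (extended_weyl_group d6_edges)"
          unfolding carrier \<kappa>_def k_def
          using n m \<pi>(1) \<rho>(1) by (intro conjI weyl_group_closed is_diagram_aut_comp is_diagram_aut_inv)
        note \<kappa>k = \<Phi>(2,3)[OF this]
        have "k (permute_basis \<kappa> c) = c" for c
        proof -
          have "permute_basis \<kappa> c = permute_basis \<pi> (permute_basis (inv_into UNIV \<rho>) c)"
            using permute_basis_comp[OF \<pi>(2) bij_imp_bij_inv[OF \<rho>(2)]] by (simp add: \<kappa>_def)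
          moreover have "permute_basis \<rho> (permute_basis (inv_into UNIV \<rho>) c) = c"
            using fun_cong[OF permute_basis_inv(2)[OF \<rho>(2)], of c] by simp
          ultimately show ?thesis
            using nm \<open>bij m\<close> by (simp add: k_def bij_is_inj)
        qed
        then have "\<Phi> (\<kappa>, k) = id"
          using star_stabilizer_closed(1) by (simp add: \<Phi>_def lattice_lift_eq fun_eq_iff)
        then have "\<kappa> = id" using \<kappa>k(2) by simp
        from fun_cong[OF this] have "\<pi> (inv_into UNIV \<rho> (\<rho> i)) = \<rho> i" for i
          by (simp add: \<kappa>_def)
        then have "\<pi> i = \<rho> i" for i using bij_is_inj[OF \<rho>(2)] by simp
        then have "\<pi> = \<rho>" by (rule ext)
        moreover have "n = m"
        proof
          fix c
          obtain b where "c = permute_basis \<rho> b"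
            using bij_permute_basis[OF \<rho>(2)] by (metis bij_is_surj surjD)
          then show "n c = m c" using nm[of b] \<open>\<pi> = \<rho>\<close> by simp
        qed
        ultimately show "\<pi> = \<rho> \<and> n = m" by simp
      qed
      show "\<Phi> ` carrier (extended_weyl_group d6_edges) = carrier (W_E8\<lparr>carrier := star_stabilizer\<rparr>)"
      proof
        show "\<Phi> ` carrier (extended_weyl_group d6_edges) \<subseteq> carrier (W_E8\<lparr>carrier := star_stabilizer\<rparr>)"
          using \<Phi>(1) by auto
        show "carrier (W_E8\<lparr>carrier := star_stabilizer\<rparr>) \<subseteq> \<Phi> ` carrier (extended_weyl_group d6_edges)"
        proof
          fix w assume "w \<in> carrier (W_E8\<lparr>carrier := star_stabilizer\<rparr>)"
          then have w: "w \<in> star_stabilizer" by simp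
          then obtain n \<pi> where n: "n \<in> carrier (weyl_group d6_edges)" "is_diagram_aut \<pi>"
            "w \<circ> root_embed = root_embed \<circ> (n \<circ> permute_basis \<pi>)"
            using star_stabilizer_decomposition by blast
          then have "\<Phi> (\<pi>, n) = w" using w by (simp add: \<Phi>_def lattice_lift_eq)
          then show "w \<in> \<Phi> ` carrier (extended_weyl_group d6_edges)"
            using n carrier by blast
        qed
      qed
    qed
  qed
qed

theorem theorem4p3:
  fixes \<tau> :: complex
  assumes "Im \<tau> \<noteq> 0"
  shows
    "subgroup (preserving_star \<tau>) W_E8 \<and>
     (\<exists>\<Phi> \<in> iso (extended_weyl_group d6_edges) (W_E8\<lparr>carrier := preserving_star \<tau>\<rparr>).
        (\<forall>i. \<Phi> (id, simple_reflection d6_edges i) = reflection (beta i)) \<and>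
        \<Phi> (sigma1_node, id) = sigma1 \<and>
        \<Phi> (sigma2_node, id) = sigma2) \<and>

     beta N0 = alpha 0 \<and>
     beta N1 = alpha 6 \<and>
     beta N2 = alpha 2 + alpha 3 + alpha 4 + alpha 5 \<and>
     beta N3 = alpha 1 \<and>
     beta N4 = alpha 0 + alpha 2 + 2 *s alpha 3 + alpha 4 + alpha 5 + alpha 6 + alpha 7 \<and>
     beta N5 = alpha 4 \<and>
     beta N6 = alpha 8 \<and>
     (\<forall>i j. beta i \<odot> beta j = - cartan d6_edges i j) \<and>

     (\<exists>\<Psi> \<in> iso (presented_group dihedral_D4) (diagram_aut_group d6_edges).
        \<Psi> (word_class dihedral_D4 (gen_word S1)) = sigma1_node \<and>
        \<Psi> (word_class dihedral_D4 (gen_word S2)) = sigma2_node) \<and>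
     (\<forall>i. sigma1 (beta i) = beta (sigma1_node i)) \<and>
     (\<forall>i. sigma2 (beta i) = beta (sigma2_node i)) \<and>

     phi_pull (beta N0) = - beta N5 \<and>
     phi_pull (beta N1) = - beta N6 \<and>
     phi_pull (beta N2) = - beta N3 - beta N4 \<and>
     phi_pull (beta N3) = beta N3 + 2 *s beta N4 + beta N5 + beta N6 \<and>
     phi_pull (beta N4) = beta N0 + beta N1 + beta N2 + beta N3 \<and>
     phi_pull (beta N5) = - beta N0 \<and>
     phi_pull (beta N6) = - beta N1 \<and>
     \<not> is_translation_QB phi_pull \<and>

     is_translation_QB (phi_pull ^^ 2) \<and>
     (phi_pull ^^ 2) (beta N0) = beta N0 \<and>
     (phi_pull ^^ 2) (beta N1) = beta N1 \<and>
     (phi_pull ^^ 2) (beta N2) = beta N2 - delta \<and>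
     (phi_pull ^^ 2) (beta N3) = beta N3 + delta \<and>
     (phi_pull ^^ 2) (beta N4) = beta N4 \<and>
     (phi_pull ^^ 2) (beta N5) = beta N5 \<and>
     (phi_pull ^^ 2) (beta N6) = beta N6 \<and>
     delta = beta N0 + beta N1 + 2 *s beta N2 + 2 *s beta N3 + 2 *s beta N4 + beta N5 + beta N6 \<and>

     (let w = (\<lambda>i. reflection (beta i)) in
        phi_pull =
          (sigma1 ^^ 3) \<circ> w N6 \<circ> w N5 \<circ> w N3 \<circ> w N2 \<circ> w N1 \<circ> w N0 \<circ> w N2 \<circ> w N1 \<circ> w N0 \<and>
        phi_push =
          w N0 \<circ> w N1 \<circ> w N2 \<circ> w N0 \<circ> w N1 \<circ> w N2 \<circ> w N3 \<circ> w N5 \<circ> w N6 \<circ> sigma1 \<and>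
        phi_pull ^^ 2 =
          (sigma1 ^^ 2) \<circ> w N3 \<circ> w N4 \<circ> w N6 \<circ> w N5 \<circ> w N4 \<circ> w N3 \<circ> w N2 \<circ> w N1 \<circ> w N0 \<circ> w N2 \<and>
        phi_push ^^ 2 =
          w N2 \<circ> w N0 \<circ> w N1 \<circ> w N2 \<circ> w N3 \<circ> w N4 \<circ> w N5 \<circ> w N6 \<circ> w N4 \<circ> w N3 \<circ> (sigma1 ^^ 2)) \<and>

     (sigma1 ^^ 2) (beta N0) = beta N1 \<and>
     (sigma1 ^^ 2) (beta N1) = beta N0 \<and>
     (sigma1 ^^ 2) (beta N2) = beta N2 \<and>
     (sigma1 ^^ 2) (beta N3) = beta N3 \<and>
     (sigma1 ^^ 2) (beta N4) = beta N4 \<and>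
     (sigma1 ^^ 2) (beta N5) = beta N6 \<and>
     (sigma1 ^^ 2) (beta N6) = beta N5"
proof -
  have iso: "\<exists>\<Phi> \<in> iso (extended_weyl_group d6_edges) (W_E8\<lparr>carrier := star_stabilizer\<rparr>).
        (\<forall>i. \<Phi> (id, simple_reflection d6_edges i) = reflection (beta i)) \<and>
        \<Phi> (sigma1_node, id) = sigma1 \<and> \<Phi> (sigma2_node, id) = sigma2"
    using extended_lift_iso extended_lift_generators by blast
  have cartan: "\<forall>i j. beta i \<odot> beta j = - cartan d6_edges i j"
    using beta_intersection by blast
  show ?thesis
    unfolding preserving_star_eq Let_def
    by (intro conjI; fact star_stabilizer_subgroup iso cartan explicit_root_identities dihedral_presentation
        phi_pull_not_translation phi_pull_square_translation phi_factorizations)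
qed

end
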